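(* Let $p$ be a prime and let $G$ be a finite $p$-group of nilpotency class $5$. If $p$ is odd, then $\exp(G\wedge G)\mid \exp(G)$. In particular, $\exp(M(G))\mid \exp(G)$.
   Context: $\exp(X)$ denotes the exponent of a group $X$. Write ${}^g h=ghg^{-1}$. The nonabelian tensor square $G\otimes G$ is the group generated by symbols $g\otimes h$ ($g,h\in G$) subject to the relations $gg'\otimes h=({}^g g'\otimes {}^g h)(g\otimes h)$ and $g\otimes hh'=(g\otimes h)({}^h g\otimes {}^h h')$ for all $g,g',h,h'\in G$. The (nonabelian) exterior square is $G\wedge G=(G\otimes G)/\nabla(G)$, where $\nabla(G)$ is the subgroup generated by all $x\otimes x$, $x\in G$. The Schur multiplier is $M(G)=H_2(G,\mathbb{Z})$; it is isomorphic to the kernel of the homomorphism $G\wedge G\to [G,G]$, $g\wedge h\mapsto [g,h]=ghg^{-1}h^{-1}$. *)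

theory Defs
  imports "HOL-Algebra.Free_Abelian_Groups" "HOL-Algebra.Generated_Groups" "HOL-Algebra.Elementary_Groups"
    "HOL-Computational_Algebra.Primes"
begin

section \<open>Exponent and nilpotency class\<close>

text \<open>The exponent is \<open>0\<close> exactly when no positive power kills the group, which
  matches divisibility: \<open>n\<close> is a multiple of the exponent iff \<open>x\<^sup>n = 1\<close> for all \<open>x\<close>.\<close>

definition group_exponent :: "('a, 'b) monoid_scheme \<Rightarrow> nat" where
  "group_exponent G =
     (if \<exists>n>0. \<forall>x\<in>carrier G. x [^]\<^bsub>G\<^esub> (n::nat) = \<one>\<^bsub>G\<^esub>
      then LEAST n. n > 0 \<and> (\<forall>x\<in>carrier G. x [^]\<^bsub>G\<^esub> (n::nat) = \<one>\<^bsub>G\<^esub>)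
      else 0)"

definition conjugate :: "('a, 'b) monoid_scheme \<Rightarrow> 'a \<Rightarrow> 'a \<Rightarrow> 'a" where
  "conjugate G g h = g \<otimes>\<^bsub>G\<^esub> h \<otimes>\<^bsub>G\<^esub> inv\<^bsub>G\<^esub> g"

definition commutator :: "('a, 'b) monoid_scheme \<Rightarrow> 'a \<Rightarrow> 'a \<Rightarrow> 'a" where
  "commutator G g h = g \<otimes>\<^bsub>G\<^esub> h \<otimes>\<^bsub>G\<^esub> inv\<^bsub>G\<^esub> g \<otimes>\<^bsub>G\<^esub> inv\<^bsub>G\<^esub> h"

text \<open>Indexed from \<open>0\<close>: \<open>lower_central_series G n\<close> is the term usually written
  \<open>\<gamma>\<close> with subscript \<open>n + 1\<close>.\<close>

primrec lower_central_series :: "('a, 'b) monoid_scheme \<Rightarrow> nat \<Rightarrow> 'a set" where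
  "lower_central_series G 0 = carrier G"
| "lower_central_series G (Suc n) =
     generate G {commutator G x y | x y. x \<in> lower_central_series G n \<and> y \<in> carrier G}"

definition has_nilpotency_class :: "('a, 'b) monoid_scheme \<Rightarrow> nat \<Rightarrow> bool" where
  "has_nilpotency_class G c \<longleftrightarrow>
     lower_central_series G c = {\<one>\<^bsub>G\<^esub>} \<and>
     (\<forall>d<c. lower_central_series G d \<noteq> {\<one>\<^bsub>G\<^esub>})"

definition finite_p_group :: "nat \<Rightarrow> ('a, 'b) monoid_scheme \<Rightarrow> bool" where
  "finite_p_group p G \<longleftrightarrow> group G \<and> finite (carrier G) \<and> (\<exists>n. order G = p ^ n)"


section \<open>Groups given by generators and relations\<close>

text \<open>A letter \<open>(True, x)\<close> stands for the generator \<open>x\<close>, and \<open>(False, x)\<close> for its formal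
  inverse. A pair \<open>(u, v)\<close> of words in \<open>R\<close> is the relation \<open>u = v\<close>.\<close>

type_synonym 'x word = "(bool \<times> 'x) list"

definition words :: "'x set \<Rightarrow> 'x word set" where
  "words X = lists (UNIV \<times> X)"

inductive word_eq :: "'x set \<Rightarrow> ('x word \<times> 'x word) set \<Rightarrow> 'x word \<Rightarrow> 'x word \<Rightarrow> bool"
  for X :: "'x set" and R :: "('x word \<times> 'x word) set" where
  refl: "u \<in> words X \<Longrightarrow> word_eq X R u u"
| sym: "word_eq X R u v \<Longrightarrow> word_eq X R v u"
| trans: "word_eq X R u v \<Longrightarrow> word_eq X R v w \<Longrightarrow> word_eq X R u w"
| append: "word_eq X R u u' \<Longrightarrow> word_eq X R v v' \<Longrightarrow> word_eq X R (u @ v) (u' @ v')"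
| cancel: "x \<in> X \<Longrightarrow> word_eq X R [(b, x), (\<not> b, x)] []"
| rel: "(u, v) \<in> R \<Longrightarrow> u \<in> words X \<Longrightarrow> v \<in> words X \<Longrightarrow> word_eq X R u v"

definition word_class :: "'x set \<Rightarrow> ('x word \<times> 'x word) set \<Rightarrow> 'x word \<Rightarrow> 'x word set" where
  "word_class X R u = {v. word_eq X R u v}"

definition presented_group :: "'x set \<Rightarrow> ('x word \<times> 'x word) set \<Rightarrow> 'x word set monoid" where
  "presented_group X R =
     \<lparr>carrier = word_class X R ` words X,
      monoid.mult = (\<lambda>A B. \<Union>u\<in>A. \<Union>v\<in>B. word_class X R (u @ v)),
      monoid.one = word_class X R []\<rparr>"

lemma word_eq_words: "word_eq X R u v \<Longrightarrow> u \<in> words X \<and> v \<in> words X"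
  by (induction rule: word_eq.induct) (auto simp: words_def)

lemma word_class_eqI:
  assumes "word_eq X R u v"
  shows "word_class X R u = word_class X R v"
  unfolding word_class_def
proof (rule Collect_cong)
  show "word_eq X R u w \<longleftrightarrow> word_eq X R v w" for w
    using word_eq.trans[OF assms, of w] word_eq.trans[OF word_eq.sym[OF assms], of w] by blast
qed

lemma word_class_eq_iff:
  assumes "u \<in> words X"
  shows "word_class X R u = word_class X R v \<longleftrightarrow> word_eq X R u v"
proof
  assume "word_class X R u = word_class X R v"
  moreover have "u \<in> word_class X R u"
    using word_eq.refl[OF assms] by (simp add: word_class_def)
  ultimately have "word_eq X R v u"
    by (simp add: word_class_def)
  then show "word_eq X R u v" by (rule word_eq.sym)
qed (rule word_class_eqI)

lemma presented_group_mult: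
  assumes "u \<in> words X" "v \<in> words X"
  shows "word_class X R u \<otimes>\<^bsub>presented_group X R\<^esub> word_class X R v = word_class X R (u @ v)"
proof -
  have eq: "word_class X R (u' @ v') = word_class X R (u @ v)"
    if "u' \<in> word_class X R u" "v' \<in> word_class X R v" for u' v'
    using that unfolding mem_Collect_eq word_class_def[of X R u] word_class_def[of X R v]
    by (metis word_class_eqI word_eq.append)
  have "u \<in> word_class X R u" "v \<in> word_class X R v"
    using assms by (simp_all add: word_class_def word_eq.refl)
  then have ne: "word_class X R u \<noteq> {}" "word_class X R v \<noteq> {}" by blast+
  have "(\<Union>u'\<in>word_class X R u. \<Union>v'\<in>word_class X R v. word_class X R (u' @ v')) =
      (\<Union>u'\<in>word_class X R u. \<Union>v'\<in>word_class X R v. word_class X R (u @ v))"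
    using eq by (simp cong: SUP_cong_simp)
  also have "\<dots> = word_class X R (u @ v)"
    using ne by simp
  finally show ?thesis by (simp add: presented_group_def)
qed

lemma presented_group_inverse:
  assumes "u \<in> words X"
  shows "\<exists>v\<in>words X. word_eq X R (v @ u) []"
  using assms
proof (induction u)
  case Nil
  then show ?case by (auto intro!: bexI[of _ "[]"] word_eq.refl simp: words_def)
next
  case (Cons a u)
  obtain b x where a: "a = (b, x)" by (cases a)
  have x: "x \<in> X" and u: "u \<in> words X"
    using Cons.prems a by (auto simp: words_def)
  obtain v where v: "v \<in> words X" "word_eq X R (v @ u) []"
    using Cons.IH u by blast
  have "word_eq X R (v @ ([(\<not> b, x), (b, x)] @ u)) (v @ ([] @ u))"
    using word_eq.cancel[OF x, of R "\<not> b"] v(1) u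
    by (intro word_eq.append word_eq.refl) auto
  then have "word_eq X R ((v @ [(\<not> b, x)]) @ a # u) []"
    using word_eq.trans[OF _ v(2)] a by simp
  moreover have "v @ [(\<not> b, x)] \<in> words X"
    using v(1) x by (auto simp: words_def)
  ultimately show ?case by blast
qed

lemma group_presented_group: "group (presented_group X R)"
proof (rule groupI)
  have carr: "carrier (presented_group X R) = word_class X R ` words X"
    and one: "\<one>\<^bsub>presented_group X R\<^esub> = word_class X R []"
    by (simp_all add: presented_group_def)
  have app: "u @ v \<in> words X" if "u \<in> words X" "v \<in> words X" for u v :: "'a word"
    using that by (auto simp: words_def)
  have nil: "[] \<in> words X" by (simp add: words_def)
  show "\<one>\<^bsub>presented_group X R\<^esub> \<in> carrier (presented_group X R)"
    using nil by (simp add: carr one)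
  fix A B C
  assume A: "A \<in> carrier (presented_group X R)"
  show "\<one>\<^bsub>presented_group X R\<^esub> \<otimes>\<^bsub>presented_group X R\<^esub> A = A"
    using A nil by (auto simp: carr one presented_group_mult)
  show "\<exists>y\<in>carrier (presented_group X R). y \<otimes>\<^bsub>presented_group X R\<^esub> A = \<one>\<^bsub>presented_group X R\<^esub>"
  proof -
    obtain u where u: "u \<in> words X" "A = word_class X R u" using A by (auto simp: carr)
    obtain v where v: "v \<in> words X" "word_eq X R (v @ u) []"
      using presented_group_inverse[OF u(1)] by blast
    then have "word_class X R v \<otimes>\<^bsub>presented_group X R\<^esub> A = \<one>\<^bsub>presented_group X R\<^esub>"
      using u app by (simp add: presented_group_mult one word_class_eq_iff)
    with v(1) show ?thesis by (auto simp: carr)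
  qed
  assume B: "B \<in> carrier (presented_group X R)"
  show "A \<otimes>\<^bsub>presented_group X R\<^esub> B \<in> carrier (presented_group X R)"
    using A B app by (auto simp: carr presented_group_mult)
  assume "C \<in> carrier (presented_group X R)"
  then show "A \<otimes>\<^bsub>presented_group X R\<^esub> B \<otimes>\<^bsub>presented_group X R\<^esub> C =
      A \<otimes>\<^bsub>presented_group X R\<^esub> (B \<otimes>\<^bsub>presented_group X R\<^esub> C)"
    using A B app by (auto simp: carr presented_group_mult)
qed


section \<open>Nonabelian tensor square and exterior square\<close>

text \<open>The generator \<open>(g, h)\<close> is the symbol \<open>g \<otimes> h\<close>.\<close>

definition tensor_generators :: "('a, 'b) monoid_scheme \<Rightarrow> ('a \<times> 'a) set" where
  "tensor_generators G = carrier G \<times> carrier G"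

definition tensor_relations :: "('a, 'b) monoid_scheme \<Rightarrow> (('a \<times> 'a) word \<times> ('a \<times> 'a) word) set" where
  "tensor_relations G =
     {([(True, (g \<otimes>\<^bsub>G\<^esub> g', h))],
       [(True, (conjugate G g g', conjugate G g h)), (True, (g, h))])
      | g g' h. g \<in> carrier G \<and> g' \<in> carrier G \<and> h \<in> carrier G}
   \<union> {([(True, (g, h \<otimes>\<^bsub>G\<^esub> h'))],
       [(True, (g, h)), (True, (conjugate G h g, conjugate G h h'))])
      | g h h'. g \<in> carrier G \<and> h \<in> carrier G \<and> h' \<in> carrier G}"

definition tensor_square :: "('a, 'b) monoid_scheme \<Rightarrow> ('a \<times> 'a) word set monoid" where
  "tensor_square G = presented_group (tensor_generators G) (tensor_relations G)"

definition tensor_symbol :: "('a, 'b) monoid_scheme \<Rightarrow> 'a \<Rightarrow> 'a \<Rightarrow> ('a \<times> 'a) word set" where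
  "tensor_symbol G g h = word_class (tensor_generators G) (tensor_relations G) [(True, (g, h))]"

definition nabla :: "('a, 'b) monoid_scheme \<Rightarrow> ('a \<times> 'a) word set set" where
  "nabla G = generate (tensor_square G) {tensor_symbol G x x | x. x \<in> carrier G}"

text \<open>The subgroup \<open>nabla G\<close> is central in the tensor square when \<open>G\<close> is a group, a standard fact not
  proved here; so the quotient below is a group.\<close>

definition exterior_square :: "('a, 'b) monoid_scheme \<Rightarrow> ('a \<times> 'a) word set set monoid" where
  "exterior_square G = tensor_square G Mod nabla G"

lemma group_tensor_square: "group (tensor_square G)"
  unfolding tensor_square_def by (rule group_presented_group)

lemma tensor_symbol_closed:
  "g \<in> carrier G \<Longrightarrow> h \<in> carrier G \<Longrightarrow> tensor_symbol G g h \<in> carrier (tensor_square G)"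
  by (auto simp: tensor_symbol_def tensor_square_def presented_group_def
      words_def tensor_generators_def)

lemma tensor_symbol_mult_left:
  assumes "group G" "g \<in> carrier G" "g' \<in> carrier G" "h \<in> carrier G"
  shows "tensor_symbol G (g \<otimes>\<^bsub>G\<^esub> g') h =
    tensor_symbol G (conjugate G g g') (conjugate G g h) \<otimes>\<^bsub>tensor_square G\<^esub> tensor_symbol G g h"
proof -
  interpret group G by fact
  have cl: "conjugate G g x \<in> carrier G" if "x \<in> carrier G" for x
    using that assms by (simp add: conjugate_def)
  have "word_eq (tensor_generators G) (tensor_relations G) [(True, (g \<otimes>\<^bsub>G\<^esub> g', h))]
      [(True, (conjugate G g g', conjugate G g h)), (True, (g, h))]"
    using assms cl
    by (intro word_eq.rel) (auto simp: tensor_relations_def words_def tensor_generators_def)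
  then show ?thesis
    using assms cl unfolding tensor_symbol_def tensor_square_def
    by (subst presented_group_mult) (auto simp: word_class_eq_iff words_def tensor_generators_def)
qed

lemma tensor_symbol_mult_right:
  assumes "group G" "g \<in> carrier G" "h \<in> carrier G" "h' \<in> carrier G"
  shows "tensor_symbol G g (h \<otimes>\<^bsub>G\<^esub> h') =
    tensor_symbol G g h \<otimes>\<^bsub>tensor_square G\<^esub> tensor_symbol G (conjugate G h g) (conjugate G h h')"
proof -
  interpret group G by fact
  have cl: "conjugate G h x \<in> carrier G" if "x \<in> carrier G" for x
    using that assms by (simp add: conjugate_def)
  have "word_eq (tensor_generators G) (tensor_relations G) [(True, (g, h \<otimes>\<^bsub>G\<^esub> h'))]
      [(True, (g, h)), (True, (conjugate G h g, conjugate G h h'))]"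
    using assms cl
    by (intro word_eq.rel) (auto simp: tensor_relations_def words_def tensor_generators_def)
  then show ?thesis
    using assms cl unfolding tensor_symbol_def tensor_square_def
    by (subst presented_group_mult) (auto simp: word_class_eq_iff words_def tensor_generators_def)
qed


section \<open>Schur multiplier\<close>

text \<open>\<open>H\<^sub>2(G, \<int>)\<close> is computed from the (unnormalised) bar resolution. After tensoring with the
  trivial module \<open>\<int>\<close>, the degree \<open>n\<close> part is free abelian on the \<open>n\<close>-tuples \<open>[x\<^sub>1 | \<dots> | x\<^sub>n]\<close>, and
  the boundary maps in degrees \<open>2\<close> and \<open>3\<close> are
  \<open>[x | y] \<mapsto> [y] - [x y] + [x]\<close> and
  \<open>[x | y | z] \<mapsto> [y | z] - [x y | z] + [x | y z] - [x | y]\<close>.\<close>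

definition bar_boundary2 :: "('a, 'b) monoid_scheme \<Rightarrow> ('a \<times> 'a \<Rightarrow>\<^sub>0 int) \<Rightarrow> ('a \<Rightarrow>\<^sub>0 int)" where
  "bar_boundary2 G =
     frag_extend (\<lambda>(x, y). frag_of y - frag_of (x \<otimes>\<^bsub>G\<^esub> y) + frag_of x)"

definition bar_boundary3 ::
    "('a, 'b) monoid_scheme \<Rightarrow> ('a \<times> 'a \<times> 'a \<Rightarrow>\<^sub>0 int) \<Rightarrow> ('a \<times> 'a \<Rightarrow>\<^sub>0 int)" where
  "bar_boundary3 G =
     frag_extend (\<lambda>(x, y, z). frag_of (y, z) - frag_of (x \<otimes>\<^bsub>G\<^esub> y, z)
                              + frag_of (x, y \<otimes>\<^bsub>G\<^esub> z) - frag_of (x, y))"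

definition bar_cycles2 :: "('a, 'b) monoid_scheme \<Rightarrow> ('a \<times> 'a \<Rightarrow>\<^sub>0 int) set" where
  "bar_cycles2 G = kernel (free_Abelian_group (carrier G \<times> carrier G))
                          (free_Abelian_group (carrier G)) (bar_boundary2 G)"

definition bar_boundaries2 :: "('a, 'b) monoid_scheme \<Rightarrow> ('a \<times> 'a \<Rightarrow>\<^sub>0 int) set" where
  "bar_boundaries2 G =
     bar_boundary3 G ` carrier (free_Abelian_group (carrier G \<times> carrier G \<times> carrier G))"

definition schur_multiplier :: "('a, 'b) monoid_scheme \<Rightarrow> ('a \<times> 'a \<Rightarrow>\<^sub>0 int) set monoid" where
  "schur_multiplier G =
     subgroup_generated (free_Abelian_group (carrier G \<times> carrier G)) (bar_cycles2 G)
       Mod bar_boundaries2 G"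

lemma subgroup_bar_cycles2:
  assumes "group G"
  shows "subgroup (bar_cycles2 G) (free_Abelian_group (carrier G \<times> carrier G))"
proof -
  interpret group G by fact
  have keys: "Poly_Mapping.keys (bar_boundary2 G c) \<subseteq> carrier G"
    if "Poly_Mapping.keys c \<subseteq> carrier G \<times> carrier G" for c
  proof -
    have *: "Poly_Mapping.keys (frag_of y - frag_of (x \<otimes>\<^bsub>G\<^esub> y) + frag_of x) \<subseteq> carrier G"
      if "x \<in> carrier G" "y \<in> carrier G" for x y
      using that by (auto dest!: subsetD[OF keys_diff] subsetD[OF keys_add])
    show ?thesis
      unfolding bar_boundary2_def
    proof (rule subset_trans[OF keys_frag_extend], rule UN_least)
      fix t assume "t \<in> Poly_Mapping.keys c"
      with that obtain x y where "t = (x, y)" "x \<in> carrier G" "y \<in> carrier G" by blast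
      with * show "Poly_Mapping.keys (case t of (x, y) \<Rightarrow>
          frag_of y - frag_of (x \<otimes>\<^bsub>G\<^esub> y) + frag_of x) \<subseteq> carrier G" by simp
    qed
  qed
  have "group_hom (free_Abelian_group (carrier G \<times> carrier G)) (free_Abelian_group (carrier G))
      (bar_boundary2 G)"
    using keys unfolding group_hom_def group_hom_axioms_def
    by (auto simp: hom_def bar_boundary2_def frag_extend_add)
  then show ?thesis
    unfolding bar_cycles2_def by (rule group_hom.subgroup_kernel)
qed

lemma bar_boundaries2_subset_cycles2:
  assumes "group G"
  shows "bar_boundaries2 G \<subseteq> bar_cycles2 G"
proof -
  interpret group G by fact
  have "bar_boundary2 G (bar_boundary3 G c) = 0 \<and>
      Poly_Mapping.keys (bar_boundary3 G c) \<subseteq> carrier G \<times> carrier G"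
    if "Poly_Mapping.keys c \<subseteq> carrier G \<times> carrier G \<times> carrier G" for c
    using that
  proof (induction c rule: frag_induction)
    case zero
    then show ?case by (simp add: bar_boundary2_def bar_boundary3_def)
  next
    case (one t)
    obtain x y z where t: "t = (x, y, z)" by (cases t) auto
    have xyz: "x \<in> carrier G" "y \<in> carrier G" "z \<in> carrier G" using one t by auto
    have "Poly_Mapping.keys (bar_boundary3 G (frag_of t)) \<subseteq> carrier G \<times> carrier G"
      using xyz unfolding t bar_boundary3_def
      by (auto dest!: subsetD[OF keys_diff] subsetD[OF keys_add])
    with xyz show ?case
      by (simp add: t bar_boundary2_def bar_boundary3_def frag_extend_diff frag_extend_add m_assoc)
  next
    case (diff a b)
    then show ?case
      using keys_diff[of "bar_boundary3 G a" "bar_boundary3 G b"]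
      by (auto simp: bar_boundary2_def bar_boundary3_def frag_extend_diff)
  qed
  then show ?thesis
    unfolding bar_boundaries2_def bar_cycles2_def kernel_def image_subset_iff
    by (simp add: Ball_def)
qed

end

theory Submission
  imports Defs "HOL-Algebra.Multiplicative_Group"
begin

text \<open>
  Let \<open>q\<close> be the exponent of \<open>G\<close>. A group \<open>T\<close> with a pairing \<open>w\<close> subject to the relations of the
  exterior square and a compatible map \<open>d\<close> to \<open>G\<close> behaves like the commutator subgroup of a central
  extension of \<open>G\<close>, with \<open>w g h\<close> in the role of \<open>[g, h]\<close>. If \<open>G\<close> has class \<open>5\<close>, this extension has
  class \<open>6\<close>. It suffices to show \<open>t\<^sup>q = 1\<close> for all \<open>t\<close> in such a \<open>T\<close>: the exterior square is one
  example, and the commutator subgroup of the extension of \<open>G\<close> by \<open>C\<^sub>2 / B\<^sub>2\<close> given by the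
  tautological bar cocycle is another, which contains \<open>H\<^sub>2 = Z\<^sub>2 / B\<^sub>2\<close>.

  Collecting \<open>1 = w (x\<^sup>q) g\<close> expresses \<open>[x, g]\<^sup>q\<close> through longer commutators raised to binomial
  coefficients \<open>q choose k\<close>, essentially \<open>[x,x,x,g]\<close> with exponent \<open>q choose 3\<close>, of
  which only the triple need be divisible by \<open>q\<close>, and \<open>[x,x,x,x,x,g]\<close> with exponent \<open>q choose 5\<close>. These are removed in
  weights \<open>6\<close>, \<open>5\<close>, \<open>4\<close> successively. In each weight the collected relation shows that
  \<open>[\<dots>,x,x,x,g]\<close> to the power \<open>q choose 3\<close> depends only on \<open>w x g\<close>; as \<open>w (x g) g = w x g\<close>, it is unchanged
  under \<open>x \<mapsto> x g\<close>, and comparing the terms quadratic in \<open>g\<close> makes it trivial. Polarizing shows that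
  commutators of length \<open>4\<close> are alternating to that power, and the Jacobi identity then kills the
  whole layer. The remaining term matters only if \<open>5\<close> divides \<open>q\<close>, and falls to the same argument in
  degree \<open>4\<close>. Only that \<open>q\<close> is odd and not divisible by \<open>15\<close> is used.
\<close>

section \<open>Pairings satisfying the relations of the tensor and exterior square\<close>

context group
begin

lemma inv_cancel_left [simp]:
  "x \<in> carrier G \<Longrightarrow> y \<in> carrier G \<Longrightarrow> x \<otimes> (inv x \<otimes> y) = y"
  "x \<in> carrier G \<Longrightarrow> y \<in> carrier G \<Longrightarrow> inv x \<otimes> (x \<otimes> y) = y"
  by (simp_all flip: m_assoc)

lemma conjugate_closed [simp]:
  "x \<in> carrier G \<Longrightarrow> y \<in> carrier G \<Longrightarrow> conjugate G x y \<in> carrier G"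
  by (simp add: conjugate_def)

lemma commutator_closed [simp]:
  "x \<in> carrier G \<Longrightarrow> y \<in> carrier G \<Longrightarrow> commutator G x y \<in> carrier G"
  by (simp add: commutator_def)

lemma conjugate_conjugate:
  "\<lbrakk>x \<in> carrier G; y \<in> carrier G; z \<in> carrier G\<rbrakk> \<Longrightarrow>
    conjugate G x (conjugate G y z) = conjugate G (x \<otimes> y) z"
  by (simp add: conjugate_def m_assoc inv_mult_group)

lemma conjugate_mult:
  "\<lbrakk>x \<in> carrier G; y \<in> carrier G; z \<in> carrier G\<rbrakk> \<Longrightarrow>
    conjugate G x (y \<otimes> z) = conjugate G x y \<otimes> conjugate G x z"
  by (simp add: conjugate_def m_assoc)

lemma conjugate_inv:
  "\<lbrakk>x \<in> carrier G; y \<in> carrier G\<rbrakk> \<Longrightarrow> conjugate G x (inv y) = inv (conjugate G x y)"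
  by (simp add: conjugate_def m_assoc inv_mult_group)

lemma conjugate_one [simp]:
  "x \<in> carrier G \<Longrightarrow> conjugate G x \<one> = \<one>"
  "x \<in> carrier G \<Longrightarrow> conjugate G \<one> x = x"
  by (simp_all add: conjugate_def)

lemma conjugate_commutator:
  "\<lbrakk>x \<in> carrier G; y \<in> carrier G; z \<in> carrier G\<rbrakk> \<Longrightarrow>
    conjugate G x (commutator G y z) = commutator G (conjugate G x y) (conjugate G x z)"
  by (simp add: conjugate_def commutator_def m_assoc inv_mult_group)

lemma commutator_mult_right_eq_conjugate:
  "\<lbrakk>x \<in> carrier G; y \<in> carrier G\<rbrakk> \<Longrightarrow> commutator G x y \<otimes> y = conjugate G x y"
  by (simp add: conjugate_def commutator_def m_assoc)

lemma inv_commutator: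
  "\<lbrakk>x \<in> carrier G; y \<in> carrier G\<rbrakk> \<Longrightarrow> inv (commutator G x y) = commutator G y x"
  by (simp add: commutator_def m_assoc inv_mult_group)

end

text \<open>Working with any such data instead of a presentation treats the tensor square, the
  exterior square and derived subgroups of central extensions at once. As symbols generate
  \<open>T\<close>, identities between homomorphisms need only be checked on
  \<open>w g h\<close>.\<close>

locale tensor_pairing = T: group T + G: group G
  for T (structure) and G :: "('g, 'h) monoid_scheme" +
  fixes w :: "'g \<Rightarrow> 'g \<Rightarrow> 'a" and d :: "'a \<Rightarrow> 'g"
  assumes w_closed [simp]: "g \<in> carrier G \<Longrightarrow> h \<in> carrier G \<Longrightarrow> w g h \<in> carrier T"
    and w_left: "g \<in> carrier G \<Longrightarrow> g' \<in> carrier G \<Longrightarrow> h \<in> carrier G \<Longrightarrow>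
       w (g \<otimes>\<^bsub>G\<^esub> g') h = w (conjugate G g g') (conjugate G g h) \<otimes> w g h"
    and w_right: "g \<in> carrier G \<Longrightarrow> h \<in> carrier G \<Longrightarrow> h' \<in> carrier G \<Longrightarrow>
       w g (h \<otimes>\<^bsub>G\<^esub> h') = w g h \<otimes> w (conjugate G h g) (conjugate G h h')"
    and d_hom: "d \<in> hom T G"
    and d_w: "g \<in> carrier G \<Longrightarrow> h \<in> carrier G \<Longrightarrow> d (w g h) = commutator G g h"
    and T_gen: "carrier T = generate T {w g h | g h. g \<in> carrier G \<and> h \<in> carrier G}"
begin

abbreviation cj where "cj \<equiv> conjugate G"

sublocale d: group_hom T G d
  using d_hom by unfold_locales

lemma w_one [simp]:
  assumes "g \<in> carrier G"
  shows "w \<one>\<^bsub>G\<^esub> g = \<one>" "w g \<one>\<^bsub>G\<^esub> = \<one>"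
  using w_left[of "\<one>\<^bsub>G\<^esub>" "\<one>\<^bsub>G\<^esub>" g] w_right[of g "\<one>\<^bsub>G\<^esub>" "\<one>\<^bsub>G\<^esub>"] assms by simp_all

text \<open>Expand \<open>w (g k) (h l)\<close> in two ways.\<close>

lemma w_commute:
  assumes "g \<in> carrier G" "h \<in> carrier G" "k \<in> carrier G" "l \<in> carrier G"
  shows "w (cj (g \<otimes>\<^bsub>G\<^esub> h) k) (cj (g \<otimes>\<^bsub>G\<^esub> h) l) \<otimes> w g h =
         w g h \<otimes> w (cj (h \<otimes>\<^bsub>G\<^esub> g) k) (cj (h \<otimes>\<^bsub>G\<^esub> g) l)"
proof -
  have c: "cj (cj a b) (cj a c) = cj (a \<otimes>\<^bsub>G\<^esub> b) c"
    if "a \<in> carrier G" "b \<in> carrier G" "c \<in> carrier G" for a b c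
    using that by (simp add: conjugate_def G.m_assoc G.inv_mult_group)
  have "w (g \<otimes>\<^bsub>G\<^esub> k) (h \<otimes>\<^bsub>G\<^esub> l) =
    w (cj g k) (cj g h) \<otimes> w (cj (g \<otimes>\<^bsub>G\<^esub> h) k) (cj (g \<otimes>\<^bsub>G\<^esub> h) l) \<otimes> (w g h \<otimes> w (cj h g) (cj h l))"
    using assms by (simp add: w_left[of g k] w_right[of g h l] w_right[of _ "cj g h" "cj g l"]
        G.conjugate_mult c)
  moreover have "w (g \<otimes>\<^bsub>G\<^esub> k) (h \<otimes>\<^bsub>G\<^esub> l) =
    w (cj g k) (cj g h) \<otimes> w g h \<otimes> (w (cj (h \<otimes>\<^bsub>G\<^esub> g) k) (cj (h \<otimes>\<^bsub>G\<^esub> g) l) \<otimes> w (cj h g) (cj h l))"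
    using assms by (simp add: w_left[of g k] w_right[of _ h l] w_left[of "cj h g" "cj h k"]
        G.conjugate_mult c)
  ultimately show ?thesis
    using assms by (simp add: T.m_assoc) (simp flip: T.m_assoc)
qed

text \<open>This is \<open>w_commute\<close> for \<open>k\<close> and \<open>l\<close> conjugated by
  \<open>(h g)^-1\<close>. Since \<open>(g h)(h g)^-1 = [g, h]\<close>, conjugation by a symbol acts
  through its image under \<open>d\<close>.\<close>

lemma w_conj_w:
  assumes "g \<in> carrier G" "h \<in> carrier G" "k \<in> carrier G" "l \<in> carrier G"
  shows "w g h \<otimes> w k l = w (cj (commutator G g h) k) (cj (commutator G g h) l) \<otimes> w g h"
proof -
  have "cj (g \<otimes>\<^bsub>G\<^esub> h) (cj (inv\<^bsub>G\<^esub> (h \<otimes>\<^bsub>G\<^esub> g)) a) = cj (commutator G g h) a"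
    "cj (h \<otimes>\<^bsub>G\<^esub> g) (cj (inv\<^bsub>G\<^esub> (h \<otimes>\<^bsub>G\<^esub> g)) a) = a" if "a \<in> carrier G" for a
    using assms that by (simp_all add: conjugate_def commutator_def G.m_assoc G.inv_mult_group)
  then show ?thesis
    using w_commute[of g h "cj (inv\<^bsub>G\<^esub> (h \<otimes>\<^bsub>G\<^esub> g)) k" "cj (inv\<^bsub>G\<^esub> (h \<otimes>\<^bsub>G\<^esub> g)) l"] assms by simp
qed

lemma T_induct [consumes 1, case_names one w inv mult]:
  assumes "t \<in> carrier T" and "P \<one>"
    and "\<And>g h. g \<in> carrier G \<Longrightarrow> h \<in> carrier G \<Longrightarrow> P (w g h)"
    and "\<And>g h. g \<in> carrier G \<Longrightarrow> h \<in> carrier G \<Longrightarrow> P (inv (w g h))"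
    and "\<And>t u. t \<in> carrier T \<Longrightarrow> u \<in> carrier T \<Longrightarrow> P t \<Longrightarrow> P u \<Longrightarrow> P (t \<otimes> u)"
  shows "P t"
proof -
  have "t \<in> generate T {w g h | g h. g \<in> carrier G \<and> h \<in> carrier G}"
    using assms(1) T_gen by simp
  then have "t \<in> carrier T \<and> P t"
    by (induction rule: generate.induct) (use assms(2-) in auto)
  then show ?thesis ..
qed

text \<open>Symbols are \<open>w_conj_w\<close>; for their inverses it is applied to
  \<open>k\<close> and \<open>l\<close> conjugated by \<open>[g, h]^-1\<close>, and products follow
  because \<open>d\<close> is a homomorphism.\<close>

lemma conj_w:
  assumes "t \<in> carrier T" "k \<in> carrier G" "l \<in> carrier G"
  shows "t \<otimes> w k l = w (cj (d t) k) (cj (d t) l) \<otimes> t"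
  using assms
proof (induction arbitrary: k l rule: T_induct)
  case (w g h)
  then show ?case using w_conj_w[of g h k l] by (simp add: d_w)
next
  case (inv g h)
  let ?c = "commutator G g h"
  have "w g h \<otimes> w (cj (inv\<^bsub>G\<^esub> ?c) k) (cj (inv\<^bsub>G\<^esub> ?c) l) = w k l \<otimes> w g h"
    using inv by (subst w_conj_w) (simp_all add: G.conjugate_conjugate)
  then have "inv (w g h) \<otimes> (w g h \<otimes> w (cj (inv\<^bsub>G\<^esub> ?c) k) (cj (inv\<^bsub>G\<^esub> ?c) l)) \<otimes> inv (w g h)
      = inv (w g h) \<otimes> (w k l \<otimes> w g h) \<otimes> inv (w g h)"
    by simp
  then show ?case
    using inv by (simp add: d_w T.m_assoc)
next
  case (mult t u)
  have "t \<otimes> u \<otimes> w k l = t \<otimes> (w (cj (d u) k) (cj (d u) l) \<otimes> u)"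
    using mult.prems mult.hyps mult.IH(2)[of k l] by (simp add: T.m_assoc)
  also have "\<dots> = (t \<otimes> w (cj (d u) k) (cj (d u) l)) \<otimes> u"
    using mult.prems mult.hyps by (simp add: T.m_assoc)
  also have "\<dots> = w (cj (d t) (cj (d u) k)) (cj (d t) (cj (d u) l)) \<otimes> t \<otimes> u"
    using mult.prems mult.hyps by (subst mult.IH(1)) simp_all
  finally show ?case
    using mult.prems mult.hyps by (simp add: T.m_assoc G.conjugate_conjugate)
qed simp

section \<open>The action of \<open>G\<close> on \<open>T\<close> and the crossed module
  identities\<close>

definition br where "br x t = w x (d t)"

text \<open>In the model, \<open>br x t\<close> is \<open>[x, t]\<close> and \<open>act x t\<close>
  is \<open>x t x^-1\<close>. Built from \<open>w\<close> and \<open>d\<close>, both are well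
  defined on all of \<open>T\<close> from the start; \<open>act_w\<close> identifies
  \<open>act\<close> as the diagonal action on symbols.\<close>

definition act where "act x t = br x t \<otimes> t"

lemma br_closed [simp]: "x \<in> carrier G \<Longrightarrow> t \<in> carrier T \<Longrightarrow> br x t \<in> carrier T"
  and act_closed [simp]: "x \<in> carrier G \<Longrightarrow> t \<in> carrier T \<Longrightarrow> act x t \<in> carrier T"
  by (simp_all add: act_def br_def)

lemma br_w: "\<lbrakk>x \<in> carrier G; g \<in> carrier G; h \<in> carrier G\<rbrakk> \<Longrightarrow> br x (w g h) = w x (commutator G g h)"
  by (simp add: br_def d_w)

text \<open>Expand \<open>w x ([g,h] h)\<close> and \<open>w (x g) h\<close>, where \<open>x g = g (g\<^sup>-\<^sup>1 x g)\<close>.\<close>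

lemma act_w:
  assumes "x \<in> carrier G" "g \<in> carrier G" "h \<in> carrier G"
  shows "act x (w g h) = w (cj x g) (cj x h)"
proof -
  let ?c = "commutator G g h" and ?x = "cj (inv\<^bsub>G\<^esub> g) x"
  have "w x (?c \<otimes>\<^bsub>G\<^esub> h) = w x ?c \<otimes> w (cj ?c x) (cj ?c h)"
    using assms by (simp add: w_right)
  then have 1: "w x (cj g h) \<otimes> w g h = w x ?c \<otimes> (w g h \<otimes> w x h)"
    using assms w_conj_w[of g h x h] by (simp add: G.commutator_mult_right_eq_conjugate T.m_assoc)
  have "x \<otimes>\<^bsub>G\<^esub> g = g \<otimes>\<^bsub>G\<^esub> ?x" "cj g ?x = x"
    using assms by (simp_all add: conjugate_def G.m_assoc)
  then have "w (x \<otimes>\<^bsub>G\<^esub> g) h = w x (cj g h) \<otimes> w g h"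
    using assms by (simp add: w_left[of g ?x])
  then have "w (cj x g) (cj x h) \<otimes> w x h = w x ?c \<otimes> w g h \<otimes> w x h"
    using assms 1 by (simp add: w_left[of x g] T.m_assoc)
  then show ?thesis
    using assms by (simp add: act_def br_w)
qed

lemma w_mult_left:
  "\<lbrakk>x \<in> carrier G; y \<in> carrier G; z \<in> carrier G\<rbrakk> \<Longrightarrow> w (x \<otimes>\<^bsub>G\<^esub> y) z = act x (w y z) \<otimes> w x z"
  by (simp add: w_left act_w)

lemma w_mult_right:
  "\<lbrakk>x \<in> carrier G; y \<in> carrier G; z \<in> carrier G\<rbrakk> \<Longrightarrow> w x (y \<otimes>\<^bsub>G\<^esub> z) = w x y \<otimes> act y (w x z)"
  by (simp add: w_right act_w)

text \<open>The commutator identity \<open>[x, t u] = [x, t] t [x, u] t^-1\<close>: expand with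
  \<open>w_right\<close>, then recognize conjugation by \<open>t\<close> through
  \<open>conj_w\<close>.\<close>

lemma br_mult:
  assumes "x \<in> carrier G" "t \<in> carrier T" "u \<in> carrier T"
  shows "br x (t \<otimes> u) = br x t \<otimes> (t \<otimes> br x u \<otimes> inv t)"
  using assms conj_w[of t x "d u"] by (simp add: br_def w_right T.m_assoc)

lemma act_mult:
  "\<lbrakk>x \<in> carrier G; t \<in> carrier T; u \<in> carrier T\<rbrakk> \<Longrightarrow> act x (t \<otimes> u) = act x t \<otimes> act x u"
  by (simp add: act_def br_mult T.m_assoc)

lemma act_hom: "x \<in> carrier G \<Longrightarrow> group_hom T T (act x)"
  by unfold_locales (simp add: hom_def act_mult)

lemma act_one [simp]: "x \<in> carrier G \<Longrightarrow> act x \<one> = \<one>"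
  and act_inv: "x \<in> carrier G \<Longrightarrow> t \<in> carrier T \<Longrightarrow> act x (inv t) = inv (act x t)"
  and act_pow: "x \<in> carrier G \<Longrightarrow> t \<in> carrier T \<Longrightarrow> act x (t [^] (n::nat)) = act x t [^] n"
  by (simp_all add: group_hom.hom_one[OF act_hom] group_hom.hom_inv[OF act_hom]
      group_hom.hom_nat_pow[OF act_hom])

lemma act_act:
  assumes "t \<in> carrier T" "x \<in> carrier G" "y \<in> carrier G"
  shows "act (x \<otimes>\<^bsub>G\<^esub> y) t = act x (act y t)"
  using assms by (induction rule: T_induct)
    (simp_all add: act_w act_mult act_inv G.conjugate_conjugate)

lemma act_one_left [simp]: "t \<in> carrier T \<Longrightarrow> act \<one>\<^bsub>G\<^esub> t = t"
  by (simp add: act_def br_def)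

text \<open>The Peiffer identity of a crossed module. On symbols it is \<open>conj_w\<close>, and
  both sides are multiplicative in \<open>u\<close>.\<close>

lemma act_d:
  assumes "t \<in> carrier T" "u \<in> carrier T"
  shows "act (d t) u = t \<otimes> u \<otimes> inv t"
  using assms(2,1)
proof (induction rule: T_induct)
  case (w g h)
  then show ?case
    using conj_w[of t g h] by (simp add: act_w T.m_assoc)
next
  case (inv g h)
  then have "w (cj (d t) g) (cj (d t) h) = t \<otimes> w g h \<otimes> inv t"
    using conj_w[of t g h] by (simp add: T.m_assoc)
  with inv show ?case by (simp add: act_w act_inv T.m_assoc T.inv_mult_group)
next
  case (mult u v)
  then show ?case by (simp add: act_mult T.m_assoc)
qed simp

lemma br_mult_left:
  "\<lbrakk>x \<in> carrier G; y \<in> carrier G; t \<in> carrier T\<rbrakk> \<Longrightarrow> br (x \<otimes>\<^bsub>G\<^esub> y) t = act x (br y t) \<otimes> br x t"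
  by (simp add: br_def w_mult_left)

lemma br_d:
  assumes "t \<in> carrier T" "u \<in> carrier T"
  shows "br (d t) u = commutator T t u"
proof -
  have "br (d t) u \<otimes> u = t \<otimes> u \<otimes> inv t"
    using act_d[OF assms] by (simp add: act_def)
  then have "br (d t) u = t \<otimes> u \<otimes> inv t \<otimes> inv u"
    using assms by (metis T.inv_solve_right T.inv_closed T.m_closed br_closed d.hom_closed)
  then show ?thesis by (simp add: commutator_def)
qed

lemma br_d_mult: "t \<in> carrier T \<Longrightarrow> u \<in> carrier T \<Longrightarrow> t \<otimes> u = br (d t) u \<otimes> u \<otimes> t"
  by (simp add: br_d commutator_def T.m_assoc)

end

locale exterior_pairing = tensor_pairing +
  assumes w_refl [simp]: "g \<in> carrier G \<Longrightarrow> w g g = \<one>"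
begin

text \<open>Expand \<open>w (x y) (x y) = 1\<close>. What remains is the image of
  \<open>w y x\<close> times \<open>w x y\<close> under \<open>act x\<close>, which the action of
  \<open>x^-1\<close> undoes.\<close>

lemma w_swap:
  assumes "x \<in> carrier G" "y \<in> carrier G"
  shows "w y x = inv (w x y)"
proof -
  have "w y (x \<otimes>\<^bsub>G\<^esub> y) = w y x" "w x (x \<otimes>\<^bsub>G\<^esub> y) = act x (w x y)"
    using assms by (simp_all add: w_mult_right)
  then have "w (x \<otimes>\<^bsub>G\<^esub> y) (x \<otimes>\<^bsub>G\<^esub> y) = act x (w y x \<otimes> w x y)"
    using assms by (simp add: w_mult_left[of x y] act_mult del: w_refl)
  then have "act x (w y x \<otimes> w x y) = \<one>"
    using assms by simp
  then have "act (inv\<^bsub>G\<^esub> x) (act x (w y x \<otimes> w x y)) = \<one>"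
    using assms by simp
  then have "w y x \<otimes> w x y = \<one>"
    using assms by (simp flip: act_act)
  then show ?thesis
    using assms by (simp add: T.inv_equality)
qed

end

section \<open>The lower central filtration\<close>

declare lower_central_series.simps(2) [simp del]

lemma (in group) generate_conjugate_closed:
  assumes "S \<subseteq> carrier G" "x \<in> carrier G" "y \<in> generate G S"
    and "\<And>s. s \<in> S \<Longrightarrow> conjugate G x s \<in> S"
  shows "conjugate G x y \<in> generate G S"
  using assms(3)
proof (induction rule: generate.induct)
  case (incl h)
  then show ?case using assms(4) by (simp add: generate.incl)
next
  case (inv h)
  then have "h \<in> carrier G" using assms(1) by blast
  with inv show ?case using assms(2,4) by (simp add: conjugate_inv generate.inv)
next
  case (eng h1 h2)
  then show ?case
    using generate_in_carrier[OF assms(1)] assms(2) by (simp add: conjugate_mult generate.eng)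
qed (simp add: assms(2) generate.one)

context group
begin

abbreviation L where "L \<equiv> lower_central_series G"

lemma L_subset: "L n \<subseteq> carrier G"
proof (induction n)
  case (Suc n)
  then show ?case
    unfolding lower_central_series.simps(2) by (intro generate_incl) auto
qed simp

lemma L_carrier [simp]: "x \<in> L n \<Longrightarrow> x \<in> carrier G"
  using L_subset by blast

lemma L_gens_subset: "{commutator G x y |x y. x \<in> L n \<and> y \<in> carrier G} \<subseteq> carrier G"
  by auto

lemmas L_Suc = lower_central_series.simps(2)

lemma L_subgroup: "subgroup (L n) G"
  using generate_is_subgroup[OF L_gens_subset] by (cases n) (simp_all add: subgroup_self L_Suc)

lemma L_conjugate: "x \<in> carrier G \<Longrightarrow> y \<in> L n \<Longrightarrow> conjugate G x y \<in> L n"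
proof (induction n arbitrary: x y)
  case (Suc n)
  have "conjugate G x y \<in> generate G {commutator G a b |a b. a \<in> L n \<and> b \<in> carrier G}"
  proof (rule generate_conjugate_closed[OF L_gens_subset])
    fix s assume "s \<in> {commutator G a b |a b. a \<in> L n \<and> b \<in> carrier G}"
    then obtain a b where "s = commutator G a b" "a \<in> L n" "b \<in> carrier G" by auto
    moreover from this Suc have "conjugate G x a \<in> L n" "conjugate G x b \<in> carrier G"
      by simp_all
    moreover have "conjugate G x s = commutator G (conjugate G x a) (conjugate G x b)"
      using Suc.prems calculation by (simp add: conjugate_commutator)
    ultimately show "conjugate G x s \<in> {commutator G a b |a b. a \<in> L n \<and> b \<in> carrier G}"
      by blast
  qed (use Suc in \<open>simp_all add: L_Suc\<close>)
  then show ?case by (simp add: L_Suc)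
qed simp

lemma commutator_L_Suc:
  assumes "x \<in> L n" "y \<in> carrier G"
  shows "commutator G x y \<in> L (Suc n)" "commutator G y x \<in> L (Suc n)"
proof -
  show "commutator G x y \<in> L (Suc n)"
    using assms by (auto simp: L_Suc intro!: generate.incl)
  then have "inv (commutator G x y) \<in> L (Suc n)"
    by (rule subgroup.m_inv_closed[OF L_subgroup])
  then show "commutator G y x \<in> L (Suc n)"
    using assms by (simp add: inv_commutator)
qed

lemma L_Suc_subset: "L (Suc n) \<subseteq> L n"
proof -
  have "commutator G x y \<in> L n" if "x \<in> L n" "y \<in> carrier G" for x y
  proof -
    have "commutator G x y = x \<otimes> conjugate G y (inv x)"
      using that by (simp add: commutator_def conjugate_def m_assoc)
    then show ?thesis
      using that L_conjugate subgroup.m_closed[OF L_subgroup] subgroup.m_inv_closed[OF L_subgroup]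
      by metis
  qed
  then have "generate G {commutator G x y |x y. x \<in> L n \<and> y \<in> carrier G} \<subseteq> L n"
    by (intro generate_subgroup_incl L_subgroup) auto
  then show ?thesis by (simp add: L_Suc)
qed

lemma L_antimono: "i \<le> j \<Longrightarrow> L j \<subseteq> L i"
  using L_Suc_subset by (rule lift_Suc_antimono_le)

end

context exterior_pairing
begin

abbreviation L where "L \<equiv> G.L"

text \<open>In terms of the central extension, \<open>L n\<close> and \<open>F n\<close> have weights \<open>n + 1\<close> and \<open>n + 2\<close>.\<close>

definition F where "F n = generate T {w x y | x y. x \<in> carrier G \<and> y \<in> L n}"

lemma F_gens_subset: "{w x y | x y. x \<in> carrier G \<and> y \<in> L n} \<subseteq> carrier T"
  by auto

lemma F_subgroup: "subgroup (F n) T"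
  unfolding F_def by (rule T.generate_is_subgroup[OF F_gens_subset])

lemmas F_mult = subgroup.m_closed[OF F_subgroup]
  and F_inv = subgroup.m_inv_closed[OF F_subgroup]
  and F_one [simp] = subgroup.one_closed[OF F_subgroup]

lemma F_carrier [simp]: "t \<in> F n \<Longrightarrow> t \<in> carrier T"
  using subgroup.mem_carrier[OF F_subgroup] .

lemma F_pow: "t \<in> F n \<Longrightarrow> t [^] (k::nat) \<in> F n"
  by (induction k) (auto intro: F_mult)

lemma F_0: "F 0 = carrier T"
  unfolding F_def T_gen by simp

lemma w_F0: "x \<in> carrier G \<Longrightarrow> y \<in> L n \<Longrightarrow> w x y \<in> F n"
  unfolding F_def by (auto intro!: generate.incl)

lemma w_F0': "x \<in> L n \<Longrightarrow> y \<in> carrier G \<Longrightarrow> w x y \<in> F n"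
  using w_F0[of y x n] F_inv w_swap[of y x] by simp

lemma F_induct [consumes 1, case_names one w inv mult]:
  assumes "t \<in> F n" and "P \<one>"
    and "\<And>g h. g \<in> carrier G \<Longrightarrow> h \<in> L n \<Longrightarrow> P (w g h)"
    and "\<And>g h. g \<in> carrier G \<Longrightarrow> h \<in> L n \<Longrightarrow> P (inv (w g h))"
    and "\<And>t u. t \<in> F n \<Longrightarrow> u \<in> F n \<Longrightarrow> P t \<Longrightarrow> P u \<Longrightarrow> P (t \<otimes> u)"
  shows "P t"
proof -
  have "t \<in> generate T {w g h | g h. g \<in> carrier G \<and> h \<in> L n}"
    using assms(1) F_def by simp
  then have "t \<in> F n \<and> P t"
    by (induction rule: generate.induct)
      (use assms(2-) in \<open>auto intro: F_mult w_F0 F_inv\<close>)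
  then show ?thesis ..
qed

lemma F_act: "x \<in> carrier G \<Longrightarrow> t \<in> F n \<Longrightarrow> act x t \<in> F n"
proof (rotate_tac, induction rule: F_induct)
  case (w g h)
  then show ?case by (simp add: act_w w_F0 G.L_conjugate)
next
  case (inv g h)
  then show ?case by (simp add: act_inv act_w w_F0 F_inv G.L_conjugate)
next
  case (mult t u)
  then show ?case by (simp add: act_mult F_mult)
qed simp

lemma F_conj: "t \<in> F n \<Longrightarrow> u \<in> carrier T \<Longrightarrow> u \<otimes> t \<otimes> inv u \<in> F n"
  using F_act[of "d u" t n] by (simp add: act_d)

lemma F_antimono: "i \<le> j \<Longrightarrow> F j \<subseteq> F i"
proof -
  assume "i \<le> j"
  then have "{w x y | x y. x \<in> carrier G \<and> y \<in> L j} \<subseteq> {w x y | x y. x \<in> carrier G \<and> y \<in> L i}"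
    using G.L_antimono by blast
  then show ?thesis
    unfolding F_def by (rule T.mono_generate)
qed

lemma d_F: "t \<in> F n \<Longrightarrow> d t \<in> L (Suc n)"
proof (induction rule: F_induct)
  case (w g h)
  then show ?case using G.commutator_L_Suc(2) by (simp add: d_w)
next
  case (inv g h)
  then show ?case
    using G.commutator_L_Suc(1) by (simp add: d_w G.inv_commutator)
next
  case (mult t u)
  then show ?case
    by (simp add: subgroup.m_closed[OF G.L_subgroup])
qed (simp add: subgroup.one_closed[OF G.L_subgroup])

lemma L_Suc_image: "L (Suc n) = d ` F n"
proof
  have "commutator G y x \<in> d ` F n" if "y \<in> L n" "x \<in> carrier G" for x y
    using that d_w[of y x] w_F0'[of y n x] by (metis G.L_carrier image_eqI)
  moreover have "subgroup (d ` F n) G"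
    by (rule d.subgroup_img_is_subgroup[OF F_subgroup])
  ultimately show "L (Suc n) \<subseteq> d ` F n"
    unfolding G.L_Suc by (intro G.generate_subgroup_incl) auto
qed (use d_F in blast)

lemma w_inv_left:
  assumes "x \<in> carrier G" "y \<in> carrier G"
  shows "w (inv\<^bsub>G\<^esub> x) y = inv (act (inv\<^bsub>G\<^esub> x) (w x y))"
proof -
  have "act (inv\<^bsub>G\<^esub> x) (w x y) \<otimes> w (inv\<^bsub>G\<^esub> x) y = \<one>"
    using w_mult_left[of "inv\<^bsub>G\<^esub> x" x y] assms by simp
  then show ?thesis
    using assms by (metis T.inv_equality T.inv_inv T.inv_comm act_closed w_closed G.inv_closed T.inv_closed)
qed

text \<open>For a commutator \<open>[a, g]\<close> and \<open>t = w a g\<close> one has \<open>w y [a, g] = act y t t\<^sup>-\<^sup>1\<close>, and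
  \<open>act y t = w ([y, a] a) ([y, g] g)\<close> differs from \<open>t\<close> by factors of high weight.\<close>

lemma w_F: "x \<in> L i \<Longrightarrow> y \<in> L j \<Longrightarrow> w x y \<in> F (i + j)"
proof (induction i arbitrary: x y j)
  case 0
  then show ?case by (simp add: w_F0)
next
  case (Suc i)
  let ?n = "Suc i + j"
  have swap: "w p r \<in> F n" if "w r p \<in> F n" "p \<in> carrier G" "r \<in> carrier G" for p r n
    using that F_inv w_swap[of r p] by simp
  have gen: "w (commutator G a g) y \<in> F ?n"
    if a: "a \<in> L i" and g: "g \<in> carrier G" for a g
  proof -
    have [simp]: "a \<in> carrier G" "y \<in> carrier G" using a Suc.prems by auto
    define t where "t = w a g"
    define u where "u = commutator G y a"
    define v where "v = commutator G y g"
    have [simp]: "t \<in> carrier T" "u \<in> carrier G" "v \<in> carrier G" using g by (simp_all add: t_def u_def v_def)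
    have "d (w y a) \<in> L (Suc (i + j))"
      using Suc.IH[OF a Suc.prems(2)] by (intro d_F swap[of a y]) simp_all
    then have u: "u \<in> L ?n" by (simp add: d_w u_def)
    have v: "v \<in> L (Suc j)" using G.commutator_L_Suc(1)[OF Suc.prems(2) g] by (simp add: v_def)
    \<comment> \<open>The induction hypothesis only reaches index \<open>i\<close>, although
      \<open>d t\<close> lies in \<open>L (Suc i)\<close>; the missing weight comes from
      \<open>v\<close> in \<open>L (Suc j)\<close>.\<close>
    have dt: "d t \<in> L i"
      using G.commutator_L_Suc(1)[OF a g] G.L_Suc_subset a g by (auto simp: t_def d_w)
    have brv: "br v t \<in> F ?n"
      using Suc.IH[OF dt v] swap[of "d t" v] by (simp add: br_def)
    have bru: "br u t \<in> F ?n"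
      using u by (simp add: br_def w_F0')
    have "act y t = w (u \<otimes>\<^bsub>G\<^esub> a) (v \<otimes>\<^bsub>G\<^esub> g)"
      using a g by (simp add: t_def act_w u_def v_def G.commutator_mult_right_eq_conjugate)
    also have "\<dots> = act u (w a v \<otimes> act v t) \<otimes> w u (v \<otimes>\<^bsub>G\<^esub> g)"
      using g by (simp add: w_mult_left w_mult_right[of a v g] t_def)
    also have "\<dots> = act u (w a v) \<otimes> (act u (br v t) \<otimes> br u t) \<otimes> (t \<otimes> w u (v \<otimes>\<^bsub>G\<^esub> g))"
      using g by (simp add: act_mult T.m_assoc) (simp add: act_def[of _ t] act_mult T.m_assoc)
    finally have "act y t \<otimes> inv t = act u (w a v) \<otimes> (act u (br v t) \<otimes> br u t) \<otimes> (t \<otimes> w u (v \<otimes>\<^bsub>G\<^esub> g)) \<otimes> inv t"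
      by (rule arg_cong)
    then have "br y t = act u (w a v) \<otimes> (act u (br v t) \<otimes> br u t) \<otimes> (t \<otimes> w u (v \<otimes>\<^bsub>G\<^esub> g) \<otimes> inv t)"
      using g by (simp add: act_def[of y t] T.m_assoc)
    moreover have "w a v \<in> F ?n" using Suc.IH[OF a v] by simp
    moreover have "w u (v \<otimes>\<^bsub>G\<^esub> g) \<in> F ?n" using u g by (simp add: w_F0')
    ultimately have "br y t \<in> F ?n"
      using brv bru by (simp add: F_mult F_act F_conj)
    then show ?thesis
      using swap[of y "commutator G a g"] g by (simp add: br_def t_def d_w)
  qed
  have "x \<in> generate G {commutator G a g |a g. a \<in> L i \<and> g \<in> carrier G}"
    using Suc.prems(1) by (simp add: G.L_Suc)
  then have "x \<in> carrier G \<and> w x y \<in> F ?n"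
  proof (induction rule: generate.induct)
    case (incl h)
    then show ?case using gen by auto
  next
    case (inv h)
    then show ?case using gen Suc.prems(2) by (auto simp: w_inv_left F_act F_inv)
  next
    case (eng h1 h2)
    then show ?case using Suc.prems(2) by (simp add: w_mult_left F_act F_mult)
  qed (use Suc.prems(2) in simp_all)
  then show ?case by simp
qed

text \<open>Weights add: \<open>(i + 1) + (j + 2) = (i + Suc j) + 2\<close>.\<close>

lemma br_F: "x \<in> L i \<Longrightarrow> t \<in> F j \<Longrightarrow> br x t \<in> F (i + Suc j)"
  unfolding br_def by (intro w_F d_F)

lemma br_F0: "x \<in> carrier G \<Longrightarrow> t \<in> F j \<Longrightarrow> br x t \<in> F (Suc j)"
  using br_F[of x 0] by simp

lemma commutator_F: "t \<in> F i \<Longrightarrow> u \<in> F j \<Longrightarrow> commutator T t u \<in> F (Suc i + Suc j)"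
  using br_F[OF d_F, of t i u j] by (simp add: br_d)

text \<open>Every element of \<open>L (Suc n)\<close> is \<open>d u\<close> for some
  \<open>u\<close> in \<open>F n\<close>, so the generating symbols of \<open>F (Suc n)\<close> are
  brackets \<open>br g u\<close>.\<close>

lemma F_Suc_induct [consumes 1, case_names one br inv mult]:
  assumes "t \<in> F (Suc n)" and "P \<one>"
    and "\<And>x t. x \<in> carrier G \<Longrightarrow> t \<in> F n \<Longrightarrow> P (br x t)"
    and "\<And>x t. x \<in> carrier G \<Longrightarrow> t \<in> F n \<Longrightarrow> P (inv (br x t))"
    and "\<And>t u. t \<in> F (Suc n) \<Longrightarrow> u \<in> F (Suc n) \<Longrightarrow> P t \<Longrightarrow> P u \<Longrightarrow> P (t \<otimes> u)"
  shows "P t"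
  using assms(1)
proof (induction rule: F_induct)
  case (w g h)
  then obtain u where "h = d u" "u \<in> F n" unfolding L_Suc_image by auto
  with w assms(3) show ?case by (simp add: br_def)
next
  case (inv g h)
  then obtain u where "h = d u" "u \<in> F n" unfolding L_Suc_image by auto
  with inv assms(4) show ?case by (simp add: br_def)
qed (use assms in auto)

end

section \<open>Collection of powers\<close>

context group
begin

lemma pow_swap:
  assumes "p \<otimes> q = q \<otimes> p" "p \<in> carrier G" "q \<in> carrier G"
  shows "p [^] (i::nat) \<otimes> q [^] (j::nat) = q [^] j \<otimes> p [^] i"
    and "r \<in> carrier G \<Longrightarrow> p [^] i \<otimes> (q [^] j \<otimes> r) = q [^] j \<otimes> (p [^] i \<otimes> r)"
proof -
  have "p [^] i \<otimes> q = q \<otimes> p [^] i"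
    using assms by (rule group_commutes_pow)
  then have "q [^] j \<otimes> p [^] i = p [^] i \<otimes> q [^] j"
    using assms by (intro group_commutes_pow) simp_all
  then show *: "p [^] i \<otimes> q [^] j = q [^] j \<otimes> p [^] i" ..
  show "r \<in> carrier G \<Longrightarrow> p [^] i \<otimes> (q [^] j \<otimes> r) = q [^] j \<otimes> (p [^] i \<otimes> r)"
    using * assms by (simp flip: m_assoc)
qed

text \<open>Each exchange of one \<open>p\<close> with one \<open>q\<close> releases one
  \<open>e\<close>, which commutes with both. The second form is the rewrite rule for use inside
  right-nested products during collection.\<close>

lemma pow_swap_central:
  assumes "p \<otimes> q = q \<otimes> (p \<otimes> e)" "e \<otimes> p = p \<otimes> e" "e \<otimes> q = q \<otimes> e"
    and [simp]: "p \<in> carrier G" "q \<in> carrier G" "e \<in> carrier G"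
  shows "p [^] (i::nat) \<otimes> q [^] (j::nat) = q [^] j \<otimes> (p [^] i \<otimes> e [^] (i * j))"
    and "r \<in> carrier G \<Longrightarrow>
      p [^] i \<otimes> (q [^] j \<otimes> r) = q [^] j \<otimes> (p [^] i \<otimes> (e [^] (i * j) \<otimes> r))"
proof -
  note sp = pow_swap[OF assms(2)] pow_swap[OF assms(3)]
  have 1: "p [^] i \<otimes> q = q \<otimes> (p [^] i \<otimes> e [^] i)" for i :: nat
  proof (induction i)
    case (Suc i)
    have "p [^] Suc i \<otimes> q = p [^] i \<otimes> (q \<otimes> (p \<otimes> e))"
      using assms(1) by (simp add: m_assoc)
    also have "\<dots> = q \<otimes> (p [^] i \<otimes> e [^] i) \<otimes> (p \<otimes> e)"
      using Suc by (simp flip: m_assoc)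
    also have "\<dots> = q \<otimes> (p [^] i \<otimes> (e [^] i \<otimes> (p [^] (1::nat) \<otimes> e)))"
      by (simp add: m_assoc)
    also have "\<dots> = q \<otimes> (p [^] i \<otimes> (p \<otimes> (e [^] i \<otimes> e)))"
      by (subst sp(2)) simp_all
    also have "\<dots> = q \<otimes> (p [^] Suc i \<otimes> e [^] Suc i)"
      by (simp add: m_assoc)
    finally show ?case .
  qed simp
  show 2: "p [^] i \<otimes> q [^] j = q [^] j \<otimes> (p [^] i \<otimes> e [^] (i * j))"
  proof (induction j)
    case (Suc j)
    have "p [^] i \<otimes> q [^] Suc j = q [^] j \<otimes> (p [^] i \<otimes> (e [^] (i * j) \<otimes> q [^] (1::nat)))"
      using Suc by (simp flip: m_assoc)
    also have "\<dots> = q [^] j \<otimes> (p [^] i \<otimes> (q \<otimes> e [^] (i * j)))"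
      by (subst sp(3)) simp_all
    also have "\<dots> = q [^] j \<otimes> ((p [^] i \<otimes> q) \<otimes> e [^] (i * j))"
      by (simp add: m_assoc)
    also have "\<dots> = q [^] Suc j \<otimes> (p [^] i \<otimes> e [^] (i * Suc j))"
      unfolding 1 by (simp add: m_assoc nat_pow_mult)
    finally show ?case .
  qed simp
  show "r \<in> carrier G \<Longrightarrow>
      p [^] i \<otimes> (q [^] j \<otimes> r) = q [^] j \<otimes> (p [^] i \<otimes> (e [^] (i * j) \<otimes> r))"
    using 2 by (simp flip: m_assoc)
qed

lemma pow_merge:
  assumes "p \<in> carrier G"
  shows "p [^] (i::nat) \<otimes> p [^] (j::nat) = p [^] (i + j)"
    and "r \<in> carrier G \<Longrightarrow> p [^] i \<otimes> (p [^] j \<otimes> r) = p [^] (i + j) \<otimes> r"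
  using assms by (simp_all add: nat_pow_mult flip: m_assoc)

lemma pow_eq_one_dvd:
  assumes "t \<in> carrier G" "t [^] (q::nat) = \<one>" "q dvd m"
  shows "t [^] m = \<one>"
  using assms by (auto simp flip: nat_pow_pow elim!: dvdE)

end

context exterior_pairing
begin

text \<open>The product of the conjugates of \<open>b\<close> by \<open>x^(n-1), ..., x, 1\<close>,
  in this order. It is what \<open>w (x^n) g\<close> becomes for \<open>b = w x g\<close>, see
  \<open>w_pow\<close>.\<close>

primrec norm where
  "norm x b 0 = \<one>"
| "norm x b (Suc n) = act (x [^]\<^bsub>G\<^esub> n) b \<otimes> norm x b n"

lemma norm_closed [simp]: "x \<in> carrier G \<Longrightarrow> b \<in> carrier T \<Longrightarrow> norm x b n \<in> carrier T"
  by (induction n) simp_all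

lemma w_pow: "x \<in> carrier G \<Longrightarrow> g \<in> carrier G \<Longrightarrow> w (x [^]\<^bsub>G\<^esub> n) g = norm x (w x g) n"
  by (induction n) (simp_all add: w_mult_left)

text \<open>Telescoping, as \<open>u^n t u^-n\<close> is the conjugate of \<open>t\<close> by
  \<open>(d u)^n\<close>. With \<open>inv t\<close> for \<open>u\<close> it lets the collection
  formula below also compute powers of a product.\<close>

lemma norm_d:
  assumes "t \<in> carrier T" "u \<in> carrier T"
  shows "u [^] n \<otimes> (inv u \<otimes> t) [^] n = norm (d u) t n"
proof (induction n)
  case (Suc n)
  have "u [^] Suc n \<otimes> (inv u \<otimes> t) [^] Suc n = u [^] n \<otimes> (t \<otimes> (inv u \<otimes> t) [^] n)"
    using assms unfolding T.nat_pow_Suc2[of "inv u \<otimes> t", OF T.m_closed[OF T.inv_closed[OF assms(2)] assms(1)]]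
    by (simp add: T.m_assoc)
  also have "\<dots> = u [^] n \<otimes> t \<otimes> inv (u [^] n) \<otimes> (u [^] n \<otimes> (inv u \<otimes> t) [^] n)"
    using assms by (simp add: T.m_assoc)
  also have "u [^] n \<otimes> t \<otimes> inv (u [^] n) = act (d u [^]\<^bsub>G\<^esub> n) t"
    using assms by (simp add: act_d flip: d.hom_nat_pow)
  finally show ?case by (simp add: Suc)
qed simp

end

locale exterior_pairing5 = exterior_pairing +
  assumes L5: "G.L 5 = {\<one>\<^bsub>G\<^esub>}"
begin

lemma F5: "t \<in> F n \<Longrightarrow> 5 \<le> n \<Longrightarrow> t = \<one>"
proof -
  assume "t \<in> F n" "5 \<le> n"
  then have "t \<in> F 5" using F_antimono by blast
  then show ?thesis
    by (induction rule: F_induct) (simp_all add: L5)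
qed

lemma F_comm: "t \<in> F i \<Longrightarrow> u \<in> F j \<Longrightarrow> 3 \<le> i + j \<Longrightarrow> t \<otimes> u = u \<otimes> t"
  using F5[OF commutator_F[of t i u j]] br_d_mult[of t u] by (simp add: br_d)

lemma act_trivial: "x \<in> L i \<Longrightarrow> t \<in> F j \<Longrightarrow> 4 \<le> i + j \<Longrightarrow> act x t = t"
  using F5[OF br_F[of x i t j]] by (simp add: act_def)

text \<open>Conjugation by \<open>x^j\<close> contributes the \<open>k\<close>-th bracket with
  exponent \<open>j choose k\<close>, and summing over \<open>j < n\<close> gives
  \<open>n choose (k + 1)\<close>. Collecting the powers of \<open>b\<close> on the left releases
  \<open>e\<close> and \<open>f\<close>, with exponents the sums of \<open>j (j + 1)\<close> and
  \<open>(j choose 2) (j + 1)\<close>.\<close>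

lemma norm_eq:
  fixes n :: nat
  assumes x: "x \<in> carrier G" and b: "b \<in> carrier T"
    and b1: "b1 = br x b" and b2: "b2 = br x b1" and b3: "b3 = br x b2" and b4: "b4 = br x b3"
    and e: "e = commutator T b1 b" and f: "f = commutator T b2 b"
  shows "norm x b n = b [^] n \<otimes> (b1 [^] (n choose 2) \<otimes> (b2 [^] (n choose 3) \<otimes> (b3 [^] (n choose 4) \<otimes>
    (b4 [^] (n choose 5) \<otimes> (e [^] (2 * (Suc n choose 3)) \<otimes> f [^] (3 * (Suc n choose 4)))))))"
proof -
  have F: "b \<in> F 0" "b1 \<in> F 1" "b2 \<in> F 2" "b3 \<in> F 3" "b4 \<in> F 4" "e \<in> F 3" "f \<in> F 4"
  proof -
    show 0: "b \<in> F 0" using b by (simp add: F_0)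
    show 1: "b1 \<in> F 1" using br_F0[OF x 0] b1 by simp
    show 2: "b2 \<in> F 2" using br_F0[OF x 1] b2 by (simp add: eval_nat_numeral)
    show 3: "b3 \<in> F 3" using br_F0[OF x 2] b3 by (simp add: eval_nat_numeral)
    show "b4 \<in> F 4" using br_F0[OF x 3] b4 by (simp add: eval_nat_numeral)
    show "e \<in> F 3" using commutator_F[OF 1 0] e by (simp add: eval_nat_numeral)
    show "f \<in> F 4" using commutator_F[OF 2 0] f by (simp add: eval_nat_numeral)
  qed
  then have C [simp]: "b \<in> carrier T" "b1 \<in> carrier T" "b2 \<in> carrier T" "b3 \<in> carrier T"
    "b4 \<in> carrier T" "e \<in> carrier T" "f \<in> carrier T" by simp_all
  note [simp] = x
  have s: "e \<otimes> b = b \<otimes> e" "e \<otimes> b1 = b1 \<otimes> e" "f \<otimes> b = b \<otimes> f" "f \<otimes> b2 = b2 \<otimes> f"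
    using F by (auto intro: F_comm)
  have "b1 \<otimes> b = e \<otimes> b \<otimes> b1" "b2 \<otimes> b = f \<otimes> b \<otimes> b2"
    using e f C by (simp_all only: br_d_mult[of b1 b] br_d_mult[of b2 b] br_d)
  then have be: "b1 \<otimes> b = b \<otimes> (b1 \<otimes> e)" and bf: "b2 \<otimes> b = b \<otimes> (b2 \<otimes> f)"
    by (simp_all add: s T.m_assoc)
  \<comment> \<open>All pairs except \<open>b1, b\<close> and \<open>b2, b\<close>: their indices
    add up to at least 3, so they commute.\<close>
  have cm: "b2 \<otimes> b1 = b1 \<otimes> b2" "b3 \<otimes> b = b \<otimes> b3" "b3 \<otimes> b1 = b1
    \<otimes> b3" "b3 \<otimes> b2 = b2 \<otimes> b3" "b4 \<otimes> b = b \<otimes> b4" "b4 \<otimes> b1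
    = b1 \<otimes> b4" "b4 \<otimes> b2 = b2 \<otimes> b4" "b4 \<otimes> b3 = b3 \<otimes> b4" "e
    \<otimes> b = b \<otimes> e" "e \<otimes> b1 = b1 \<otimes> e" "e \<otimes> b2 = b2 \<otimes> e" "e
    \<otimes> b3 = b3 \<otimes> e" "e \<otimes> b4 = b4 \<otimes> e" "f \<otimes> b = b \<otimes> f" "f
    \<otimes> b1 = b1 \<otimes> f" "f \<otimes> b2 = b2 \<otimes> f" "f \<otimes> b3 = b3 \<otimes> f"
    "f \<otimes> b4 = b4 \<otimes> f" "f \<otimes> e = e \<otimes> f"
    using F by (auto intro: F_comm)
  note sw = T.pow_swap_central[OF be s(2,1)] T.pow_swap_central[OF bf s(4,3)]
    T.pow_swap[OF cm(1)] T.pow_swap[OF cm(2)]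
    T.pow_swap[OF cm(3)] T.pow_swap[OF cm(4)]
    T.pow_swap[OF cm(5)] T.pow_swap[OF cm(6)]
    T.pow_swap[OF cm(7)] T.pow_swap[OF cm(8)]
    T.pow_swap[OF cm(9)] T.pow_swap[OF cm(10)]
    T.pow_swap[OF cm(11)] T.pow_swap[OF cm(12)]
    T.pow_swap[OF cm(13)]
    T.pow_swap[OF cm(14)] T.pow_swap[OF cm(15)]
    T.pow_swap[OF cm(16)] T.pow_swap[OF cm(17)]
    T.pow_swap[OF cm(18)] T.pow_swap[OF cm(19)]
    T.pow_merge
  have b4_fix: "act x b4 = b4"
    using act_trivial[of x 0 b4 4] F(5) by simp
  have a: "act x b = b1 \<otimes> b" "act x b1 = b2 \<otimes> b1" "act x b2 = b3 \<otimes> b2" "act x b3 = b4 \<otimes> b3"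
    by (simp_all add: act_def b1 b2 b3 b4)
  have p: "act x b1 = b1 [^] (1::nat) \<otimes> b2 [^] (1::nat)"
     "act x b2 = b2 [^] (1::nat) \<otimes> b3 [^] (1::nat)"
     "act x b3 = b3 [^] (1::nat) \<otimes> b4 [^] (1::nat)"
    using cm
    by (simp_all add: a)
  have pp: "act x (b1 [^] k) = b1 [^] k \<otimes> b2 [^] k"
     "act x (b2 [^] k) = b2 [^] k \<otimes> b3 [^] k"
     "act x (b3 [^] k) = b3 [^] k \<otimes> b4 [^] k" for k :: nat
    unfolding act_pow[OF x C(2)] act_pow[OF x C(3)] act_pow[OF x C(4)] p
    using cm
    by (simp_all add: T.pow_mult_distrib)
  have ch: "Suc n choose 2 = n + (n choose 2)" "Suc n choose 3 = (n choose 2) + (n choose 3)"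
    "Suc n choose 4 = (n choose 3) + (n choose 4)" "Suc n choose 5 = (n choose 4) + (n choose 5)" for n
    by (simp_all add: eval_nat_numeral)
  \<comment> \<open>The binomial expansion of \<open>(1 + X)^n\<close>, with \<open>X\<close>
    standing for \<open>br x\<close>; Pascal's rule gives the induction step.\<close>
  have act_n: "act (x [^]\<^bsub>G\<^esub> n) b = b1 [^] n \<otimes> (b2 [^] (n choose 2) \<otimes> (b3 [^] (n choose 3) \<otimes>
    (b4 [^] (n choose 4) \<otimes> b [^] (1::nat))))" for n :: nat
  proof (induction n)
    case (Suc n)
    have "act (x [^]\<^bsub>G\<^esub> Suc n) b = act x (act (x [^]\<^bsub>G\<^esub> n) b)"
      using G.nat_pow_Suc2[OF x, of n] by (simp only: act_act b x G.nat_pow_closed)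
    also have "\<dots> = b1 [^] n \<otimes> b2 [^] n \<otimes> (b2 [^] (n choose 2) \<otimes> b3 [^] (n choose 2) \<otimes>
       (b3 [^] (n choose 3) \<otimes> b4 [^] (n choose 3) \<otimes> (b4 [^] (n choose 4) \<otimes> (b1 [^] (1::nat) \<otimes> b))))"
      by (simp add: Suc act_mult pp act_pow b4_fix a)
    also have "\<dots> = b1 [^] n \<otimes> (b2 [^] n \<otimes> (b2 [^] (n choose 2) \<otimes> (b3 [^] (n choose 2) \<otimes>
       (b3 [^] (n choose 3) \<otimes> (b4 [^] (n choose 3) \<otimes> (b4 [^] (n choose 4) \<otimes> (b1 [^] (1::nat) \<otimes> b)))))))"
      by (simp only: T.m_assoc C T.nat_pow_closed T.m_closed)
    also have "\<dots> = b1 [^] (n + 1) \<otimes> (b2 [^] (n + (n choose 2)) \<otimes> (b3 [^] ((n choose 2) + (n choose 3)) \<otimes>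
       (b4 [^] ((n choose 3) + (n choose 4)) \<otimes> b)))"
      by (simp only: sw C T.nat_pow_closed T.m_closed)
    finally show ?case by (simp add: ch)
  qed (simp add: binomial_eq_0)
  show ?thesis
  proof (induction n)
    case (Suc n)
    \<comment> \<open>The increments are what moving \<open>b1^n\<close> and
      \<open>b2^(n choose 2)\<close> past \<open>b^(n + 1)\<close> releases.\<close>
    have e2: "2 * (Suc (Suc n) choose 3) = n * Suc n + 2 * (Suc n choose 3)"
      using Suc_times_binomial_eq[of n 1] unfolding ch(2)[of "Suc n"]
      by (simp add: numeral_2_eq_2)
    have e3: "3 * (Suc (Suc n) choose 4) = (n choose 2) * Suc n + 3 * (Suc n choose 4)"
      using Suc_times_binomial_eq[of n 2] unfolding ch(3)[of "Suc n"]
      by (simp add: eval_nat_numeral mult.commute)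
    have "norm x b (Suc n) = b1 [^] n \<otimes> (b2 [^] (n choose 2) \<otimes> (b3 [^] (n choose 3) \<otimes>
    (b4 [^] (n choose 4) \<otimes> (b [^] Suc n \<otimes> (b1 [^] (n choose 2) \<otimes> (b2 [^] (n choose 3) \<otimes> (b3 [^] (n choose 4) \<otimes>
    (b4 [^] (n choose 5) \<otimes> (e [^] (2 * (Suc n choose 3)) \<otimes> f [^] (3 * (Suc n choose 4)))))))))))"
      unfolding norm.simps Suc act_n T.nat_pow_Suc2[OF C(1)] by (simp add: T.m_assoc)
    also have "\<dots> = b [^] Suc n \<otimes> (b1 [^] (n + (n choose 2)) \<otimes> (b2 [^] ((n choose 2) + (n choose 3)) \<otimes>
       (b3 [^] ((n choose 3) + (n choose 4)) \<otimes> (b4 [^] ((n choose 4) + (n choose 5)) \<otimes>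
       (e [^] (n * Suc n + 2 * (Suc n choose 3)) \<otimes> f [^] ((n choose 2) * Suc n + 3 * (Suc n choose 4)))))))"
      by (simp only: sw C T.nat_pow_closed T.m_closed)
    finally show ?case unfolding e2 e3 unfolding ch(1,3,4) by (simp add: ch(2))
  qed (simp add: binomial_eq_0)
qed

end

section \<open>Additive functions on a layer of the filtration\<close>

lemma (in group) odd_torsion_eq_one:
  assumes "t \<in> carrier G" "t [^] (q::nat) = \<one>" "odd q" "t \<otimes> t = \<one>"
  shows "t = \<one>"
proof -
  obtain k where "q = Suc (2 * k)" using assms(3) by (auto elim: oddE)
  moreover have "t [^] (2 * k) = (t \<otimes> t) [^] k"
    using assms(1) by (simp add: mult_2 pow_mult_distrib nat_pow_mult)
  ultimately show ?thesis using assms by simp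
qed

context exterior_pairing5
begin

text \<open>The target \<open>F 2\<close> only serves as an abelian group containing all values that occur.\<close>

definition hchar where
  "hchar i k N \<longleftrightarrow> (\<forall>t\<in>F i. N t \<in> F 2) \<and>
     (\<forall>t\<in>F i. \<forall>u\<in>F i. N (t \<otimes> u) = N t \<otimes> N u) \<and> (\<forall>t\<in>F i. t \<in> F k \<longrightarrow> N t = \<one>)"

text \<open>A homomorphism that sees only the layer \<open>F n / F (Suc n)\<close>, on which
  \<open>G\<close> acts trivially and brackets are multilinear.\<close>

abbreviation lchar where "lchar n \<equiv> hchar n (Suc n)"

lemma F2_comm: "s \<in> F 2 \<Longrightarrow> t \<in> F 2 \<Longrightarrow> s \<otimes> t = t \<otimes> s"
  using F_comm[of s 2 t 2] by simp

context
  fixes i k N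
  assumes N: "hchar i k N"
begin

lemma hchar_F2: "t \<in> F i \<Longrightarrow> N t \<in> F 2"
  and hchar_mult: "t \<in> F i \<Longrightarrow> u \<in> F i \<Longrightarrow> N (t \<otimes> u) = N t \<otimes> N u"
  and hchar_kill: "t \<in> F i \<Longrightarrow> t \<in> F k \<Longrightarrow> N t = \<one>"
  using N by (auto simp: hchar_def)

lemma hchar_carrier: "t \<in> F i \<Longrightarrow> N t \<in> carrier T"
  by (rule F_carrier[OF hchar_F2])

lemma hchar_one: "N \<one> = \<one>"
  by (rule hchar_kill) simp_all

lemma hchar_inv: "t \<in> F i \<Longrightarrow> N (inv t) = inv (N t)"
  using hchar_mult[of "inv t" t] hchar_one
  by (intro T.inv_equality[symmetric]) (simp_all add: F_inv hchar_carrier)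

end

lemma hchar_mono: "hchar i k N \<Longrightarrow> i \<le> i' \<Longrightarrow> k \<le> k' \<Longrightarrow> hchar i' k' N"
  using F_antimono[of i i'] F_antimono[of k k'] unfolding hchar_def by blast

lemma hchar_pow_hom: "hchar i k N \<Longrightarrow> hchar i k (\<lambda>t. N t [^] (n::nat))"
  unfolding hchar_def by (auto simp: F_pow intro!: T.pow_mult_distrib intro: F2_comm)

lemma hchar_id: "lchar 4 (\<lambda>t. t)"
  unfolding hchar_def using F_antimono[of 2 4] F5[of _ 5] by auto

lemma hchar_conj:
  assumes "hchar i k N" "t \<in> F j" "u \<in> F i" "k \<le> i + j + 2"
  shows "N (t \<otimes> u \<otimes> inv t) = N u"
proof -
  have *: "commutator T t u \<in> F (i + j + 2)"
    using commutator_F[OF assms(2,3)] by (simp add: add.commute)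
  then have "commutator T t u \<in> F k" "commutator T t u \<in> F i"
    using assms(4) F_antimono[of k "i + j + 2"] F_antimono[of i "i + j + 2"] by auto
  moreover have "t \<otimes> u \<otimes> inv t = commutator T t u \<otimes> u"
    using assms by (simp add: commutator_def T.m_assoc)
  ultimately show ?thesis
    using assms by (simp add: hchar_mult[OF assms(1)] hchar_kill[OF assms(1)] hchar_carrier[OF assms(1)])
qed

lemma lchar_conj: "lchar n N \<Longrightarrow> t \<in> carrier T \<Longrightarrow> u \<in> F n \<Longrightarrow> N (t \<otimes> u \<otimes> inv t) = N u"
  using hchar_conj[of n "Suc n" N t 0 u] by (simp add: F_0)

lemma lchar_act:
  assumes "lchar n N" "x \<in> carrier G" "t \<in> F n"
  shows "N (act x t) = N t"
proof -
  have "br x t \<in> F (Suc n)" using br_F0 assms by blast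
  moreover from this have "br x t \<in> F n" using F_antimono[of n "Suc n"] by auto
  ultimately show ?thesis
    using assms by (simp add: act_def hchar_mult[OF assms(1)] hchar_kill[OF assms(1)] hchar_carrier[OF assms(1)])
qed

text \<open>In \<open>br_mult\<close> the second factor is conjugated by \<open>t\<close>, which
  changes it by a commutator in \<open>F (a + Suc i + i + 2)\<close>. The bound on \<open>k\<close>
  says that \<open>N\<close> kills this.\<close>

lemma hchar_br:
  assumes "x \<in> L a" "hchar (a + Suc i) (a + Suc k) N" "k \<le> 2 * i + 2"
  shows "hchar i k (\<lambda>t. N (br x t))"
  unfolding hchar_def
proof (intro conjI ballI impI)
  have [simp]: "x \<in> carrier G" using assms(1) by simp
  fix t assume t: "t \<in> F i"
  then show "N (br x t) \<in> F 2"
    using br_F[OF assms(1)] hchar_F2[OF assms(2)] by simp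
  show "N (br x t) = \<one>" if "t \<in> F k"
    using hchar_kill[OF assms(2) br_F[OF assms(1) t]] br_F[OF assms(1) that] by simp
  fix u assume u: "u \<in> F i"
  show "N (br x (t \<otimes> u)) = N (br x t) \<otimes> N (br x u)"
    using t u br_F[OF assms(1) t] br_F[OF assms(1) u] assms(3)
    by (simp add: br_mult hchar_mult[OF assms(2)] F_conj hchar_conj[OF assms(2), where j = i])
qed

lemma lchar_br: "x \<in> L a \<Longrightarrow> lchar (a + Suc i) N \<Longrightarrow> lchar i (\<lambda>t. N (br x t))"
  by (rule hchar_br) simp_all

lemma lchar_br0: "x \<in> carrier G \<Longrightarrow> lchar (Suc i) N \<Longrightarrow> lchar i (\<lambda>t. N (br x t))"
  using lchar_br[of x 0] by simp

section \<open>Bilinearity and the Jacobi identity on one layer\<close>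

context
  fixes n N
  assumes N: "lchar n N"
begin

lemma lchar_left:
  assumes "x \<in> L i" "y \<in> L i" "z \<in> L k" "n = i + k"
  shows "N (w (x \<otimes>\<^bsub>G\<^esub> y) z) = N (w x z) \<otimes> N (w y z)"
  using w_F[OF assms(1,3)] w_F[OF assms(2,3)] assms
  by (simp add: w_mult_left hchar_mult[OF N] F_act lchar_act[OF N] F2_comm hchar_F2[OF N])

lemma lchar_inv_left:
  assumes "x \<in> L i" "z \<in> L k" "n = i + k"
  shows "N (w (inv\<^bsub>G\<^esub> x) z) = inv (N (w x z))"
  using w_F[OF assms(1,2)] assms
  by (simp add: w_inv_left hchar_inv[OF N] F_act lchar_act[OF N])

lemma lchar_swap:
  assumes "x \<in> L i" "y \<in> L k" "n = i + k"
  shows "N (w y x) = inv (N (w x y))"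
  using w_F[OF assms(1,2)] assms by (simp add: w_swap[of x y] hchar_inv[OF N])

lemma lchar_br_left:
  assumes "x \<in> L i" "y \<in> L i" "t \<in> F k" "n = i + Suc k"
  shows "N (br (x \<otimes>\<^bsub>G\<^esub> y) t) = N (br x t) \<otimes> N (br y t)"
  using assms d_F[OF assms(3)] by (simp add: br_def lchar_left)

lemma lchar_br_inv_left:
  assumes "x \<in> L i" "t \<in> F k" "n = i + Suc k"
  shows "N (br (inv\<^bsub>G\<^esub> x) t) = inv (N (br x t))"
  using assms d_F[OF assms(2)] by (simp add: br_def lchar_inv_left)

text \<open>With \<open>u = [x, y]\<close> and \<open>v = [x, z]\<close>, conjugating
  \<open>t = w y z\<close> by \<open>x\<close> gives the symbol of \<open>u y\<close> and
  \<open>v z\<close>. After expansion, the factors with two of \<open>t, u, v\<close> have too high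
  a weight for \<open>N\<close>; those left are \<open>w y v\<close> and
  \<open>w u z\<close>.\<close>

lemma lchar_jacobi:
  assumes x: "x \<in> L i" and y: "y \<in> L j" and z: "z \<in> L k" and n: "n = i + j + k + 1"
  shows "N (w x (commutator G y z)) = N (w (commutator G x y) z) \<otimes> N (w y (commutator G x z))"
proof -
  have [simp]: "x \<in> carrier G" "y \<in> carrier G" "z \<in> carrier G" using assms by simp_all
  define t u v where "t = w y z" and "u = commutator G x y" and "v = commutator G x z"
  have t: "t \<in> F (j + k)" unfolding t_def by (rule w_F[OF y z])
  have u: "u \<in> L (Suc (i + j))" and v: "v \<in> L (Suc (i + k))"
    using d_F[OF w_F[OF x y]] d_F[OF w_F[OF x z]] by (simp_all add: u_def v_def d_w)
  have [simp]: "t \<in> carrier T" "u \<in> carrier G" "v \<in> carrier G" using t u v by simp_all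
  have low: "s \<in> F n" "s \<in> F (Suc n)" if "s \<in> F m" "n < m" for s m
    using that F_antimono[of n m] F_antimono[of "Suc n" m] by auto
  have k: "br v t \<in> F n" "br v t \<in> F (Suc n)" "br u t \<in> F n" "br u t \<in> F (Suc n)"
      "w u v \<in> F n" "w u v \<in> F (Suc n)"
    using low[OF br_F[OF v t]] low[OF br_F[OF u t]] low[OF w_F[OF u v]] n by simp_all
  have h: "w y v \<in> F n" "w u z \<in> F n" "br x t \<in> F n"
  proof -
    have "n = j + Suc (i + k)" "n = Suc (i + j) + k" "n = i + Suc (j + k)"
      using n by simp_all
    then show "w y v \<in> F n" "w u z \<in> F n" "br x t \<in> F n"
      using w_F[OF y v] w_F[OF u z] br_F[OF x t] by metis+
  qed
  have "act x t = w (u \<otimes>\<^bsub>G\<^esub> y) (v \<otimes>\<^bsub>G\<^esub> z)"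
    by (simp add: t_def act_w u_def v_def G.commutator_mult_right_eq_conjugate)
  also have "\<dots> = act u (w y v \<otimes> act v t) \<otimes> (w u v \<otimes> act v (w u z))"
    by (simp add: w_mult_left[of u y] w_mult_right[of y v z] w_mult_right[of u v z] t_def)
  also have "\<dots> = act u (w y v) \<otimes> (act u (br v t) \<otimes> br u t) \<otimes> (t \<otimes> (w u v \<otimes> act v (w u z)))"
    by (simp add: act_mult T.m_assoc) (simp add: act_def[of _ t] act_mult T.m_assoc)
  finally have "act x t \<otimes> inv t = act u (w y v) \<otimes> (act u (br v t) \<otimes> br u t) \<otimes> (t \<otimes> (w u v \<otimes> act v (w u z))) \<otimes> inv t"
    by (rule arg_cong)
  then have br: "br x t = act u (w y v) \<otimes> (act u (br v t) \<otimes> br u t) \<otimes> (t \<otimes> (w u v \<otimes> act v (w u z)) \<otimes> inv t)"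
    by (simp add: act_def[of x t] T.m_assoc)
  have "N (br x t) = N (w y v) \<otimes> (N (br v t) \<otimes> N (br u t)) \<otimes> N (w u v \<otimes> act v (w u z))"
  proof -
    have E: "w u v \<otimes> act v (w u z) \<in> F n"
      using k(5) h(2) by (intro F_mult F_act) simp_all
    have "act u (w y v) \<in> F n" "act u (br v t) \<in> F n"
      using h(1) k(1) by (simp_all add: F_act)
    then show ?thesis
      unfolding br
      using k(3) h(1) F_conj[OF E \<open>t \<in> carrier T\<close>]
      by (simp only: hchar_mult[OF N] F_mult lchar_act[OF N] lchar_conj[OF N] E k(1) \<open>t \<in> carrier T\<close> \<open>u \<in> carrier G\<close>)
  qed
  also have "\<dots> = N (w u z) \<otimes> N (w y v)"
    unfolding hchar_kill[OF N k(1,2)] hchar_kill[OF N k(3,4)]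
      hchar_mult[OF N k(5) F_act[OF \<open>v \<in> carrier G\<close> h(2)]] hchar_kill[OF N k(5,6)]
      lchar_act[OF N \<open>v \<in> carrier G\<close> h(2)]
    by (simp only: T.l_one T.r_one T.one_closed hchar_carrier[OF N h(1)] hchar_carrier[OF N h(2)])
      (rule F2_comm[OF hchar_F2[OF N h(1)] hchar_F2[OF N h(2)]])
  finally show ?thesis
    by (simp add: t_def u_def v_def br_w)
qed

end

lemma lchar_generate:
  assumes N: "lchar (Suc n) N" and "\<And>x t. x \<in> carrier G \<Longrightarrow> t \<in> F n \<Longrightarrow> N (br x t) = \<one>"
    and "t \<in> F (Suc n)"
  shows "N t = \<one>"
  using assms(3)
proof (induction rule: F_Suc_induct)
  case (inv x t)
  then show ?case using assms(2) by (simp add: hchar_inv[OF N] br_F0)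
qed (simp_all add: hchar_one[OF N] hchar_mult[OF N] assms(2))

lemma lchar_generate0:
  assumes N: "lchar 0 N" and "\<And>x y. x \<in> carrier G \<Longrightarrow> y \<in> carrier G \<Longrightarrow> N (w x y) = \<one>"
    and "t \<in> F 0"
  shows "N t = \<one>"
  using assms(3)
proof (induction rule: F_induct)
  case (inv x t)
  then show ?case using assms(2) by (simp add: hchar_inv[OF N] w_F0)
qed (simp_all add: hchar_one[OF N] hchar_mult[OF N] assms(2))

text \<open>As operators, \<open>xxz + xzx + zxx = [x, [x, z]] + 3 xzx\<close>.\<close>

lemma lchar_polarized_cube:
  assumes N: "lchar (Suc (Suc k)) N" and x: "x \<in> carrier G" and z: "z \<in> L k" and g: "g \<in> carrier G"
  shows "N (br x (br x (w z g))) \<otimes> N (br x (br z (w x g))) \<otimes> N (br z (br x (w x g))) =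
    N (w (commutator G x (commutator G x z)) g) \<otimes> N (br x (br z (w x g))) [^] (3::nat)"
proof -
  have [simp]: "x \<in> carrier G" "z \<in> carrier G" "g \<in> carrier G" using assms by simp_all
  have 0: "x \<in> L 0" "g \<in> L 0" by simp_all
  have c: "commutator G x z \<in> L (Suc k)" "commutator G x g \<in> L 1"
    using G.commutator_L_Suc(2)[OF z x] G.commutator_L_Suc(2)[OF 0(2) x] by simp_all
  have N': "lchar (Suc k) (\<lambda>t. N (br x t))" by (rule lchar_br0[OF x N])
  define A where "A = N (w (commutator G x (commutator G x z)) g)"
  define B where "B = N (w (commutator G x z) (commutator G x g))"
  define Q where "Q = N (w x (commutator G z (commutator G x g)))"
  have "commutator G x (commutator G x z) \<in> L (Suc (Suc k))"
    "commutator G z (commutator G x g) \<in> L (Suc (Suc k))"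
    using G.commutator_L_Suc(2)[OF c(1) x] d_F[OF w_F[OF z c(2)]] by (simp_all add: d_w)
  then have F: "A \<in> F 2" "B \<in> F 2" "Q \<in> F 2"
    unfolding A_def B_def Q_def using hchar_F2[OF N] w_F[OF c] by (simp_all add: w_F0 w_F0')
  have "N (br x (br x (w z g))) = N (br x (w (commutator G x z) g)) \<otimes> N (br x (w z (commutator G x g)))"
    using lchar_jacobi[OF N' 0(1) z 0(2)] by (simp add: br_w)
  also have "N (br x (w z (commutator G x g))) = Q"
    by (simp add: br_w Q_def)
  also have "N (br x (w (commutator G x z) g)) = A \<otimes> B"
    using lchar_jacobi[OF N 0(1) c(1) 0(2)] by (simp add: br_w A_def B_def)
  finally have P: "N (br x (br x (w z g))) = A \<otimes> B \<otimes> Q" .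
  have "N (br z (br x (w x g))) = N (w (commutator G z x) (commutator G x g)) \<otimes> Q"
    using lchar_jacobi[OF N z 0(1) c(2)] by (simp add: br_w br_def d_w Q_def)
  also have "N (w (commutator G z x) (commutator G x g)) = inv B"
    using lchar_inv_left[OF N c] by (simp add: B_def G.inv_commutator)
  finally have R: "N (br z (br x (w x g))) = inv B \<otimes> Q" .
  have "N (br x (br z (w x g))) = Q"
    by (simp add: br_w br_def d_w Q_def)
  moreover have "A \<otimes> B \<otimes> Q \<otimes> Q \<otimes> (inv B \<otimes> Q) = A \<otimes> (B \<otimes> (Q \<otimes> Q \<otimes> inv B)) \<otimes> Q"
    using F by (simp add: T.m_assoc)
  moreover have "Q \<otimes> Q \<otimes> inv B = inv B \<otimes> (Q \<otimes> Q)"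
    using F by (intro F2_comm F_mult F_inv)
  ultimately show ?thesis
    using F unfolding P R A_def[symmetric] by (simp add: numeral_3_eq_3 T.m_assoc)
qed

section \<open>Polarization of commutators of length four\<close>

lemma lchar2_br: "lchar 2 N \<Longrightarrow> x \<in> carrier G \<Longrightarrow> lchar 1 (\<lambda>t. N (br x t))"
  using lchar_br0[of x 1 N] by (simp add: numeral_2_eq_2)

lemma lchar1_br: "lchar 1 N \<Longrightarrow> x \<in> carrier G \<Longrightarrow> lchar 0 (\<lambda>t. N (br x t))"
  using lchar_br0[of x 0 N] by simp

lemmas lchar2_br_br = lchar1_br[OF lchar2_br]

lemma w_br_F: "x \<in> carrier G \<Longrightarrow> g \<in> carrier G \<Longrightarrow> w x g \<in> F 0"
  "x \<in> carrier G \<Longrightarrow> t \<in> F 0 \<Longrightarrow> br x t \<in> F 1"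
  "x \<in> carrier G \<Longrightarrow> t \<in> F 1 \<Longrightarrow> br x t \<in> F 2"
  "x \<in> carrier G \<Longrightarrow> t \<in> F 2 \<Longrightarrow> br x t \<in> F 3"
  "x \<in> carrier G \<Longrightarrow> t \<in> F 0 \<Longrightarrow> br x t \<in> F (Suc 0)"
  "x \<in> carrier G \<Longrightarrow> t \<in> F (Suc 0) \<Longrightarrow> br x t \<in> F 2"
  "x \<in> carrier G \<Longrightarrow> t \<in> F 3 \<Longrightarrow> br x t \<in> F 4"
  using br_F0[of x t 0] br_F0[of x t 1] br_F0[of x t 2] br_F0[of x t 3]
  by (simp_all add: w_F0 eval_nat_numeral)

context
  fixes N
  assumes N: "lchar 2 N"
begin

lemma lchar2_add1:
  assumes "x \<in> carrier G" "z \<in> carrier G" "t \<in> F 0"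
  shows "y \<in> carrier G \<Longrightarrow> N (br (x \<otimes>\<^bsub>G\<^esub> y) (br z t)) = N (br x (br z t)) \<otimes> N (br y (br z t))"
    and "N (br (inv\<^bsub>G\<^esub> x) (br z t)) = inv (N (br x (br z t)))"
  using assms lchar_br_left[OF N _ _ w_br_F(2), of x 0 y z t] lchar_br_inv_left[OF N _ w_br_F(2), of x 0 z t]
  by simp_all

lemma lchar2_add2:
  assumes "x \<in> carrier G" "z \<in> carrier G" "t \<in> F 0"
  shows "y \<in> carrier G \<Longrightarrow> N (br z (br (x \<otimes>\<^bsub>G\<^esub> y) t)) = N (br z (br x t)) \<otimes> N (br z (br y t))"
    and "N (br z (br (inv\<^bsub>G\<^esub> x) t)) = inv (N (br z (br x t)))"
  using assms lchar_br_left[OF lchar2_br[OF N], of z x 0 y t 0]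
    lchar_br_inv_left[OF lchar2_br[OF N], of z x 0 t 0]
  by simp_all

lemma lchar2_add3:
  assumes "x \<in> carrier G" "a \<in> carrier G" "b \<in> carrier G" "g \<in> carrier G"
  shows "y \<in> carrier G \<Longrightarrow> N (br a (br b (w (x \<otimes>\<^bsub>G\<^esub> y) g))) = N (br a (br b (w x g))) \<otimes> N (br a (br b (w y g)))"
    and "N (br a (br b (w (inv\<^bsub>G\<^esub> x) g))) = inv (N (br a (br b (w x g))))"
  using assms lchar_left[OF lchar2_br_br[OF N], of a b x 0 y g 0]
    lchar_inv_left[OF lchar2_br_br[OF N], of a b x 0 g 0]
  by simp_all

lemma lchar2_F2: "x \<in> carrier G \<Longrightarrow> y \<in> carrier G \<Longrightarrow> t \<in> F 0 \<Longrightarrow> N (br x (br y t)) \<in> F 2"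
  by (intro hchar_F2[OF N] w_br_F)

end

lemma F2_mult_inv: "s \<in> F 2 \<Longrightarrow> t \<in> F 2 \<Longrightarrow> inv (s \<otimes> t) = inv s \<otimes> inv t"
  by (simp add: T.inv_mult_group F2_comm F_inv)

lemma F2_pow_mult: "s \<in> F 2 \<Longrightarrow> t \<in> F 2 \<Longrightarrow> (s \<otimes> t) [^] (n::nat) = s [^] n \<otimes> t [^] n"
  by (rule T.pow_mult_distrib[OF F2_comm]) simp_all

text \<open>\<open>U\<close> and \<open>S\<close> are the parts of a relation that are odd and even
  in a variable; the hypotheses are the relation for the variable and for its inverse. With odd
  torsion both parts vanish.\<close>

lemma F2_polarize:
  assumes "U \<in> F 2" "S \<in> F 2" "U \<otimes> S = \<one>" "inv U \<otimes> S = \<one>"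
  shows "U \<otimes> U = \<one>" "S \<otimes> S = \<one>"
proof -
  have "S = inv U" using assms by (metis F_carrier T.inv_equality T.inv_inv T.inv_closed F2_comm)
  moreover have "S = U" using assms by (metis F_carrier T.inv_equality T.inv_inv T.inv_closed)
  ultimately show "U \<otimes> U = \<one>" "S \<otimes> S = \<one>" using assms by auto
qed

text \<open>Since \<open>w (x g) g = w x g\<close>, the left-hand side of the hypothesis is unchanged under
  \<open>x \<mapsto> x g\<^sup>\<plusminus>\<^sup>1\<close>; compare the terms quadratic in \<open>g\<close>.\<close>

lemma lchar_square_vanish:
  assumes N: "lchar 2 N" and tors: "\<And>t. t \<in> F 2 \<Longrightarrow> N t [^] (q::nat) = \<one>" "odd q"
    and K: "\<And>x g. x \<in> carrier G \<Longrightarrow> g \<in> carrier G \<Longrightarrow> N (br x (br x (w x g))) = K (w x g)"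
    and [simp]: "g \<in> carrier G" "x \<in> carrier G"
  shows "N (br g (br g (w g x))) = \<one>"
proof -
  have ig: "w (inv\<^bsub>G\<^esub> g) g = \<one>" by (simp add: w_inv_left)
  have w: "w (x \<otimes>\<^bsub>G\<^esub> g) g = w x g" "w (x \<otimes>\<^bsub>G\<^esub> inv\<^bsub>G\<^esub> g) g = w x g"
    by (simp_all add: w_mult_left ig)
  define f where "f a c = N (br a (br c (w x g)))" for a c
  have F: "f a c \<in> F 2" if "a \<in> carrier G" "c \<in> carrier G" for a c
    unfolding f_def using that by (intro lchar2_F2[OF N]) (simp_all add: w_br_F)
  have C [simp]: "f a c \<in> carrier T" if "a \<in> carrier G" "c \<in> carrier G" for a c
    using F[OF that] by simp
  have e: "f (x \<otimes>\<^bsub>G\<^esub> g) (x \<otimes>\<^bsub>G\<^esub> g) = f x x" "f (x \<otimes>\<^bsub>G\<^esub> inv\<^bsub>G\<^esub> g) (x \<otimes>\<^bsub>G\<^esub> inv\<^bsub>G\<^esub> g) = f x x"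
    using K[of x g] K[of "x \<otimes>\<^bsub>G\<^esub> g" g] K[of "x \<otimes>\<^bsub>G\<^esub> inv\<^bsub>G\<^esub> g" g] by (simp_all add: f_def w)
  have "f (x \<otimes>\<^bsub>G\<^esub> g) (x \<otimes>\<^bsub>G\<^esub> g) = f x x \<otimes> f x g \<otimes> (f g x \<otimes> f g g)"
    unfolding f_def by (simp add: lchar2_add1[OF N] w_br_F) (simp add: lchar2_add2[OF N] w_br_F)
  then have 1: "f x g \<otimes> f g x \<otimes> f g g = \<one>"
    using e(1) by (simp add: T.m_assoc)
  have "f (x \<otimes>\<^bsub>G\<^esub> inv\<^bsub>G\<^esub> g) (x \<otimes>\<^bsub>G\<^esub> inv\<^bsub>G\<^esub> g) = f x x \<otimes> inv (f x g) \<otimes> (inv (f g x) \<otimes> f g g)"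
    unfolding f_def
    by (simp add: lchar2_add1[OF N] w_br_F, simp add: lchar2_add2[OF N] w_br_F,
        simp add: F2_mult_inv lchar2_F2[OF N] w_br_F F_inv F_carrier[OF lchar2_F2[OF N]])
  then have 2: "inv (f x g \<otimes> f g x) \<otimes> f g g = \<one>"
    using e(2) F by (simp add: T.m_assoc F2_mult_inv)
  \<comment> \<open>Here \<open>U\<close> is \<open>f x g \<otimes> f g x\<close>, linear in the
    substituted \<open>g\<close>, and \<open>S\<close> is the quadratic term
    \<open>f g g\<close>.\<close>
  have "f g g \<otimes> f g g = \<one>"
    using F2_polarize[OF _ _ 1 2] F by (simp add: F_mult)
  then have "f g g = \<one>"
    using T.odd_torsion_eq_one[OF C tors(1)[of "br g (br g (w x g))", folded f_def] tors(2)]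
    by (simp add: w_br_F)
  moreover have "w g x = inv (w x g)" by (rule w_swap) simp_all
  ultimately show ?thesis
    using hchar_inv[OF lchar2_br_br[OF N], of g g "w x g"] by (simp add: f_def w_br_F)
qed

text \<open>Substitute \<open>x z\<close> and \<open>x z^-1\<close> for \<open>x\<close> in
  \<open>Z\<close>: the part linear in \<open>z\<close>, the product
  \<open>P \<otimes> Q \<otimes> R\<close>, is trivial. By \<open>lchar_polarized_cube\<close> it
  equals \<open>N (w [x, [x, z]] g)\<close> times a cube, and cubes of values vanish by
  \<open>tors3\<close>.\<close>

lemma lchar_cube_polarize:
  assumes N: "lchar 2 N" and tors: "\<And>t. t \<in> F 2 \<Longrightarrow> N t [^] (q::nat) = \<one>" "odd q"
    and tors3: "\<And>t. t \<in> F 2 \<Longrightarrow> N t [^] (3::nat) = \<one>"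
    and Z: "\<And>x g. x \<in> carrier G \<Longrightarrow> g \<in> carrier G \<Longrightarrow> N (br x (br x (w x g))) = \<one>"
    and [simp]: "g \<in> carrier G" "x \<in> carrier G" "z \<in> carrier G"
  shows "N (br g (br x (w x z))) = \<one>"
proof -
  define f where "f a c e = N (br a (br c (w e g)))" for a c e
  have F: "f a c e \<in> F 2" if "a \<in> carrier G" "c \<in> carrier G" "e \<in> carrier G" for a c e
    unfolding f_def using that by (intro lchar2_F2[OF N]) (simp_all add: w_br_F)
  have C [simp]: "f a c e \<in> carrier T" if "a \<in> carrier G" "c \<in> carrier G" "e \<in> carrier G" for a c e
    using F[OF that] by simp
  have Zf: "f a a a = \<one>" if "a \<in> carrier G" for a
    using Z[of a g] that by (simp add: f_def)
  note fadd = lchar2_add1[OF N] lchar2_add2[OF N] lchar2_add3[OF N] w_br_F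
  define P Q R S where "P = f x x z" and "Q = f x z x" and "R = f z x x"
    and "S = f x z z \<otimes> f z x z \<otimes> f z z x"
  have F': "P \<in> F 2" "Q \<in> F 2" "R \<in> F 2" "f x z z \<in> F 2" "f z x z \<in> F 2" "f z z x \<in> F 2" "S \<in> F 2"
    by (simp_all add: P_def Q_def R_def S_def F F_mult)
  have e: "f (x \<otimes>\<^bsub>G\<^esub> y) (x \<otimes>\<^bsub>G\<^esub> y) (x \<otimes>\<^bsub>G\<^esub> y) =
      f x x x \<otimes> f x x y \<otimes> (f x y x \<otimes> f x y y) \<otimes> (f y x x \<otimes> f y x y \<otimes> (f y y x \<otimes> f y y y))"
    if [simp]: "y \<in> carrier G" for y
    unfolding f_def
    by (simp add: lchar2_add1[OF N] w_br_F, simp add: lchar2_add2[OF N] w_br_F,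
        simp add: lchar2_add3[OF N] w_br_F)
  have i: "f x x (inv\<^bsub>G\<^esub> z) = inv P" "f x (inv\<^bsub>G\<^esub> z) x = inv Q" "f (inv\<^bsub>G\<^esub> z) x x = inv R"
    "f x (inv\<^bsub>G\<^esub> z) (inv\<^bsub>G\<^esub> z) = f x z z" "f (inv\<^bsub>G\<^esub> z) x (inv\<^bsub>G\<^esub> z) = f z x z"
    "f (inv\<^bsub>G\<^esub> z) (inv\<^bsub>G\<^esub> z) x = f z z x"
    using F' unfolding f_def P_def Q_def R_def by (simp_all add: fadd)
  have "P \<otimes> (Q \<otimes> f x z z) \<otimes> (R \<otimes> f z x z \<otimes> f z z x) = \<one>"
    using e[of z] F' by (simp add: Zf P_def Q_def R_def)
  moreover have "inv P \<otimes> (inv Q \<otimes> f x z z) \<otimes> (inv R \<otimes> f z x z \<otimes> f z z x) = \<one>"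
    using e[of "inv\<^bsub>G\<^esub> z"] F' by (simp add: Zf i)
  moreover have "A \<otimes> (B \<otimes> f x z z) \<otimes> (D \<otimes> f z x z \<otimes> f z z x) = A \<otimes> B \<otimes> D \<otimes> S"
    if "A \<in> F 2" "B \<in> F 2" "D \<in> F 2" for A B D
  proof -
    have "f x z z \<otimes> D = D \<otimes> f x z z" using that F' by (intro F2_comm)
    then have "f x z z \<otimes> (D \<otimes> r) = D \<otimes> (f x z z \<otimes> r)" if "r \<in> carrier T" for r
      using that \<open>D \<in> F 2\<close> by (simp flip: T.m_assoc)
    then show ?thesis using that by (simp add: S_def T.m_assoc)
  qed
  ultimately have "P \<otimes> Q \<otimes> R \<otimes> S = \<one>" "inv P \<otimes> inv Q \<otimes> inv R \<otimes> S = \<one>"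
    using F' F_inv by simp_all
  then have "P \<otimes> Q \<otimes> R \<otimes> (P \<otimes> Q \<otimes> R) = \<one>"
    using F' by (intro F2_polarize(1)[of _ S]) (simp_all add: F2_mult_inv F_mult)
  moreover have "(P \<otimes> Q \<otimes> R) [^] q = \<one>"
    using F' tors(1) w_br_F by (simp add: F2_pow_mult F_mult) (simp add: P_def Q_def R_def f_def w_br_F)
  ultimately have PQR: "P \<otimes> Q \<otimes> R = \<one>"
    using T.odd_torsion_eq_one[of "P \<otimes> Q \<otimes> R" q] F' tors(2) by simp
  have Q3: "Q [^] (3::nat) = \<one>" unfolding Q_def f_def by (intro tors3 w_br_F) simp_all
  define c where "c = commutator G x (commutator G x z)"
  have c: "c \<in> L 2"
    using G.commutator_L_Suc(2)[of "commutator G x z" 1 x] G.commutator_L_Suc(2)[of z 0 x]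
    by (simp add: c_def numeral_2_eq_2)
  have "P \<otimes> Q \<otimes> R = N (w c g) \<otimes> Q [^] (3::nat)"
    using lchar_polarized_cube[of 0 N x z g] N unfolding P_def Q_def R_def f_def c_def
    by (simp add: numeral_2_eq_2)
  then have "N (w c g) = \<one>"
    using PQR Q3 hchar_carrier[OF N] w_F0'[OF c, of g] by simp
  then have "N (w g c) = \<one>"
    using lchar_swap[OF N c, of g 0] by simp
  then show ?thesis by (simp add: br_w br_def d_w c_def)
qed

text \<open>The analogue of \<open>lchar_cube_polarize\<close> for \<open>z\<close> in
  \<open>L 1\<close>. The triple bracket lies in \<open>F 2\<close>, its variation linear in
  \<open>z\<close> in \<open>F 3\<close>, and terms with two entries \<open>z\<close> in
  \<open>F 4\<close>, where \<open>M\<close> is trivial. So the invariance \<open>H\<close> alone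
  isolates the linear part, and no substitution of \<open>z^-1\<close> is called for.\<close>

lemma hchar_cube_polarize:
  assumes M: "hchar 2 4 M" and tors3: "\<And>t. t \<in> F 3 \<Longrightarrow> M t [^] (3::nat) = \<one>"
    and x [simp]: "x \<in> carrier G" and z: "z \<in> L 1" and g [simp]: "g \<in> carrier G"
    and H: "M (br (x \<otimes>\<^bsub>G\<^esub> z) (br (x \<otimes>\<^bsub>G\<^esub> z) (w (x \<otimes>\<^bsub>G\<^esub> z) g))) = M (br x (br x (w x g)))"
  shows "M (br g (br x (w x z))) = \<one>"
proof -
  have [simp]: "z \<in> carrier G" using z by simp
  have M3: "lchar 3 M" using hchar_mono[OF M, of 3 4] by simp
  have N1: "hchar 1 3 (\<lambda>t. M (br x t))"
    using hchar_br[of x 0 1 3 M] M by (simp add: numeral_2_eq_2)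
  have N1': "lchar 2 (\<lambda>t. M (br x t))" using hchar_mono[OF N1, of 2 3] by simp
  have N2: "hchar 0 2 (\<lambda>t. M (br x (br x t)))"
    using hchar_br[of x 0 0 2 "\<lambda>t. M (br x t)"] N1 by (simp add: numeral_3_eq_3 numeral_2_eq_2)
  have N2': "lchar 1 (\<lambda>t. M (br x (br x t)))"
    using hchar_mono[OF N2, of 1 2] by (simp add: numeral_2_eq_2)
  have Z1: "lchar 1 (\<lambda>t. M (br z t))"
    using lchar_br[OF z, of 1 M] M3 by (simp add: eval_nat_numeral)
  have Zx: "lchar 0 (\<lambda>t. M (br z (br x t)))" using lchar1_br[OF Z1 x] .
  have xZ: "lchar 0 (\<lambda>t. M (br x (br z t)))"
    using lchar_br[OF z, of 0 "\<lambda>t. M (br x t)"] N1' by (simp add: numeral_2_eq_2)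
  have brz: "br z t \<in> F (Suc (Suc j))" if "t \<in> F j" for t j
    using br_F[OF z that] by simp
  have brz': "t \<in> F 0 \<Longrightarrow> br z t \<in> F 2" "t \<in> F 1 \<Longrightarrow> br z t \<in> F 3" for t
    using brz[of t 0] brz[of t 1] by (simp_all add: eval_nat_numeral)
  have up: "t \<in> F 3 \<Longrightarrow> t \<in> F 2" "t \<in> F 2 \<Longrightarrow> t \<in> F 1" "t \<in> F 1 \<Longrightarrow> t \<in> F 0" for t
    using F_antimono[of 2 3] F_antimono[of 1 2] F_antimono[of 0 1] by auto
  define y u b b' where "y = x \<otimes>\<^bsub>G\<^esub> z" and "u = w z g" and "b = w x g" and "b' = w y g"
  have y [simp]: "y \<in> carrier G" by (simp add: y_def)
  have b: "b \<in> F 0" "b' \<in> F 0" by (simp_all add: b_def b'_def w_br_F)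
  have u: "u \<in> F 1" using w_F0'[OF z g] by (simp add: u_def)
  have b'_eq: "b' = act x u \<otimes> b" by (simp add: b'_def b_def u_def y_def w_mult_left)
  have au: "act x u \<in> F 1" "act x u \<in> F 0" using u by (simp_all add: F_act up)
  have s1: "M (br y t) = M (br x t) \<otimes> M (br z t)" if t: "t \<in> F 1" for t
  proof -
    have z3: "br z t \<in> F 3" and x2: "br x t \<in> F 2" using t by (simp_all add: brz' w_br_F)
    have "br y t = act x (br z t) \<otimes> br x t" using t by (simp add: y_def br_mult_left)
    moreover have "M (act x (br z t)) = M (br z t)" using z3 by (intro lchar_act[OF M3]) simp_all
    ultimately have "M (br y t) = M (br z t) \<otimes> M (br x t)"
      using z3 x2 by (simp add: hchar_mult[OF M] F_act up)
    also note F2_comm[OF hchar_F2[OF M up(1)[OF z3]] hchar_F2[OF M x2]]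
    finally show ?thesis .
  qed
  have t: "br y b' \<in> F 1" using b by (simp add: w_br_F)
  have teq: "br y b' = act x (br z b') \<otimes> br x b'" using b by (simp add: y_def br_mult_left)
  have zb: "act x (br z b') \<in> F 2" "act x (br z b') \<in> F 1" and xb: "br x b' \<in> F 1"
    using b by (simp_all add: F_act brz' up w_br_F)
  have "M (br x (br y b')) = M (br x (act x (br z b'))) \<otimes> M (br x (br x b'))"
    unfolding teq using zb xb by (simp add: hchar_mult[OF N1])
  also have "M (br x (act x (br z b'))) = M (br x (br z b'))"
    using b by (intro lchar_act[OF N1']) (simp_all add: brz')
  also have "M (br x (br z b')) = M (br x (br z b))"
    unfolding b'_eq using b au hchar_carrier[OF xZ b(1)] by (simp add: hchar_mult[OF xZ] hchar_kill[OF xZ])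
  also have "M (br x (br x b')) = M (br x (br x u)) \<otimes> M (br x (br x b))"
    unfolding b'_eq using b u au by (simp add: hchar_mult[OF N2] lchar_act[OF N2'])
  finally have 1: "M (br x (br y b')) = M (br x (br z b)) \<otimes> (M (br x (br x u)) \<otimes> M (br x (br x b)))" .
  have "M (br z (br y b')) = M (br z (act x (br z b'))) \<otimes> M (br z (br x b'))"
    unfolding teq using zb xb by (simp add: hchar_mult[OF Z1])
  \<comment> \<open>Two entries \<open>z\<close> push this factor into \<open>F 4\<close>.\<close>
  also have "M (br z (act x (br z b'))) = \<one>"
    using zb by (intro hchar_kill[OF Z1]) (simp_all add: numeral_2_eq_2)
  also have "M (br z (br x b')) = M (br z (br x b))"
    unfolding b'_eq using b au hchar_carrier[OF Zx b(1)] by (simp add: hchar_mult[OF Zx] hchar_kill[OF Zx])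
  finally have 2: "M (br z (br y b')) = M (br z (br x b))"
    using hchar_carrier[OF Zx b(1)] by simp
  define P Q R where "P = M (br x (br x u))" and "Q = M (br x (br z b))" and "R = M (br z (br x b))"
  have F: "P \<in> F 2" "Q \<in> F 2" "R \<in> F 2" "M (br x (br x b)) \<in> F 2"
    using hchar_F2[OF N2 up(3)[OF u]] hchar_F2[OF xZ b(1)] hchar_F2[OF Zx b(1)] hchar_F2[OF N2 b(1)]
    by (simp_all add: P_def Q_def R_def)
  have "M (br y (br y b')) = Q \<otimes> (P \<otimes> M (br x (br x b))) \<otimes> R"
    using s1[OF t] 1 2 by (simp add: P_def Q_def R_def)
  moreover have "M (br y (br y b')) = M (br x (br x b))"
    using H by (simp add: y_def b_def b'_def)
  moreover have "Q \<otimes> (P \<otimes> m) \<otimes> R = P \<otimes> Q \<otimes> R \<otimes> m" if "m \<in> F 2" for m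
  proof -
    have "Q \<otimes> (P \<otimes> m) \<otimes> R = (Q \<otimes> P) \<otimes> (m \<otimes> R)"
      using F(1-3) that by (simp add: T.m_assoc)
    also have "\<dots> = (P \<otimes> Q) \<otimes> (R \<otimes> m)"
      by (simp only: F2_comm[OF F(2,1)] F2_comm[OF that F(3)])
    finally show ?thesis
      using F(1-3) that by (simp add: T.m_assoc)
  qed
  ultimately have "P \<otimes> Q \<otimes> R \<otimes> M (br x (br x b)) = M (br x (br x b))"
    using F(4) by simp
  then have PQR: "P \<otimes> Q \<otimes> R = \<one>"
    using F by (simp only: T.r_cancel_one F_carrier T.m_closed)
  define c where "c = commutator G x (commutator G x z)"
  have c: "c \<in> L 3"
    using G.commutator_L_Suc(2)[OF G.commutator_L_Suc(2)[OF z x] x] by (simp add: c_def eval_nat_numeral)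
  have Q3: "Q [^] (3::nat) = \<one>"
    unfolding Q_def by (rule tors3[OF w_br_F(4)[OF x brz'(1)[OF b(1)]]])
  have "P \<otimes> Q \<otimes> R = M (w c g) \<otimes> Q [^] (3::nat)"
    using lchar_polarized_cube[of 1 M x z g] M3 z unfolding P_def Q_def R_def c_def u_def b_def
    by (simp add: eval_nat_numeral)
  then have "M (w c g) = \<one>"
    using PQR Q3 hchar_carrier[OF M3] w_F0'[OF c, of g] by simp
  then have "M (w g c) = \<one>"
    using lchar_swap[OF M3 c, of g 0] by simp
  then show ?thesis by (simp add: br_w br_def d_w c_def)
qed

text \<open>Hypotheses \<open>A12\<close> and \<open>A23\<close> make \<open>N [g, [x, [y, z]]]\<close> alternating in its four arguments, so that
  \<open>N [[g, x], [y, z]]\<close> is twice that value. It is also antisymmetric under exchanging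
  \<open>[g, x]\<close> and \<open>[y, z]\<close>, an even permutation.\<close>

lemma lchar_alternating_vanish:
  assumes N: "lchar 2 N" and tors: "\<And>t. t \<in> F 2 \<Longrightarrow> N t [^] (q::nat) = \<one>" "odd q"
    and A12: "\<And>g y z. g \<in> carrier G \<Longrightarrow> y \<in> carrier G \<Longrightarrow> z \<in> carrier G \<Longrightarrow>
      N (br g (br g (w y z))) = \<one>"
    and A23: "\<And>g x z. g \<in> carrier G \<Longrightarrow> x \<in> carrier G \<Longrightarrow> z \<in> carrier G \<Longrightarrow>
      N (br g (br x (w x z))) = \<one>"
    and t: "t \<in> F 2"
  shows "N t = \<one>"
proof -
  define f where "f g x y z = N (br g (br x (w y z)))" for g x y z
  have F: "f g x y z \<in> F 2" if "g \<in> carrier G" "x \<in> carrier G" "y \<in> carrier G" "z \<in> carrier G" for g x y z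
    unfolding f_def using that by (intro lchar2_F2[OF N]) (simp_all add: w_br_F)
  note C = F_carrier[OF F]
  have s12: "f x g y z = inv (f g x y z)"
    if [simp]: "g \<in> carrier G" "x \<in> carrier G" "y \<in> carrier G" "z \<in> carrier G" for g x y z
  proof -
    have "f (g \<otimes>\<^bsub>G\<^esub> x) (g \<otimes>\<^bsub>G\<^esub> x) y z = f g g y z \<otimes> f g x y z \<otimes> (f x g y z \<otimes> f x x y z)"
      unfolding f_def by (simp add: lchar2_add1[OF N] w_br_F) (simp add: lchar2_add2[OF N] w_br_F)
    then have "f g x y z \<otimes> f x g y z = \<one>"
      using C[of g x y z] C[of x g y z] by (simp add: f_def A12)
    then show ?thesis
      using C[of g x y z] C[of x g y z] by (metis T.inv_equality T.inv_comm that)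
  qed
  have s23: "f g y x z = inv (f g x y z)"
    if [simp]: "g \<in> carrier G" "x \<in> carrier G" "y \<in> carrier G" "z \<in> carrier G" for g x y z
  proof -
    have "f g (x \<otimes>\<^bsub>G\<^esub> y) (x \<otimes>\<^bsub>G\<^esub> y) z = f g x x z \<otimes> f g x y z \<otimes> (f g y x z \<otimes> f g y y z)"
      unfolding f_def by (simp add: lchar2_add2[OF N] w_br_F) (simp add: lchar2_add3[OF N] w_br_F)
    then have "f g x y z \<otimes> f g y x z = \<one>"
      using C[of g x y z] C[of g y x z] by (simp add: f_def A23)
    then show ?thesis
      using C[of g x y z] C[of g y x z] by (metis T.inv_equality T.inv_comm that)
  qed
  have s34: "f g x z y = inv (f g x y z)"
    if [simp]: "g \<in> carrier G" "x \<in> carrier G" "y \<in> carrier G" "z \<in> carrier G" for g x y z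
    unfolding f_def w_swap[OF that(3,4)] using hchar_inv[OF lchar2_br_br[OF N]] by (simp add: w_br_F)
  have J: "N (w (commutator G g x) (commutator G y z)) = f g x y z \<otimes> f g x y z"
    if [simp]: "g \<in> carrier G" "x \<in> carrier G" "y \<in> carrier G" "z \<in> carrier G" for g x y z
  proof -
    have c: "commutator G y z \<in> L 1" "commutator G g x \<in> L 1"
      using G.commutator_L_Suc(2)[of z 0 y] G.commutator_L_Suc(2)[of x 0 g] by simp_all
    have "f g x y z = N (w (commutator G g x) (commutator G y z)) \<otimes> f x g y z"
      using lchar_jacobi[OF N, of g 0 x 0 "commutator G y z" 1] c by (simp add: f_def br_w br_def d_w)
    then show ?thesis
      using C[of g x y z] hchar_carrier[OF N] w_F[OF c(2,1)] s12[of g x y z]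
      by (simp add: numeral_2_eq_2 T.inv_solve_right)
  qed
  have f: "f g x y z = \<one>"
    if [simp]: "g \<in> carrier G" "x \<in> carrier G" "y \<in> carrier G" "z \<in> carrier G" for g x y z
  proof -
    let ?a = "f g x y z"
    have c: "commutator G y z \<in> L 1" "commutator G g x \<in> L 1"
      using G.commutator_L_Suc(2)[of z 0 y] G.commutator_L_Suc(2)[of x 0 g] by simp_all
    have "f y z g x = ?a"
      using C[of g x y z] s23[of y g z x] s12[of g y z x] s34[of g y x z] s23[of g x y z] by simp
    then have "N (w (commutator G y z) (commutator G g x)) = ?a \<otimes> ?a"
      using J[of y z g x] by simp
    moreover have "N (w (commutator G y z) (commutator G g x)) = inv (N (w (commutator G g x) (commutator G y z)))"
      using lchar_swap[OF N c(2,1)] by simp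
    ultimately have "?a \<otimes> ?a = inv (?a \<otimes> ?a)"
      using J[of g x y z] by simp
    then have "?a \<otimes> ?a \<otimes> (?a \<otimes> ?a) = \<one>"
      using C[of g x y z] by (metis T.m_closed T.r_inv that)
    moreover have "(?a \<otimes> ?a) [^] q = \<one>" "?a [^] q = \<one>"
      using F[of g x y z] tors(1)[of "br g (br x (w y z))"] by (simp_all add: F2_pow_mult w_br_F f_def)
    ultimately have "?a \<otimes> ?a = \<one>"
      using T.odd_torsion_eq_one[of "?a \<otimes> ?a" q] C[of g x y z] tors(2) by simp
    then show ?thesis
      using T.odd_torsion_eq_one[of ?a q] C[of g x y z] tors(2) \<open>?a [^] q = \<one>\<close> by simp
  qed
  have "N (br g (br x s)) = \<one>" if "g \<in> carrier G" "x \<in> carrier G" "s \<in> F 0" for g x s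
    using lchar_generate0[OF lchar2_br_br[OF N] _ that(3)] f that by (simp add: f_def)
  then have "N (br g s) = \<one>" if "g \<in> carrier G" "s \<in> F 1" for g s
    using lchar_generate[of 0 "\<lambda>t. N (br g t)" s] lchar2_br[OF N] that by simp
  then show ?thesis
    using lchar_generate[of 1 N t] N t by (simp add: numeral_2_eq_2)
qed

end

section \<open>The exponent of the pairing\<close>

lemma mult_choose_eq: "Suc k * (q choose Suc k) = q * ((q - 1) choose k)" for q :: nat
  using Suc_times_binomial_eq[of "q - 1" k] by (cases q) (simp_all add: mult.commute)

lemma dvd_choose_2: "odd q \<Longrightarrow> q dvd (q choose 2)" for q :: nat
proof -
  assume "odd q"
  moreover have "q dvd 2 * (q choose 2)"
    using mult_choose_eq[of 1 q] by (simp add: numeral_2_eq_2)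
  ultimately show ?thesis by (simp add: coprime_dvd_mult_right_iff)
qed

lemma dvd_choose_4: "odd q \<Longrightarrow> q dvd (q choose 4)" for q :: nat
proof -
  assume "odd q"
  \<comment> \<open>The factor 4 is split so that oddness of \<open>q\<close> cancels each 2
    separately.\<close>
  moreover have "2 * (2 * (q choose 4)) = q * ((q - 1) choose 3)"
    using mult_choose_eq[of 3 q] by (simp add: eval_nat_numeral)
  then have "q dvd 2 * (2 * (q choose 4))" by simp
  ultimately show ?thesis by (metis coprime_dvd_mult_right_iff coprime_right_2_iff_odd)
qed

lemma dvd_3_choose_3: "q dvd 3 * (q choose 3)" for q :: nat
  using mult_choose_eq[of 2 q] by (simp add: eval_nat_numeral)

lemma dvd_5_choose_5: "q dvd 5 * (q choose 5)" for q :: nat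
  using mult_choose_eq[of 4 q] by (simp add: eval_nat_numeral)

locale exterior_pairing5_exp = exterior_pairing5 +
  fixes q :: nat
  assumes odd_q: "odd q" and exp_q: "x \<in> carrier G \<Longrightarrow> x [^]\<^bsub>G\<^esub> q = \<one>\<^bsub>G\<^esub>"
begin

text \<open>Together with \<open>v\<close> these are the binomial exponents that need not be
  multiples of \<open>q\<close>; they become so after multiplication by 3 and 5
  respectively.\<close>

abbreviation s where "s \<equiv> q choose 3"
abbreviation v where "v \<equiv> q choose 5"

text \<open>Reduces the exponents of the commutators in \<open>norm_eq\<close> modulo
  \<open>q\<close>: the first to \<open>2 * s\<close>, the second to zero, since \<open>q\<close>
  divides \<open>3 * s\<close>, \<open>q choose 2\<close> and \<open>q choose 4\<close>.\<close>

lemma choose_Suc_q: "2 * (Suc q choose 3) = 2 * s + 2 * (q choose 2)"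
  "3 * (Suc q choose 4) = 3 * s + 3 * (q choose 4)"
  by (simp_all add: eval_nat_numeral)

lemmas norm_eq' = norm_eq[OF _ _ HOL.refl HOL.refl HOL.refl HOL.refl HOL.refl HOL.refl]

lemma norm_exponent:
  assumes "x \<in> carrier G" "g \<in> carrier G"
  shows "norm x (w x g) q = \<one>"
  using w_pow[of x g q] assms by (simp add: exp_q)

text \<open>From index 2 on the groups \<open>F n\<close> are abelian, so powers are multiplicative
  and generators suffice.\<close>

lemma F_pow_generate:
  assumes "2 \<le> n" and "\<And>g h. g \<in> carrier G \<Longrightarrow> h \<in> L n \<Longrightarrow> w g h [^] (m::nat) = \<one>" and "t \<in> F n"
  shows "t [^] m = \<one>"
  using assms(3)
proof (induction rule: F_induct)
  case (inv g h)
  then show ?case using assms(2) by (simp add: T.nat_pow_inv)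
next
  case (mult t u)
  have "t \<in> F 2" "u \<in> F 2" using mult assms(1) F_antimono by blast+
  then show ?case using mult by (simp add: F2_pow_mult)
qed (use assms(2) in simp_all)

section \<open>Exponents in weights six and five, and the collected relations\<close>

lemma br_F4: "x \<in> carrier G \<Longrightarrow> t \<in> F 4 \<Longrightarrow> br x t = \<one>"
  using br_F0[of x t 4] by (simp add: F5)

lemma br_one [simp]: "x \<in> carrier G \<Longrightarrow> br x \<one> = \<one>"
  by (simp add: br_def)

text \<open>For a symbol in \<open>F 4\<close> all further brackets vanish and collection leaves
  \<open>b^q = 1\<close>. In \<open>F 3\<close> below one bracket survives, in \<open>F 4\<close>
  and with exponent \<open>q choose 2\<close>.\<close>

lemma F4_pow_q: "t \<in> F 4 \<Longrightarrow> t [^] q = \<one>"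
proof (rule F_pow_generate)
  fix g h assume gh: "g \<in> carrier G" "h \<in> L 4"
  then have b: "w g h \<in> F 4" "h \<in> carrier G" by (simp_all add: w_F0)
  then show "w g h [^] q = \<one>"
    using norm_exponent[of g h] gh norm_eq'[of g "w g h" q]
    by (simp add: br_F4 commutator_def)
qed simp_all

lemma F4_pow: "t \<in> F 4 \<Longrightarrow> q dvd m \<Longrightarrow> t [^] m = \<one>"
  by (rule T.pow_eq_one_dvd[OF F_carrier F4_pow_q])

lemma F3_pow_q: "t \<in> F 3 \<Longrightarrow> t [^] q = \<one>"
proof (rule F_pow_generate)
  fix g h assume gh: "g \<in> carrier G" "h \<in> L 3"
  then have b: "w g h \<in> F 3" "h \<in> carrier G" by (simp_all add: w_F0)
  then have 4: "br g (w g h) \<in> F 4" using gh by (simp add: w_br_F)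
  then have "br g (w g h) [^] (q choose 2) = \<one>"
    using dvd_choose_2[OF odd_q] by (rule F4_pow)
  moreover have "commutator T (br g (w g h)) (w g h) = \<one>"
    using F5[OF commutator_F[OF 4 b(1)]] by simp
  ultimately show "w g h [^] q = \<one>"
    using norm_exponent[of g h] gh b 4 norm_eq'[of g "w g h" q]
    by (simp add: br_F4 commutator_def)
qed simp_all

lemma F3_pow: "t \<in> F 3 \<Longrightarrow> q dvd m \<Longrightarrow> t [^] m = \<one>"
  by (rule T.pow_eq_one_dvd[OF F_carrier F3_pow_q])

text \<open>The expansion of \<open>1 = w (x^q) g\<close> by \<open>norm_eq\<close>. The third
  bracket has exponent \<open>q choose 4\<close> in \<open>F 3\<close> and dies; so does the
  commutator in \<open>F 4\<close>, while the one in \<open>F 3\<close> keeps exponent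
  \<open>2 * s\<close>.\<close>

lemma relation:
  assumes [simp]: "x \<in> carrier G" "g \<in> carrier G" and b: "b = w x g"
  shows "b [^] q \<otimes> (br x b [^] (q choose 2) \<otimes> (br x (br x b) [^] s \<otimes>
    (br x (br x (br x (br x b))) [^] v \<otimes> commutator T (br x b) b [^] (2 * s)))) = \<one>"
proof -
  have F: "b \<in> F 0" "br x b \<in> F 1" "br x (br x b) \<in> F 2" "br x (br x (br x b)) \<in> F 3"
    by (simp_all add: b w_br_F)
  have "commutator T (br x b) b \<in> F 3" "commutator T (br x (br x b)) b \<in> F 4"
    using commutator_F[OF F(2,1)] commutator_F[OF F(3,1)] by (simp_all add: eval_nat_numeral)
  then have "commutator T (br x b) b [^] (2 * (Suc q choose 3)) = commutator T (br x b) b [^] (2 * s)"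
    "commutator T (br x (br x b)) b [^] (3 * (Suc q choose 4)) = \<one>"
    using F dvd_choose_2[OF odd_q] dvd_choose_4[OF odd_q] dvd_3_choose_3[of q]
    unfolding choose_Suc_q by (simp_all add: F3_pow F4_pow flip: T.nat_pow_mult)
  moreover have "br x (br x (br x b)) [^] (q choose 4) = \<one>"
    using F dvd_choose_4[OF odd_q] by (simp add: F3_pow)
  ultimately show ?thesis
    using norm_exponent[of x g] norm_eq'[of x b q] F by (simp add: b)
qed

text \<open>A \<open>g\<close> in \<open>L 1\<close> raises every weight by one, which removes the
  fourth bracket and the commutator.\<close>

lemma relation1:
  assumes x [simp]: "x \<in> carrier G" and g: "g \<in> L 1" and b: "b = w x g"
  shows "b [^] q \<otimes> (br x b [^] (q choose 2) \<otimes> br x (br x b) [^] s) = \<one>"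
proof -
  have F: "b \<in> F 1" using g by (simp add: b w_F0)
  then have F': "br x b \<in> F 2" "br x (br x (br x b)) \<in> F 4"
    by (simp_all add: w_br_F)
  have "commutator T (br x b) b = \<one>" using F5[OF commutator_F[OF F'(1) F]] by simp
  then show ?thesis
    using relation[of x g b] g F F' by (simp add: b br_F4)
qed

lemma relation2:
  assumes x [simp]: "x \<in> carrier G" and g: "g \<in> L 2" and b: "b = w x g"
  shows "b [^] q \<otimes> br x (br x b) [^] s = \<one>"
proof -
  have F: "b \<in> F 2" using g by (simp add: b w_F0)
  then have "br x b [^] (q choose 2) = \<one>"
    using dvd_choose_2[OF odd_q] by (simp add: F3_pow w_br_F)
  then show ?thesis
    using relation1[of x g b] g F G.L_antimono[of 1 2] by (auto simp: b)
qed

text \<open>By \<open>norm_d\<close>, \<open>t^-q (t u)^q\<close> is the norm of \<open>u\<close>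
  under \<open>d (t^-1)\<close>. This lies in \<open>L 2\<close>, so the only correction is a
  bracket in \<open>F 3\<close> with exponent \<open>q choose 2\<close>.\<close>

lemma F1_pow_mult:
  assumes t: "t \<in> F 1" and u: "u \<in> F 0"
  shows "(t \<otimes> u) [^] q = t [^] q \<otimes> u [^] q"
proof -
  define x b1 where "x = d (inv t)" and "b1 = br x u"
  have [simp]: "t \<in> carrier T" "u \<in> carrier T" using t u by simp_all
  have x: "x \<in> L 2" using d_F[OF F_inv[OF t]] by (simp add: x_def numeral_2_eq_2)
  have b1: "b1 \<in> F 3" using br_F[OF x u] by (simp add: b1_def eval_nat_numeral)
  have "br x b1 = \<one>" using br_F[OF x b1] by (simp add: F5)
  moreover have "commutator T b1 u = \<one>" using commutator_F[OF b1 u] by (simp add: F5)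
  moreover have "b1 [^] (q choose 2) = \<one>" using b1 dvd_choose_2[OF odd_q] by (rule F3_pow)
  ultimately have "norm x u q = u [^] q"
    using norm_eq'[of x u q] x by (simp add: b1_def[symmetric] commutator_def)
  then have "inv t [^] q \<otimes> (t \<otimes> u) [^] q = u [^] q"
    using norm_d[of u "inv t" q] by (simp add: x_def)
  then have "t [^] q \<otimes> (inv (t [^] q) \<otimes> (t \<otimes> u) [^] q) = t [^] q \<otimes> u [^] q"
    by (simp add: T.nat_pow_inv)
  then show ?thesis by simp
qed

lemma br_pow_q:
  assumes [simp]: "y \<in> carrier G" and b: "b \<in> F 0"
  shows "br y (b [^] q) = br y b [^] q"
proof -
  have "act y (b [^] q) = br y b [^] q \<otimes> b [^] q"
    using b by (simp add: act_pow) (simp add: act_def F1_pow_mult w_br_F)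
  then show ?thesis using b by (simp add: act_def)
qed

lemma br_mult_F1:
  assumes "y \<in> carrier G" "t \<in> F 1" "u \<in> F 1"
  shows "br y (t \<otimes> u) = br y t \<otimes> br y u"
proof -
  have "t \<otimes> br y u = br y u \<otimes> t"
    using assms F_comm[of t 1 "br y u" 2] by (simp add: w_br_F)
  then show ?thesis using assms by (simp add: br_mult T.m_assoc)
qed

lemma br_pow_F1: "y \<in> carrier G \<Longrightarrow> t \<in> F 1 \<Longrightarrow> br y (t [^] (n::nat)) = br y t [^] n"
  by (induction n) (simp_all add: br_mult_F1 F_pow)

lemma F_up: "t \<in> F 4 \<Longrightarrow> t \<in> F 3" "t \<in> F 3 \<Longrightarrow> t \<in> F 2" "t \<in> F 2 \<Longrightarrow> t \<in> F 1" "t \<in> F 1 \<Longrightarrow> t \<in> F 0"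
  using F_antimono[of 3 4] F_antimono[of 2 3] F_antimono[of 1 2] F_antimono[of 0 1] by auto

text \<open>Two evaluations of \<open>br y b [^] q\<close> are compared: bracket the relation for
  \<open>x, g\<close> with \<open>y\<close>, where the fourth bracket drops out, or apply
  \<open>relation1\<close> to \<open>br y b\<close>, which is the symbol \<open>w y (d b)\<close>.
  The left-hand side thus involves \<open>x\<close> only through \<open>b\<close>.\<close>

lemma relation_br:
  assumes y [simp]: "y \<in> carrier G" and x [simp]: "x \<in> carrier G" and g [simp]: "g \<in> carrier G"
    and b: "b = w x g"
  shows "br y (br y b) [^] (q choose 2) \<otimes> br y (br y (br y b)) [^] s =
    br y (br x b) [^] (q choose 2) \<otimes> (br y (br x (br x b)) [^] s \<otimes>
      br y (commutator T (br x b) b) [^] (2 * s))"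
proof -
  define b1 b2 b4 e where "b1 = br x b" and "b2 = br x b1" and "b4 = br x (br x b2)"
    and "e = commutator T b1 b"
  have F: "b \<in> F 0" "b1 \<in> F 1" "b2 \<in> F 2" "b4 \<in> F 4"
    by (simp_all add: b b1_def b2_def b4_def w_br_F)
  have e: "e \<in> F 3" using commutator_F[OF F(2,1)] by (simp add: e_def eval_nat_numeral)
  define X where "X = b1 [^] (q choose 2) \<otimes> (b2 [^] s \<otimes> (b4 [^] v \<otimes> e [^] (2 * s)))"
  note up = F_up(3)[OF F(3)] F_up(3)[OF F_up(2)[OF F_up(1)[OF F(4)]]] F_up(3)[OF F_up(2)[OF e]]
  have X: "X \<in> F 1" using F up unfolding X_def by (simp add: F_mult F_pow)
  have bX: "b [^] q \<otimes> X = \<one>"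
    using relation[of x g b] by (simp add: b X_def b1_def b2_def b4_def e_def)
  then have "b [^] q = inv X" using F X by (simp add: T.inv_equality)
  then have bq: "b [^] q \<in> F 1" using X F_inv by simp
  have "br y (b [^] q) \<otimes> br y X = \<one>"
    using bX bq X br_mult_F1[of y "b [^] q" X] by simp
  moreover have "br y X = br y b1 [^] (q choose 2) \<otimes> (br y b2 [^] s \<otimes> br y e [^] (2 * s))"
    using F up e unfolding X_def by (simp add: br_mult_F1 F_mult F_pow br_pow_F1 br_F4)
  ultimately have 1: "br y b [^] q \<otimes> (br y b1 [^] (q choose 2) \<otimes> (br y b2 [^] s \<otimes> br y e [^] (2 * s))) = \<one>"
    using F by (simp add: br_pow_q)
  have "d b \<in> L 1" using d_F[OF F(1)] by simp
  then have 2: "br y b [^] q \<otimes> (br y (br y b) [^] (q choose 2) \<otimes> br y (br y (br y b)) [^] s) = \<one>"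
    using relation1[of y "d b" "br y b"] by (simp add: br_def)
  have "A = B" if "C \<otimes> A = \<one>" "C \<otimes> B = \<one>" "C \<in> carrier T" "A \<in> carrier T" "B \<in> carrier T" for A B C
    using that by (metis T.inv_cancel_left(2))
  from this[OF 2 1] show ?thesis
    using F e by (simp add: b1_def b2_def e_def)
qed

section \<open>Weight six: removing the exponent \<open>s\<close>\<close>

lemma hchar_id': "2 \<le> i \<Longrightarrow> hchar i 5 (\<lambda>t. t)"
  unfolding hchar_def using F_antimono[of 2 i] F5[of _ 5] by auto

lemma lchar4_s: "lchar 4 (\<lambda>t. t [^] (m::nat))"
  using hchar_pow_hom[OF hchar_id, of m] .

lemma lchar3_s: "x \<in> carrier G \<Longrightarrow> lchar 3 (\<lambda>t. br x t [^] (m::nat))"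
  using lchar_br0[of x 3 "\<lambda>t. t [^] m"] lchar4_s by simp

lemma lchar2_s: "x \<in> carrier G \<Longrightarrow> y \<in> carrier G \<Longrightarrow> lchar 2 (\<lambda>t. br x (br y t) [^] (m::nat))"
  using lchar_br0[of y 2 "\<lambda>t. br x t [^] m"] lchar3_s by simp

lemma pow_s_q: "t \<in> F 3 \<Longrightarrow> (t [^] s) [^] q = \<one>" and pow_s_3: "t \<in> F 3 \<Longrightarrow> (t [^] s) [^] (3::nat) = \<one>"
  using F3_pow[of t "s * q"] F3_pow[of t "s * 3"] dvd_3_choose_3[of q]
  by (simp_all add: T.nat_pow_pow mult.commute)

text \<open>Bracket \<open>relation_br\<close> with \<open>z\<close>: the terms with exponent
  \<open>q choose 2\<close> land in \<open>F 3\<close> and die, the commutator term leaves the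
  filtration. The right-hand side depends only on \<open>w x g\<close>, as
  \<open>lchar_square_vanish\<close> demands.\<close>

lemma weight6_relation:
  assumes z [simp]: "z \<in> carrier G" and y [simp]: "y \<in> carrier G"
    and x [simp]: "x \<in> carrier G" and g [simp]: "g \<in> carrier G"
  shows "br z (br y (br x (br x (w x g)))) [^] s = br z (br y (br y (br y (w x g)))) [^] s"
proof -
  define b e where "b = w x g" and "e = commutator T (br x b) b"
  have F: "b \<in> F 0" by (simp add: b_def w_br_F)
  have "e \<in> F 3" unfolding e_def using commutator_F[of "br x b" 1 b 0] F by (simp add: w_br_F eval_nat_numeral)
  then have e: "br y e \<in> F 4" by (simp add: w_br_F)
  have F2: "br y (br y b) \<in> F 2" "br y (br y (br y b)) \<in> F 3" "br y (br x b) \<in> F 2" "br y (br x (br x b)) \<in> F 3"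
    using F by (simp_all add: w_br_F)
  note up = F_up(3)[OF F2(1)] F_up(3)[OF F_up(2)[OF F2(2)]] F_up(3)[OF F2(3)] F_up(3)[OF F_up(2)[OF F2(4)]]
    F_up(3)[OF F_up(2)[OF F_up(1)[OF e]]]
  have dies: "br z t [^] (q choose 2) = \<one>" if "t \<in> F 2" for t
    using that dvd_choose_2[OF odd_q] by (simp add: F3_pow w_br_F)
  have "br z (br y (br y b) [^] (q choose 2) \<otimes> br y (br y (br y b)) [^] s) =
    br z (br y (br x b) [^] (q choose 2) \<otimes> (br y (br x (br x b)) [^] s \<otimes> br y e [^] (2 * s)))"
    using relation_br[OF y x g b_def] by (simp add: e_def)
  then show ?thesis
    using up F2 e by (simp add: br_mult_F1 br_pow_F1 F_mult F_pow dies br_F4 b_def[symmetric])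
qed

lemma weight6_vanish:
  assumes z [simp]: "z \<in> carrier G" and y [simp]: "y \<in> carrier G"
    and x [simp]: "x \<in> carrier G" and g [simp]: "g \<in> carrier G"
  shows "br z (br y (br x (br x (w x g)))) [^] s = \<one>"
  by (rule lchar_square_vanish[OF lchar2_s _ odd_q weight6_relation])
    (simp_all add: pow_s_q w_br_F F_up)

lemma weight6_cube:
  assumes z [simp]: "z \<in> carrier G" and y [simp]: "y \<in> carrier G" and t: "t \<in> F 0"
  shows "br z (br y (br y (br y t))) [^] s = \<one>"
  using lchar_generate0[OF lchar2_br_br[OF lchar2_s[of z y s]], of y y t] t
    weight6_vanish weight6_relation by simp

text \<open>For a generator \<open>b = br x t\<close> of \<open>F 1\<close>,
  \<open>relation_br\<close> replaces the two inner brackets with \<open>y\<close> by brackets with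
  \<open>x\<close>. This produces a triple bracket with \<open>x\<close> on \<open>t\<close>, which
  \<open>weight6_cube\<close> kills.\<close>

lemma weight6_cube1:
  assumes y [simp]: "y \<in> carrier G" and t: "t \<in> F 1"
  shows "br y (br y (br y t)) [^] s = \<one>"
proof -
  have "br y (br y (br y (br x t))) [^] s = \<one>" if [simp]: "x \<in> carrier G" and t: "t \<in> F 0" for x t
  proof -
    define b where "b = br x t"
    have b: "b \<in> F 1" and g: "d t \<in> L 1" using t d_F[of t 0] by (simp_all add: b_def w_br_F)
    have bw: "b = w x (d t)" by (simp add: b_def br_def)
    have "commutator T (br x b) b = \<one>"
      using commutator_F[of "br x b" 2 b 1] b by (simp add: w_br_F F5)
    moreover have "br y (br y b) [^] (q choose 2) = \<one>" "br y (br x b) [^] (q choose 2) = \<one>"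
      using b dvd_choose_2[OF odd_q] by (simp_all add: F3_pow w_br_F)
    ultimately have "br y (br y (br y b)) [^] s = br y (br x (br x b)) [^] s"
      using relation_br[OF y \<open>x \<in> carrier G\<close> _ bw] b g by simp
    then show ?thesis using weight6_cube[of y x t] t by (simp add: b_def)
  qed
  then show ?thesis
    using lchar_generate[of 0 "\<lambda>t. br y (br y (br y t)) [^] s" t] lchar2_br[OF lchar2_s[of y y s], of y] t
    by simp
qed

text \<open>A generator is \<open>br x a\<close> with \<open>a\<close> in \<open>F 1\<close>, so the
  second term of \<open>relation2\<close> is a triple bracket with \<open>x\<close> on
  \<open>a\<close>, trivial to the power \<open>s\<close>.\<close>

lemma F2_pow_q: "t \<in> F 2 \<Longrightarrow> t [^] q = \<one>"
proof (rule F_pow_generate)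
  fix x g assume x: "x \<in> carrier G" and g: "g \<in> L 2"
  then obtain a where a: "a \<in> F 1" "g = d a" using L_Suc_image[of 1] by (auto simp: numeral_2_eq_2)
  then have "w x g = br x a" by (simp add: br_def)
  then show "w x g [^] q = \<one>"
    using relation2[OF x g HOL.refl] weight6_cube1[OF x a(1)] a x by simp
qed simp_all

lemma F2_pow: "t \<in> F 2 \<Longrightarrow> q dvd m \<Longrightarrow> t [^] m = \<one>"
  by (rule T.pow_eq_one_dvd[OF F_carrier F2_pow_q])

lemma relation_br':
  assumes y [simp]: "y \<in> carrier G" and x [simp]: "x \<in> carrier G" and g [simp]: "g \<in> carrier G"
    and b: "b = w x g"
  shows "br y (br y (br y b)) [^] s = br y (br x (br x b)) [^] s \<otimes> br y (commutator T (br x b) b) [^] (2 * s)"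
proof -
  have F: "b \<in> F 0" by (simp add: b w_br_F)
  have "commutator T (br x b) b \<in> F 3"
    using commutator_F[of "br x b" 1 b 0] F by (simp add: w_br_F eval_nat_numeral)
  then have "commutator T (br x b) b \<in> carrier T" by simp
  moreover have "br y (br y b) [^] (q choose 2) = \<one>" "br y (br x b) [^] (q choose 2) = \<one>"
    using F dvd_choose_2[OF odd_q] by (simp_all add: F2_pow w_br_F)
  ultimately show ?thesis
    using relation_br[OF y x g b] F by simp
qed

lemma w_shift:
  assumes [simp]: "x \<in> carrier G" "g \<in> carrier G" and z: "z \<in> L 1"
  obtains a where "a \<in> F 1" "w (x \<otimes>\<^bsub>G\<^esub> z) g = a \<otimes> w x g"
proof
  show "act x (w z g) \<in> F 1" using w_F0'[OF z] by (simp add: F_act)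
  show "w (x \<otimes>\<^bsub>G\<^esub> z) g = act x (w z g) \<otimes> w x g"
    using z by (simp add: w_mult_left)
qed

lemma lchar_br_shift:
  assumes N: "lchar (Suc j) N" and x: "x \<in> carrier G" and z: "z \<in> L 1" and t: "t \<in> F j"
  shows "N (br (x \<otimes>\<^bsub>G\<^esub> z) t) = N (br x t)"
proof -
  have "z \<in> carrier G" using z by simp
  have "br z t \<in> F (Suc (Suc j))" using br_F[OF z t] by simp
  then have "N (br z t) = \<one>"
    using F_antimono[of "Suc j" "Suc (Suc j)"] by (intro hchar_kill[OF N]) auto
  then show ?thesis
    using lchar_br_left[OF N, of x 0 z t j] x t \<open>z \<in> carrier G\<close> hchar_carrier[OF N, of "br x t"]
    by (simp add: br_F0)
qed

text \<open>As \<open>[u, t]\<close> is inverse to \<open>br (d t) u\<close>, the commutator can be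
  treated by multilinearity. Passing from \<open>x\<close> to \<open>x z\<close> changes each entry
  by higher weight, hence the value by terms in \<open>F 4\<close>. This cancels the commutator
  terms when relations for \<open>x\<close> and \<open>x z\<close> are compared.\<close>

lemma commutator_shift:
  assumes N: "lchar 3 N" and x [simp]: "x \<in> carrier G" and g [simp]: "g \<in> carrier G" and z: "z \<in> L 1"
    and b: "b = w x g" and b': "b' = w (x \<otimes>\<^bsub>G\<^esub> z) g"
  shows "N (commutator T (br (x \<otimes>\<^bsub>G\<^esub> z) b') b') = N (commutator T (br x b) b)"
proof -
  have [simp]: "z \<in> carrier G" using z by simp
  have F: "b \<in> F 0" "b' \<in> F 0" by (simp_all add: b b' w_br_F)
  obtain a where a: "a \<in> F 1" "b' = a \<otimes> b" using w_shift[OF x g z] b b' by metis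
  have flip: "N (commutator T u t) = inv (N (br (d t) u))" if "t \<in> F 0" "u \<in> F 1" for t u
  proof -
    have "br (d t) u \<in> F 3" using br_F[OF d_F[OF that(1)] that(2)] by (simp add: numeral_3_eq_3)
    moreover have "commutator T u t = inv (br (d t) u)"
      using that by (simp add: br_d T.inv_commutator)
    ultimately show ?thesis by (simp add: hchar_inv[OF N])
  qed
  have hom: "lchar 1 (\<lambda>u. N (br (d b) u))"
    using lchar_br[OF d_F[OF F(1)], of 1 N] N by (simp add: numeral_3_eq_3)
  let ?b1 = "br (x \<otimes>\<^bsub>G\<^esub> z) b'"
  have b1: "?b1 \<in> F 1" using F by (simp add: w_br_F)
  have da: "d a \<in> L 2" "d a \<in> L 1" "d b \<in> L 1"
    using d_F[OF a(1)] d_F[OF F(1)] G.L_antimono[of 1 2] by (auto simp: numeral_2_eq_2)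
  have "br (d a) ?b1 \<in> F 4" using br_F[OF da(1) b1] by (simp add: eval_nat_numeral)
  then have "N (br (d a) ?b1) = \<one>"
    using F_antimono[of 3 4] by (intro hchar_kill[OF N]) auto
  moreover have "N (br (d b) ?b1) \<in> carrier T" using hchar_carrier[OF hom b1] .
  ultimately have "N (br (d b') ?b1) = N (br (d b) ?b1)"
    using lchar_br_left[OF N da(2,3) b1] a F by simp
  also have "\<dots> = N (br (d b) (br x b'))"
    using lchar_br_shift[of 0, OF _ x z F(2)] hom by simp
  also have "\<dots> = N (br (d b) (br x a)) \<otimes> N (br (d b) (br x b))"
    unfolding a(2) using a F F_antimono[of 0 1]
    by (intro hchar_mult[OF lchar1_br[OF hom x]]) auto
  also have "N (br (d b) (br x a)) = \<one>"
    using a F_antimono[of 0 1] by (intro hchar_kill[OF lchar1_br[OF hom x]]) auto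
  finally have "N (br (d b') ?b1) = N (br (d b) (br x b))"
    using hchar_carrier[OF lchar1_br[OF hom x] F(1)] by simp
  then show ?thesis
    using F b1 by (simp add: flip w_br_F)
qed

text \<open>To get the invariance for \<open>hchar_cube_polarize\<close>, compare
  \<open>relation_br'\<close> for \<open>x\<close> and \<open>x z\<close>. The triple brackets with
  \<open>y\<close> agree since the two symbols differ by an element of \<open>F 1\<close>, where
  \<open>weight6_cube1\<close> applies; the commutator terms agree by
  \<open>commutator_shift\<close>.\<close>

lemma weight6_cube_polarized:
  assumes y [simp]: "y \<in> carrier G" and x [simp]: "x \<in> carrier G" and g [simp]: "g \<in> carrier G"
    and z: "z \<in> L 1"
  shows "br y (br g (br x (w x z))) [^] s = \<one>"
proof -
  have zG [simp]: "z \<in> carrier G" using z by simp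
  have M: "hchar 2 4 (\<lambda>t. br y t [^] s)"
    using hchar_br[of y 0 2 4 "\<lambda>t. t [^] s"] hchar_pow_hom[OF hchar_id'[of 3], of s]
    by (simp add: eval_nat_numeral)
  have K: "hchar 0 2 (\<lambda>t. br y (br y (br y t)) [^] s)"
    using hchar_br[of y 0 0 2 "\<lambda>t. br y (br y t) [^] s"] hchar_br[of y 0 1 3 "\<lambda>t. br y t [^] s"] M
    by (simp add: eval_nat_numeral)
  show ?thesis
  proof (rule hchar_cube_polarize[OF M _ x z g])
    show "(br y t [^] s) [^] (3::nat) = \<one>" if "t \<in> F 3" for t
      using that by (intro pow_s_3) (simp add: w_br_F F_up(1))
    let ?x = "x \<otimes>\<^bsub>G\<^esub> z"
    define b b' where b: "b = w x g" and b': "b' = w ?x g"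
    have F: "b \<in> F 0" "b' \<in> F 0" by (simp_all add: b b' w_br_F)
    obtain a where a: "a \<in> F 1" "b' = a \<otimes> b" using w_shift[OF x g z] b b' by metis
    have "br y (br y (br y b')) [^] s = br y (br y (br y b)) [^] s"
      unfolding a(2) using a F F_up(4) weight6_cube1[OF y a(1)] by (simp add: hchar_mult[OF K])
    moreover have "br y (commutator T (br ?x b') b') [^] (2 * s) = br y (commutator T (br x b) b) [^] (2 * s)"
      by (rule commutator_shift[OF lchar3_s[OF y] x g z b b'])
    moreover have c: "commutator T (br x b) b \<in> carrier T" using F by simp
    ultimately have "br y (br ?x (br ?x b')) [^] s \<otimes> br y (commutator T (br x b) b) [^] (2 * s) =
      br y (br x (br x b)) [^] s \<otimes> br y (commutator T (br x b) b) [^] (2 * s)"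
      using relation_br'[OF y _ g b'] relation_br'[OF y x g b] by simp
    then show "br y (br ?x (br ?x b')) [^] s = br y (br x (br x b)) [^] s"
      using F c by (subst (asm) T.right_cancel) simp_all
  qed
qed

text \<open>With \<open>z\<close> and \<open>y\<close> as outer entries, the inner commutator of
  length four is alternating to the power \<open>s\<close>: in its first two entries by
  \<open>weight6_cube_polarized\<close> at \<open>[p, r]\<close>, in the middle two by
  \<open>lchar_cube_polarize\<close>. Then \<open>lchar_alternating_vanish\<close> applies, and such
  brackets generate \<open>F 4\<close>.\<close>

lemma F4_pow_s: "t \<in> F 4 \<Longrightarrow> t [^] s = \<one>"
proof -
  assume t: "t \<in> F 4"
  have F2: "br z (br y t) [^] s = \<one>" if [simp]: "z \<in> carrier G" "y \<in> carrier G" and t: "t \<in> F 2" for z y t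
  proof (rule lchar_alternating_vanish[OF lchar2_s[OF that(1,2)] _ odd_q _ _ t])
    show q: "(br z (br y t) [^] s) [^] q = \<one>" if "t \<in> F 2" for t
      using that by (intro pow_s_q) (simp add: w_br_F F_up(1))
    show "br z (br y (br g (br g (w p r)))) [^] s = \<one>"
      if "g \<in> carrier G" "p \<in> carrier G" "r \<in> carrier G" for g p r
      using weight6_cube_polarized[of z g y "commutator G p r"] that G.commutator_L_Suc(2)[of r 0 p]
      by (simp add: br_w)
    show "br z (br y (br g (br x (w x p)))) [^] s = \<one>"
      if "g \<in> carrier G" "x \<in> carrier G" "p \<in> carrier G" for g x p
    proof (rule lchar_cube_polarize[OF lchar2_s[OF \<open>z \<in> carrier G\<close> \<open>y \<in> carrier G\<close>] q odd_q _ _ that(1,2,3)])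
      show "(br z (br y t) [^] s) [^] (3::nat) = \<one>" if "t \<in> F 2" for t
        using that by (intro pow_s_3) (simp add: w_br_F F_up(1))
    qed (simp_all add: weight6_vanish)
  qed
  have "br z t [^] s = \<one>" if "z \<in> carrier G" "t \<in> F 3" for z t
    using lchar_generate[of 2 "\<lambda>t. br z t [^] s" t] lchar3_s[of z s] F2 that by simp
  then show ?thesis
    using lchar_generate[of 3 "\<lambda>t. t [^] s" t] lchar4_s[of s] t by simp
qed

lemma F4_pow_2s: "t \<in> F 4 \<Longrightarrow> t [^] (2 * s) = \<one>"
  using F4_pow_s[of t] T.nat_pow_pow[of t s 2] by (simp add: mult.commute)

section \<open>Weight five: the same with one outer entry fewer\<close>

lemma lchar3_pow_s: "lchar 3 (\<lambda>t. t [^] s)" "lchar 3 (\<lambda>t. t [^] (2 * s))"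
  using hchar_pow_hom[OF hchar_id'[of 3], of s] hchar_pow_hom[OF hchar_id'[of 3], of "2 * s"]
    F4_pow_s F4_pow_2s by (simp_all add: hchar_def)

lemma lchar2_br_s: "y \<in> carrier G \<Longrightarrow> lchar 2 (\<lambda>t. br y t [^] s)"
  using lchar_br0[of y 2 "\<lambda>t. t [^] s"] lchar3_pow_s by simp

text \<open>The bracketed commutator lies in \<open>F 4\<close>, where \<open>2 * s\<close> is now
  an exponent, so \<open>relation_br'\<close> loses its last term.\<close>

lemma weight5_relation:
  assumes [simp]: "y \<in> carrier G" "x \<in> carrier G" "g \<in> carrier G"
  shows "br y (br x (br x (w x g))) [^] s = br y (br y (br y (w x g))) [^] s"
proof -
  have "commutator T (br x (w x g)) (w x g) \<in> F 3"
    using commutator_F[of "br x (w x g)" 1 "w x g" 0] by (simp add: w_br_F eval_nat_numeral)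
  then have "br y (commutator T (br x (w x g)) (w x g)) [^] (2 * s) = \<one>"
    by (simp add: F4_pow_2s w_br_F)
  then show ?thesis
    using relation_br'[of y x g "w x g"] by simp
qed

lemma weight5_vanish:
  assumes [simp]: "y \<in> carrier G" "x \<in> carrier G" "g \<in> carrier G"
  shows "br y (br x (br x (w x g))) [^] s = \<one>"
  by (rule lchar_square_vanish[OF lchar2_br_s _ odd_q weight5_relation])
    (simp_all add: pow_s_q w_br_F)

lemma weight5_cube: "y \<in> carrier G \<Longrightarrow> t \<in> F 0 \<Longrightarrow> br y (br y (br y t)) [^] s = \<one>"
  using lchar_generate0[OF lchar2_br_br[OF lchar2_br_s[of y]], of y y t]
    weight5_vanish weight5_relation by simp

text \<open>For a generator \<open>br x a\<close>, \<open>relation1\<close> leaves a triple bracket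
  with \<open>x\<close> on \<open>a\<close>, killed by \<open>weight5_cube\<close>. Products are
  handled by \<open>F1_pow_mult\<close>.\<close>

lemma F1_pow_q: "t \<in> F 1 \<Longrightarrow> t [^] q = \<one>"
proof -
  assume "t \<in> F 1"
  then have "t \<in> F (Suc 0)" by simp
  then show ?thesis
  proof (induction rule: F_Suc_induct)
    case (br x a)
    have g: "d a \<in> L 1" using d_F[OF br(2)] by simp
    have "br x (br x a) [^] (q choose 2) = \<one>"
      using br dvd_choose_2[OF odd_q] by (simp add: F2_pow w_br_F)
    then show ?case
      using relation1[OF br(1) g HOL.refl] weight5_cube[OF br] br g by (simp add: br_def)
  next
    case (inv x a)
    have g: "d a \<in> L 1" using d_F[OF inv(2)] by simp
    have "br x (br x a) [^] (q choose 2) = \<one>"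
      using inv dvd_choose_2[OF odd_q] by (simp add: F2_pow w_br_F)
    then have "br x a [^] q = \<one>"
      using relation1[OF inv(1) g HOL.refl] weight5_cube[OF inv] inv g by (simp add: br_def)
    then show ?case using inv by (simp add: T.nat_pow_inv)
  next
    case (mult t u)
    then show ?case using F1_pow_mult[of t u] F_up(4)[of u] by simp
  qed simp
qed

text \<open>The argument of \<open>F1_pow_mult\<close> again, now with \<open>d (t^-1)\<close> only
  in \<open>L 1\<close>. The additional bracket and commutator lie in \<open>F 4\<close>, with
  exponents that are known to kill it. This reduces the whole claim to symbols.\<close>

lemma pow_q_mult:
  assumes [simp]: "t \<in> carrier T" "u \<in> carrier T"
  shows "(t \<otimes> u) [^] q = t [^] q \<otimes> u [^] q"
proof -
  define x b1 where "x = d (inv t)" and "b1 = br x u"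
  have u: "u \<in> F 0" "inv t \<in> F 0" by (simp_all add: F_0)
  have x: "x \<in> L 1" using d_F[OF u(2)] by (simp add: x_def)
  have b1: "b1 \<in> F 2" using br_F[OF x u(1)] by (simp add: b1_def eval_nat_numeral)
  have b2: "br x b1 \<in> F 4" using br_F[OF x b1] by (simp add: eval_nat_numeral)
  have "commutator T b1 u \<in> F 4" "commutator T (br x b1) u = \<one>"
    using commutator_F[OF b1 u(1)] F5[OF commutator_F[OF b2 u(1)]] by (simp_all add: eval_nat_numeral)
  moreover from this have "commutator T b1 u [^] (2 * (Suc q choose 3)) = \<one>"
    using dvd_choose_2[OF odd_q] unfolding choose_Suc_q
    by (simp add: F4_pow_2s F4_pow flip: T.nat_pow_mult)
  moreover have "b1 [^] (q choose 2) = \<one>" "br x b1 [^] s = \<one>"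
    using b1 b2 dvd_choose_2[OF odd_q] by (simp_all add: F2_pow F4_pow_s)
  ultimately have "norm x u q = u [^] q"
    using norm_eq'[of x u q] x b2 by (simp add: b1_def[symmetric] br_F4)
  then have "inv t [^] q \<otimes> (t \<otimes> u) [^] q = u [^] q"
    using norm_d[of u "inv t" q] by (simp add: x_def)
  then have "t [^] q \<otimes> (inv (t [^] q) \<otimes> (t \<otimes> u) [^] q) = t [^] q \<otimes> u [^] q"
    by (simp add: T.nat_pow_inv)
  then show ?thesis by simp
qed

lemma relation':
  assumes [simp]: "x \<in> carrier G" "g \<in> carrier G" and b: "b = w x g"
  shows "b [^] q \<otimes> (br x (br x b) [^] s \<otimes>
    (br x (br x (br x (br x b))) [^] v \<otimes> commutator T (br x b) b [^] (2 * s))) = \<one>"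
proof -
  have F: "b \<in> F 0" by (simp add: b w_br_F)
  then have "br x b [^] (q choose 2) = \<one>"
    using dvd_choose_2[OF odd_q] w_br_F(2)[OF assms(1)] by (intro T.pow_eq_one_dvd[OF F_carrier F1_pow_q])
  then show ?thesis
    using relation[of x g b] F by (simp add: b)
qed

lemma br4_shift:
  assumes x [simp]: "x \<in> carrier G" and g [simp]: "g \<in> carrier G" and z: "z \<in> L 1"
    and b: "b = w x g" and b': "b' = w (x \<otimes>\<^bsub>G\<^esub> z) g"
  shows "br (x \<otimes>\<^bsub>G\<^esub> z) (br (x \<otimes>\<^bsub>G\<^esub> z) (br (x \<otimes>\<^bsub>G\<^esub> z) (br (x \<otimes>\<^bsub>G\<^esub> z) b'))) = br x (br x (br x (br x b)))"
proof -
  have [simp]: "z \<in> carrier G" using z by simp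
  define y where "y = x \<otimes>\<^bsub>G\<^esub> z"
  have [simp]: "y \<in> carrier G" by (simp add: y_def)
  obtain a where a: "a \<in> F 1" "b' = a \<otimes> b" using w_shift[OF x g z] b b' by metis
  have F: "b \<in> F 0" "b' \<in> F 0" by (simp_all add: b b' w_br_F)
  have l3: "lchar 3 (\<lambda>t. br x t)" using lchar_br0[of x 3 "\<lambda>t. t"] hchar_id by simp
  have l2: "lchar 2 (\<lambda>t. br x (br x t))" using lchar_br0[of x 2 "\<lambda>t. br x t"] l3 by simp
  have l1: "lchar 1 (\<lambda>t. br x (br x (br x t)))" by (rule lchar2_br[OF l2 x])
  have l0: "lchar 0 (\<lambda>t. br x (br x (br x (br x t))))" by (rule lchar1_br[OF l1 x])
  have "br y (br y (br y (br y b'))) = br x (br y (br y (br y b')))"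
    using lchar_br_shift[of 3 "\<lambda>t. t" x z] hchar_id z F by (simp add: y_def[symmetric] w_br_F)
  also have "\<dots> = br x (br x (br y (br y b')))"
    using lchar_br_shift[of 2 "\<lambda>t. br x t" x z] l3 z F by (simp add: y_def[symmetric] w_br_F)
  also have "\<dots> = br x (br x (br x (br y b')))"
    using lchar_br_shift[of 1 "\<lambda>t. br x (br x t)" x z] l2 z F by (simp add: y_def[symmetric] w_br_F numeral_2_eq_2)
  also have "\<dots> = br x (br x (br x (br x b')))"
    using lchar_br_shift[of 0 "\<lambda>t. br x (br x (br x t))" x z] l1 z F by (simp add: y_def[symmetric] w_br_F)
  also have "\<dots> = br x (br x (br x (br x b)))"
    unfolding a(2) using a F F_up(4)[OF a(1)] hchar_mult[OF l0, of a b] hchar_kill[OF l0, of a] by simp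
  finally show ?thesis by (simp add: y_def)
qed

text \<open>Compare \<open>relation'\<close> for \<open>x\<close> and \<open>x z\<close>. The
  symbols differ by an element of \<open>F 1\<close>, so their \<open>q\<close>-th powers agree;
  fourth brackets and commutator terms agree by \<open>br4_shift\<close> and
  \<open>commutator_shift\<close>.\<close>

lemma weight5_cube_polarized:
  assumes x [simp]: "x \<in> carrier G" and g [simp]: "g \<in> carrier G" and z: "z \<in> L 1"
  shows "br g (br x (w x z)) [^] s = \<one>"
proof -
  have [simp]: "z \<in> carrier G" using z by simp
  have M: "hchar 2 4 (\<lambda>t. t [^] s)"
    using hchar_pow_hom[OF hchar_id'[of 2], of s] F4_pow_s by (simp add: hchar_def)
  show ?thesis
  proof (rule hchar_cube_polarize[OF M _ x z g])
    show "(t [^] s) [^] (3::nat) = \<one>" if "t \<in> F 3" for t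
      using that by (rule pow_s_3)
    let ?x = "x \<otimes>\<^bsub>G\<^esub> z"
    define b b' where b: "b = w x g" and b': "b' = w ?x g"
    have F: "b \<in> F 0" "b' \<in> F 0" by (simp_all add: b b' w_br_F)
    obtain a where a: "a \<in> F 1" "b' = a \<otimes> b" using w_shift[OF x g z] b b' by metis
    have "b' [^] q = b [^] q" using a F by (simp add: pow_q_mult F1_pow_q)
    moreover have "commutator T (br ?x b') b' [^] (2 * s) = commutator T (br x b) b [^] (2 * s)"
      by (rule commutator_shift[OF lchar3_pow_s(2) x g z b b'])
    moreover define Y where "Y = br x (br x (br x (br x b))) [^] v \<otimes> commutator T (br x b) b [^] (2 * s)"
    moreover have Y: "Y \<in> carrier T" using F by (simp add: Y_def)
    ultimately have "b [^] q \<otimes> (br ?x (br ?x b') [^] s \<otimes> Y) = b [^] q \<otimes> (br x (br x b) [^] s \<otimes> Y)"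
      using relation'[OF _ g b'] relation'[OF x g b] br4_shift[OF x g z b b'] by simp
    then show "br ?x (br ?x b') [^] s = br x (br x b) [^] s"
      using F Y by (simp add: T.right_cancel)
  qed
qed

text \<open>As for \<open>F4_pow_s\<close>, with a single outer entry \<open>y\<close>.\<close>

lemma F3_pow_s: "t \<in> F 3 \<Longrightarrow> t [^] s = \<one>"
proof -
  assume t: "t \<in> F 3"
  have F2: "br y t [^] s = \<one>" if [simp]: "y \<in> carrier G" and t: "t \<in> F 2" for y t
  proof (rule lchar_alternating_vanish[OF lchar2_br_s[OF that(1)] _ odd_q _ _ t])
    show q: "(br y t [^] s) [^] q = \<one>" if "t \<in> F 2" for t
      using that by (intro pow_s_q) (simp add: w_br_F)
    show "br y (br g (br g (w p r))) [^] s = \<one>"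
      if "g \<in> carrier G" "p \<in> carrier G" "r \<in> carrier G" for g p r
      using weight5_cube_polarized[of g y "commutator G p r"] that G.commutator_L_Suc(2)[of r 0 p]
      by (simp add: br_w)
    show "br y (br g (br x (w x p))) [^] s = \<one>"
      if "g \<in> carrier G" "x \<in> carrier G" "p \<in> carrier G" for g x p
    proof (rule lchar_cube_polarize[OF lchar2_br_s[OF \<open>y \<in> carrier G\<close>] q odd_q _ _ that(1,2,3)])
      show "(br y t [^] s) [^] (3::nat) = \<one>" if "t \<in> F 2" for t
        using that by (intro pow_s_3) (simp add: w_br_F)
    qed (simp_all add: weight5_vanish)
  qed
  then show ?thesis
    using lchar_generate[of 2 "\<lambda>t. t [^] s" t] lchar3_pow_s t by simp
qed

section \<open>Weight four: powers of symbols\<close>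

lemma lchar2_pow_s: "lchar 2 (\<lambda>t. t [^] s)"
  using hchar_pow_hom[OF hchar_id'[of 2], of s] F3_pow_s by (simp add: hchar_def)

text \<open>The commutator lies in \<open>F 3\<close>, which \<open>s\<close> now kills.\<close>

lemma relation'':
  assumes [simp]: "x \<in> carrier G" "g \<in> carrier G" and b: "b = w x g"
  shows "b [^] q \<otimes> (br x (br x b) [^] s \<otimes> br x (br x (br x (br x b))) [^] v) = \<one>"
proof -
  have F: "b \<in> F 0" by (simp add: b w_br_F)
  then have "commutator T (br x b) b \<in> F 3"
    using commutator_F[of "br x b" 1 b 0] by (simp add: w_br_F eval_nat_numeral)
  then have "commutator T (br x b) b [^] (2 * s) = \<one>"
    using F3_pow_s[of "commutator T (br x b) b"] T.nat_pow_pow[of "commutator T (br x b) b" s 2]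
    by (simp add: mult.commute)
  then show ?thesis
    using relation'[of x g b] F by (simp add: b)
qed

text \<open>The value at \<open>i\<close> of the polynomial with coefficients \<open>c\<close>, written multiplicatively.\<close>

primrec polyprod :: "(nat \<Rightarrow> 'a) \<Rightarrow> nat \<Rightarrow> nat \<Rightarrow> 'a" where
  "polyprod c i 0 = c 0"
| "polyprod c i (Suc n) = c (Suc n) [^] (i ^ Suc n) \<otimes> polyprod c i n"

lemma polyprod_F2: "(\<And>k. c k \<in> F 2) \<Longrightarrow> polyprod c i n \<in> F 2"
  by (induction n) (simp_all add: F_mult F_pow)

lemma polyprod_cong: "(\<And>k. k \<le> n \<Longrightarrow> c k = c' k) \<Longrightarrow> polyprod c i n = polyprod c' i n"
  by (induction n) simp_all

text \<open>In additive notation, \<open>c\<close> has the coefficients of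
  \<open>a(X) + X b(X)\<close>.\<close>

lemma polyprod_shift:
  assumes a: "\<And>k. a k \<in> F 2" and b: "\<And>k. b k \<in> F 2"
    and c: "c 0 = a 0" "\<And>k. c (Suc k) = a (Suc k) \<otimes> b k"
  shows "polyprod c i (Suc n) = polyprod a i (Suc n) \<otimes> polyprod b i n [^] i"
proof -
  have swap: "(p \<otimes> r) \<otimes> (p' \<otimes> r') = (p \<otimes> p') \<otimes> (r \<otimes> r')"
    if "p \<in> F 2" "r \<in> F 2" "p' \<in> F 2" "r' \<in> F 2" for p r p' r'
  proof -
    have "(p \<otimes> r) \<otimes> (p' \<otimes> r') = p \<otimes> (r \<otimes> p') \<otimes> r'" using that by (simp add: T.m_assoc)
    also have "r \<otimes> p' = p' \<otimes> r" using that by (intro F2_comm)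
    finally show ?thesis using that by (simp add: T.m_assoc)
  qed
  show ?thesis
  proof (induction n)
    case 0
    have "(a 1 [^] i \<otimes> b 0 [^] i) \<otimes> (a 0 \<otimes> \<one>) = (a 1 [^] i \<otimes> a 0) \<otimes> (b 0 [^] i \<otimes> \<one>)"
      using a b by (intro swap) (simp_all add: F_pow)
    then show ?case using a b c F_carrier[OF a] F_carrier[OF b] by (simp add: F2_pow_mult)
  next
    case (Suc n)
    let ?e = "i ^ Suc n"
    have "polyprod c i (Suc (Suc n)) =
      (a (Suc (Suc n)) [^] (i * ?e) \<otimes> b (Suc n) [^] (i * ?e)) \<otimes> (polyprod a i (Suc n) \<otimes> polyprod b i n [^] i)"
      using Suc a b c(2)[of "Suc n"] by (simp add: F2_pow_mult)
    also have "\<dots> = (a (Suc (Suc n)) [^] (i * ?e) \<otimes> polyprod a i (Suc n)) \<otimes>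
        (b (Suc n) [^] (i * ?e) \<otimes> polyprod b i n [^] i)"
      using a b by (intro swap F_pow polyprod_F2)
    also have "b (Suc n) [^] (i * ?e) \<otimes> polyprod b i n [^] i = polyprod b i (Suc n) [^] i"
      using b F_carrier[OF b] by (simp add: F2_pow_mult F_pow polyprod_F2 T.nat_pow_pow mult.commute)
    finally show ?case by simp
  qed
qed

lemma lchar_br_pow_left:
  assumes N: "lchar (Suc j) N" and g [simp]: "g \<in> carrier G" and t: "t \<in> F j"
  shows "N (br (g [^]\<^bsub>G\<^esub> (i::nat)) t) = N (br g t) [^] i"
proof (induction i)
  case 0
  then show ?case using hchar_one[OF N] t by (simp add: br_def)
next
  case (Suc i)
  then show ?case using lchar_br_left[OF N, of "g [^]\<^bsub>G\<^esub> i" 0 g t j] t by simp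
qed

lemma br_funpow_F:
  "y \<in> carrier G \<Longrightarrow> b \<in> F 0 \<Longrightarrow> (br y ^^ n) b \<in> F n"
  by (induction n) (simp_all add: br_F0)

text \<open>Each bracket with \<open>x g^i\<close> splits into one with \<open>x\<close> and the
  \<open>i\<close>-th power of one with \<open>g\<close>, so an \<open>n\<close>-fold bracket is a
  polynomial in \<open>i\<close> of degree \<open>n\<close>; its leading coefficient has
  \<open>g\<close> in every one of these entries.\<close>

lemma lchar_br_funpow_poly:
  assumes x [simp]: "x \<in> carrier G" and g [simp]: "g \<in> carrier G" and b: "b \<in> F 0"
  shows "lchar n N \<Longrightarrow> \<exists>c. (\<forall>k. c k \<in> F 2) \<and> c n = N ((br g ^^ n) b) \<and>
    (\<forall>i. N ((br (x \<otimes>\<^bsub>G\<^esub> g [^]\<^bsub>G\<^esub> (i::nat)) ^^ n) b) = polyprod c i n)"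
proof (induction n arbitrary: N)
  case 0
  then show ?case using hchar_F2[OF 0 b] by (intro exI[of _ "\<lambda>_. N b"]) simp
next
  case (Suc n)
  obtain a where a: "\<And>k. a k \<in> F 2"
    "\<And>i. N (br x ((br (x \<otimes>\<^bsub>G\<^esub> g [^]\<^bsub>G\<^esub> (i::nat)) ^^ n) b)) = polyprod a i n"
    using Suc.IH[OF lchar_br0[OF x Suc.prems]] by blast
  obtain a' where a': "\<And>k. a' k \<in> F 2" "a' n = N (br g ((br g ^^ n) b))"
    "\<And>i. N (br g ((br (x \<otimes>\<^bsub>G\<^esub> g [^]\<^bsub>G\<^esub> (i::nat)) ^^ n) b)) = polyprod a' i n"
    using Suc.IH[OF lchar_br0[OF g Suc.prems]] by blast
  \<comment> \<open>Truncated at degree \<open>n\<close>, so that coefficient \<open>Suc n\<close>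
    of \<open>c\<close> comes from \<open>a'\<close> alone.\<close>
  define a0 where "a0 k = (if k \<le> n then a k else \<one>)" for k
  define c where "c k = (case k of 0 \<Rightarrow> a0 0 | Suc j \<Rightarrow> a0 (Suc j) \<otimes> a' j)" for k
  have a0: "a0 k \<in> F 2" for k using a(1) by (simp add: a0_def)
  have c: "c k \<in> F 2" for k
    using a0 a'(1) by (simp add: c_def F_mult split: nat.split)
  have "N ((br (x \<otimes>\<^bsub>G\<^esub> g [^]\<^bsub>G\<^esub> i) ^^ Suc n) b) = polyprod c i (Suc n)" for i :: nat
  proof -
    let ?y = "x \<otimes>\<^bsub>G\<^esub> g [^]\<^bsub>G\<^esub> i"
    let ?t = "(br ?y ^^ n) b"
    have t: "?t \<in> F n" using b by (intro br_funpow_F) simp_all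
    have "N (br ?y ?t) = N (br x ?t) \<otimes> N (br g ?t) [^] i"
      using lchar_br_left[OF Suc.prems, of x 0 "g [^]\<^bsub>G\<^esub> i" ?t n] t
      by (simp add: lchar_br_pow_left[OF Suc.prems])
    also have "\<dots> = polyprod a i n \<otimes> polyprod a' i n [^] i" using a(2) a'(3) by simp
    also have "polyprod a i n = polyprod a0 i (Suc n)"
      using polyprod_cong[of n a0 a i] polyprod_F2[of a i n] a(1) by (simp add: a0_def)
    also have "polyprod a0 i (Suc n) \<otimes> polyprod a' i n [^] i = polyprod c i (Suc n)"
      by (rule polyprod_shift[symmetric, OF a0 a'(1)]) (simp_all add: c_def)
    finally show ?thesis by simp
  qed
  moreover have "c (Suc n) = N ((br g ^^ Suc n) b)"
    using a'(1)[of n] a'(2) by (simp add: c_def a0_def)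
  ultimately show ?case using c by blast
qed

text \<open>The fourth difference of a polynomial of degree four is \<open>24\<close> times its leading coefficient.\<close>

lemma polyprod_constant:
  assumes c: "\<And>k. c k \<in> F 2" and const: "\<And>i. polyprod c i 4 = K"
  shows "c 4 [^] (24::nat) = \<one>"
proof -
  have K: "K = c 0" using const[of 0] c[of 0] by (simp add: eval_nat_numeral)
  have C: "c k \<in> carrier T" for k using c F_carrier by blast
  \<comment> \<open>The polynomial without its constant term.\<close>
  define U where "U i = c 4 [^] (i ^ 4) \<otimes> (c 3 [^] (i ^ 3) \<otimes> (c 2 [^] (i ^ 2) \<otimes> c 1 [^] i))" for i :: nat
  have U: "U i = \<one>" for i
  proof -
    have "U i \<otimes> c 0 = c 0"
      using const[of i] C K by (simp add: U_def eval_nat_numeral T.m_assoc)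
    then show ?thesis using C by (simp add: U_def)
  qed
  have Upow: "U i [^] m = c 4 [^] (i ^ 4 * m) \<otimes> (c 3 [^] (i ^ 3 * m) \<otimes> (c 2 [^] (i ^ 2 * m) \<otimes> c 1 [^] (i * m)))"
    for i m :: nat
    using c C by (simp add: U_def F2_pow_mult F_mult F_pow T.nat_pow_pow)
  note sw = T.pow_swap[OF F2_comm[OF c[of 1] c[of 2]]] T.pow_swap[OF F2_comm[OF c[of 1] c[of 3]]]
    T.pow_swap[OF F2_comm[OF c[of 1] c[of 4]]] T.pow_swap[OF F2_comm[OF c[of 2] c[of 3]]]
    T.pow_swap[OF F2_comm[OF c[of 2] c[of 4]]] T.pow_swap[OF F2_comm[OF c[of 3] c[of 4]]] T.pow_merge
  define V where "V = c 3 [^] (112::nat) \<otimes> (c 2 [^] (40::nat) \<otimes> c 1 [^] (16::nat))"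
  have V: "V \<in> carrier T" using C by (simp add: V_def)
  \<comment> \<open>The fourth difference \<open>U 4 - 4 U 3 + 6 U 2 - 4 U 1\<close>, negative terms
    moved to the other side. The coefficients of degree one to three agree on both sides and form
    \<open>V\<close>; in degree four, \<open>352 - 328 = 24\<close>.\<close>
  have "U 4 [^] (1::nat) \<otimes> U 2 [^] (6::nat) = c 4 [^] (352::nat) \<otimes> V"
    unfolding Upow V_def
    by (simp only: T.m_assoc sw C T.nat_pow_closed T.m_closed) simp
  then have 1: "c 4 [^] (352::nat) \<otimes> V = \<one>" by (simp add: U)
  have "U 3 [^] (4::nat) \<otimes> U 1 [^] (4::nat) = c 4 [^] (328::nat) \<otimes> V"
    unfolding Upow V_def
    by (simp only: T.m_assoc sw C T.nat_pow_closed T.m_closed) simp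
  then have "c 4 [^] (328 + 24 :: nat) \<otimes> V = c 4 [^] (328::nat) \<otimes> V"
    using 1 by (simp add: U)
  then have "c 4 [^] (328::nat) \<otimes> c 4 [^] (24::nat) = c 4 [^] (328::nat)"
    using V C by (simp only: T.right_cancel T.nat_pow_closed T.nat_pow_mult)
  then show ?thesis using C by simp
qed

text \<open>If 5 does not divide \<open>q\<close>, then \<open>q\<close> divides \<open>v\<close>
  and only the triple bracket remains, which \<open>lchar_square_vanish\<close> kills. Otherwise 3
  does not divide \<open>q\<close>, so \<open>q\<close> divides \<open>s\<close> and the quartic
  term remains. It is constant along \<open>x g^i\<close>, as \<open>w (x g^i) g = w x g\<close>,
  and its leading coefficient is killed by 24 and by \<open>q\<close>.\<close>

lemma w_pow_q:
  assumes "\<not> 15 dvd q" and g [simp]: "g \<in> carrier G" and x [simp]: "x \<in> carrier G"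
  shows "w g x [^] q = \<one>"
proof (cases "5 dvd q")
  case False
  then have "coprime 5 q" by (intro prime_imp_coprime) simp_all
  then have v: "q dvd v"
    using dvd_5_choose_5[of q] by (simp add: coprime_commute coprime_dvd_mult_right_iff)
  have "b [^] q \<otimes> br y (br y b) [^] s = \<one>"
    if [simp]: "y \<in> carrier G" "h \<in> carrier G" and b: "b = w y h" for y h b
    using relation''[OF that] v by (simp add: b F4_pow w_br_F)
  note rel = this[OF _ _ HOL.refl]
  have "br y (br y (w y h)) [^] s = inv (w y h [^] q)"
    if [simp]: "y \<in> carrier G" "h \<in> carrier G" for y h
    using rel[OF that] by (intro T.inv_equality[symmetric]) (metis T.inv_comm T.nat_pow_closed br_closed w_closed that, simp_all)
  \<comment> \<open>The relation writes the bracket as \<open>inv (b [^] q)\<close>, a function of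
    the symbol \<open>b\<close> alone.\<close>
  then have "br g (br g (w g x)) [^] s = \<one>"
    by (intro lchar_square_vanish[OF lchar2_pow_s _ odd_q, of "\<lambda>b. inv (b [^] q)"])
      (simp_all add: F2_pow T.nat_pow_pow)
  then show ?thesis using rel[OF g x] by simp
next
  case True
  then have "\<not> 3 dvd q" using assms(1) by presburger
  then have c3: "coprime 3 q" by (intro prime_imp_coprime) simp_all
  then have "q dvd s"
    using dvd_3_choose_3[of q] by (simp add: coprime_commute coprime_dvd_mult_right_iff)
  then have rel: "w y h [^] q \<otimes> br y (br y (br y (br y (w y h)))) [^] v = \<one>"
    if [simp]: "y \<in> carrier G" "h \<in> carrier G" for y h
    using relation''[OF that HOL.refl] by (simp add: F2_pow w_br_F)
  define b where "b = w x g"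
  have b: "b \<in> F 0" and [simp]: "b \<in> carrier T" by (simp_all add: b_def w_br_F)
  have sh: "w (x \<otimes>\<^bsub>G\<^esub> g [^]\<^bsub>G\<^esub> i) g = b" for i :: nat
  proof (induction i)
    case (Suc i)
    have "w (x \<otimes>\<^bsub>G\<^esub> g [^]\<^bsub>G\<^esub> Suc i) g = w (x \<otimes>\<^bsub>G\<^esub> g [^]\<^bsub>G\<^esub> i \<otimes>\<^bsub>G\<^esub> g) g"
      by (simp add: G.m_assoc)
    then show ?case using Suc by (simp add: w_mult_left[of _ g])
  qed (simp add: b_def)
  obtain c where c: "\<And>k. c k \<in> F 2" "c 4 = (br g ^^ 4) b [^] v"
    "\<And>i. (br (x \<otimes>\<^bsub>G\<^esub> g [^]\<^bsub>G\<^esub> (i::nat)) ^^ 4) b [^] v = polyprod c i 4"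
    using lchar_br_funpow_poly[OF x g b lchar4_s[of v]] by blast
  have "polyprod c i 4 = inv (b [^] q)" for i
  proof -
    have "b [^] q \<otimes> polyprod c i 4 = \<one>"
      using rel[of "x \<otimes>\<^bsub>G\<^esub> g [^]\<^bsub>G\<^esub> i" g] unfolding c(3)[symmetric] sh by (simp add: eval_nat_numeral)
    moreover have "polyprod c i 4 \<in> carrier T" using polyprod_F2[of c, OF c(1)] by (rule F_carrier)
    ultimately show ?thesis using b by (metis T.inv_comm T.inv_equality F_carrier T.nat_pow_closed)
  qed
  then have "c 4 [^] (24::nat) = \<one>" by (intro polyprod_constant c(1))
  moreover have "c 4 [^] q = \<one>" using c(1) by (rule F2_pow_q)
  ultimately have "T.ord (c 4) dvd 24" "T.ord (c 4) dvd q"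
    using c(1)[of 4] by (simp_all add: T.pow_eq_id)
  \<comment> \<open>Only the primes 2 and 3 matter: \<open>q\<close> is odd, and not a multiple of 3
    in this case.\<close>
  moreover have "coprime 24 q"
  proof -
    have "coprime ((2 * 2) * (2 * 3)) q"
      using c3 odd_q by (simp only: coprime_mult_left_iff coprime_left_2_iff_odd simp_thms)
    then show ?thesis by simp
  qed
  ultimately have "T.ord (c 4) = 1"
    by (metis coprime_common_divisor_nat)
  then have "c 4 = \<one>"
    using T.pow_eq_id[of "c 4" 1] c(1)[of 4] by simp
  then have 1: "br g (br g (br g (br g b))) [^] v = \<one>"
    using c(2) by (simp add: eval_nat_numeral)
  have "w g x = inv b" using w_swap[of x g] by (simp add: b_def)
  then have "br g (br g (br g (br g (w g x)))) [^] v = \<one>"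
    using 1 hchar_inv[OF lchar2_br_br[OF lchar2_s[of g g v]], of g g b] b by simp
  then show ?thesis using rel[of g x] by simp
qed

lemma T_pow_q:
  assumes "\<not> 15 dvd q" and "t \<in> carrier T"
  shows "t [^] q = \<one>"
  using assms(2)
  by (induction rule: T_induct) (simp_all add: w_pow_q assms(1) T.nat_pow_inv pow_q_mult)

end

section \<open>The exterior square\<close>

lemma (in group) pow_group_exponent:
  assumes "x \<in> carrier G"
  shows "x [^] group_exponent G = \<one>"
proof (cases "\<exists>n>0. \<forall>x\<in>carrier G. x [^] (n::nat) = \<one>")
  case True
  then have "\<forall>x\<in>carrier G. x [^] (LEAST n. n > 0 \<and> (\<forall>x\<in>carrier G. x [^] (n::nat) = \<one>)) = \<one>"
    by (rule LeastI2_ex) simp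
  then show ?thesis using True assms by (simp add: group_exponent_def)
qed (simp only: group_exponent_def if_False nat_pow_0)

lemma (in group) group_exponent_dvd:
  assumes "\<And>x. x \<in> carrier G \<Longrightarrow> x [^] (n::nat) = \<one>"
  shows "group_exponent G dvd n"
proof (cases "n = 0")
  case False
  let ?P = "\<lambda>n. n > 0 \<and> (\<forall>x\<in>carrier G. x [^] (n::nat) = \<one>)"
  have ex: "?P n" using assms False by blast
  then have e: "group_exponent G = (LEAST n. ?P n)"
    unfolding group_exponent_def by (intro if_P) blast
  let ?e = "group_exponent G"
  have "?P ?e" unfolding e by (rule LeastI[of ?P, OF ex])
  have "x [^] (n mod ?e) = \<one>" if x: "x \<in> carrier G" for x
  proof -
    have "x [^] n = (x [^] ?e) [^] (n div ?e) \<otimes> x [^] (n mod ?e)"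
      using x by (simp add: nat_pow_pow nat_pow_mult)
    then show ?thesis using x assms by (simp add: pow_group_exponent)
  qed
  moreover have "n mod ?e < ?e" using \<open>?P ?e\<close> by simp
  then have "\<not> ?P (n mod ?e)" unfolding e by (rule not_less_Least)
  ultimately show ?thesis by auto
qed simp

section \<open>The universal property of a presentation\<close>

definition word_value :: "('a, 'b) monoid_scheme \<Rightarrow> ('x \<Rightarrow> 'a) \<Rightarrow> 'x word \<Rightarrow> 'a" where
  "word_value H f u = foldr (\<lambda>(b, x) a. (if b then f x else inv\<^bsub>H\<^esub> (f x)) \<otimes>\<^bsub>H\<^esub> a) u \<one>\<^bsub>H\<^esub>"

context group
begin

lemma word_value_simps [simp]:
  "word_value G f [] = \<one>"
  "word_value G f ((b, x) # u) = (if b then f x else inv (f x)) \<otimes> word_value G f u"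
  by (simp_all add: word_value_def)

lemma word_value_closed:
  assumes "f \<in> X \<rightarrow> carrier G" "u \<in> words X"
  shows "word_value G f u \<in> carrier G"
  using assms(2) unfolding words_def
  by (induction u) (use assms(1) in \<open>auto simp: Pi_def\<close>)

lemma word_value_append:
  assumes f: "f \<in> X \<rightarrow> carrier G" and "u \<in> words X" and v: "v \<in> words X"
  shows "word_value G f (u @ v) = word_value G f u \<otimes> word_value G f v"
  using assms(2)
proof (induction u)
  case Nil
  then show ?case using word_value_closed[OF f v] by simp
next
  case (Cons a u)
  obtain b x where a: "a = (b, x)" by (cases a)
  then have "x \<in> X" "u \<in> words X" using Cons.prems by (auto simp: words_def)
  then show ?case
    using Cons.IH word_value_closed[OF f, of u] word_value_closed[OF f v] f
    by (auto simp: a Pi_def m_assoc)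
qed

lemma word_value_eq:
  assumes f: "f \<in> X \<rightarrow> carrier G"
    and R: "\<And>u v. (u, v) \<in> R \<Longrightarrow> u \<in> words X \<Longrightarrow> v \<in> words X \<Longrightarrow> word_value G f u = word_value G f v"
    and "word_eq X R u v"
  shows "word_value G f u = word_value G f v"
  using assms(3)
proof (induction rule: word_eq.induct)
  case (append u u' v v')
  then show ?case
    using word_eq_words[of X R] by (metis word_value_append[OF f])
next
  case (cancel x b)
  then show ?case using f by (auto simp: Pi_def)
qed (use R in auto)

lemma presented_group_universal:
  assumes f: "f \<in> X \<rightarrow> carrier G"
    and R: "\<And>u v. (u, v) \<in> R \<Longrightarrow> u \<in> words X \<Longrightarrow> v \<in> words X \<Longrightarrow> word_value G f u = word_value G f v"
  obtains h where "h \<in> hom (presented_group X R) G"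
    and "\<And>x. x \<in> X \<Longrightarrow> h (word_class X R [(True, x)]) = f x"
proof
  define h where "h A = the_elem (word_value G f ` A)" for A
  have h: "h (word_class X R u) = word_value G f u" if u: "u \<in> words X" for u
  proof -
    \<comment> \<open>Evaluation is constant on classes, so its image is a singleton and
      \<open>the_elem\<close> is meaningful.\<close>
    have "word_value G f ` word_class X R u = {word_value G f u}"
      using word_value_eq[OF f R] word_eq.refl[OF u] by (fastforce simp: word_class_def)
    then show ?thesis by (simp add: h_def)
  qed
  show "h \<in> hom (presented_group X R) G"
  proof (rule homI)
    fix A B assume "A \<in> carrier (presented_group X R)" "B \<in> carrier (presented_group X R)"
    then obtain u v where uv: "u \<in> words X" "v \<in> words X" "A = word_class X R u" "B = word_class X R v"
      by (auto simp: presented_group_def)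
    then have "u @ v \<in> words X" by (simp add: words_def)
    then show "h (A \<otimes>\<^bsub>presented_group X R\<^esub> B) = h A \<otimes> h B"
      using uv by (simp add: presented_group_mult h word_value_append[OF f])
  next
    fix A assume "A \<in> carrier (presented_group X R)"
    then show "h A \<in> carrier G"
      using word_value_closed[OF f] by (auto simp: presented_group_def h)
  qed
  show "h (word_class X R [(True, x)]) = f x" if "x \<in> X" for x
    using that funcset_mem[OF f that] by (subst h) (auto simp: words_def)
qed

end

lemma presented_group_generate:
  "carrier (presented_group X R) = generate (presented_group X R) {word_class X R [(True, x)] | x. x \<in> X}"
  (is "_ = generate ?P ?S")
proof
  interpret group ?P by (rule group_presented_group)
  have S: "?S \<subseteq> carrier ?P" by (auto simp: presented_group_def words_def)
  then show "generate ?P ?S \<subseteq> carrier ?P" by (rule generate_incl)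
  have "word_class X R u \<in> generate ?P ?S" if "u \<in> words X" for u
    using that
  proof (induction u)
    case Nil
    show ?case using generate.one[of ?P ?S] by (simp add: presented_group_def)
  next
    case (Cons a u)
    obtain b x where a: "a = (b, x)" by (cases a)
    then have x: "x \<in> X" "u \<in> words X" using Cons.prems by (auto simp: words_def)
    then have w: "[(c, x)] \<in> words X" for c by (simp add: words_def)
    have "word_class X R [(False, x)] \<otimes>\<^bsub>?P\<^esub> word_class X R [(True, x)] = \<one>\<^bsub>?P\<^esub>"
      using w word_eq.cancel[OF x(1), of R False]
      by (simp add: presented_group_mult) (simp add: presented_group_def word_class_eqI)
    then have "inv\<^bsub>?P\<^esub> (word_class X R [(True, x)]) = word_class X R [(False, x)]"
      using w by (intro inv_equality) (auto simp: presented_group_def)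
    moreover have "word_class X R [(True, x)] \<in> ?S" using x by blast
    ultimately have "word_class X R [(b, x)] \<in> generate ?P ?S"
      using generate.incl[of "word_class X R [(True, x)]" ?S ?P]
        generate.inv[of "word_class X R [(True, x)]" ?S ?P] by (cases b) simp_all
    then have "word_class X R [(b, x)] \<otimes>\<^bsub>?P\<^esub> word_class X R u \<in> generate ?P ?S"
      using Cons.IH x(2) by (intro generate.eng)
    then show ?case using presented_group_mult[OF w x(2)] a by simp
  qed
  then show "carrier ?P \<subseteq> generate ?P ?S" by (auto simp: presented_group_def)
qed

text \<open>The map \<open>d\<close> exists by the universal property, because commutators in
  \<open>G\<close> satisfy the tensor relations.\<close>

lemma tensor_square_pairing:
  assumes "group G"
  obtains d where "tensor_pairing (tensor_square G) G (tensor_symbol G) d"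
proof -
  interpret group G by fact
  let ?X = "tensor_generators G" and ?R = "tensor_relations G"
  define f where "f = (\<lambda>(g, h). commutator G g h)"
  have f: "f \<in> ?X \<rightarrow> carrier G" by (auto simp: f_def tensor_generators_def)
  have "word_value G f u = word_value G f v" if "(u, v) \<in> ?R" for u v
    using that unfolding tensor_relations_def f_def
    by (auto simp: commutator_def conjugate_def m_assoc inv_mult_group)
  then obtain d where d: "d \<in> hom (presented_group ?X ?R) G"
    "\<And>x. x \<in> ?X \<Longrightarrow> d (word_class ?X ?R [(True, x)]) = f x"
    using presented_group_universal[OF f] by metis
  have "tensor_pairing (tensor_square G) G (tensor_symbol G) d"
  proof (rule tensor_pairing.intro[OF group_tensor_square assms], unfold_locales)
    show "carrier (tensor_square G) = generate (tensor_square G)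
      {tensor_symbol G g h |g h. g \<in> carrier G \<and> h \<in> carrier G}"
      unfolding tensor_square_def by (subst presented_group_generate)
        (auto intro!: arg_cong[of _ _ "generate (presented_group ?X ?R)"]
          simp: tensor_symbol_def tensor_generators_def)
    show "d \<in> hom (tensor_square G) G" using d(1) by (simp add: tensor_square_def)
    show "d (tensor_symbol G g h) = commutator G g h" if "g \<in> carrier G" "h \<in> carrier G" for g h
      using d(2)[of "(g, h)"] that by (simp add: tensor_symbol_def tensor_generators_def f_def)
  qed (simp_all add: tensor_symbol_closed tensor_symbol_mult_left[OF assms] tensor_symbol_mult_right[OF assms])
  then show ?thesis by (rule that)
qed

text \<open>By \<open>conj_w\<close> a conjugate of \<open>w x x\<close> is again such a symbol, so
  \<open>N\<close> is normal; since \<open>[x, x] = 1\<close>, the map \<open>d\<close> descends to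
  the quotient.\<close>

lemma (in tensor_pairing) exterior_pairing_Mod:
  defines "N \<equiv> generate T {w x x | x. x \<in> carrier G}"
  shows "\<exists>d'. exterior_pairing (T Mod N) G (\<lambda>g h. N #> w g h) d'"
proof -
  have S: "{w x x | x. x \<in> carrier G} \<subseteq> carrier T" by auto
  have sub: "subgroup N T" unfolding N_def by (rule T.generate_is_subgroup[OF S])
  have "conjugate T t n \<in> N" if "t \<in> carrier T" "n \<in> N" for t n
    unfolding N_def
  proof (rule T.generate_conjugate_closed[OF S that(1)])
    show "n \<in> generate T {w x x | x. x \<in> carrier G}" using that(2) by (simp add: N_def)
    fix a assume "a \<in> {w x x | x. x \<in> carrier G}"
    then obtain x where x: "x \<in> carrier G" "a = w x x" by auto
    then have "conjugate T t a = w (cj (d t) x) (cj (d t) x)"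
      using that(1) conj_w[of t x x] by (simp add: conjugate_def T.m_assoc)
    then show "conjugate T t a \<in> {w x x | x. x \<in> carrier G}" using that(1) x by auto
  qed
  then have N: "N \<lhd> T" using sub by (simp add: T.normal_inv_iff conjugate_def)
  then interpret N: normal N T .
  interpret Q: group "T Mod N" by (rule N.factorgroup_is_group)
  have d1: "d n = \<one>\<^bsub>G\<^esub>" if "n \<in> N" for n
    using that unfolding N_def
  proof (induction rule: generate.induct)
    case (eng a b)
    then show ?case using S T.generate_incl[OF S] by (auto simp: subset_iff)
  qed (auto simp: d_w commutator_def G.m_assoc)
  have dd: "d x = d y" if "x \<in> carrier T" "y \<in> carrier T" "N #> x = N #> y" for x y
  proof -
    have "x \<in> N #> y" using T.rcos_self[OF that(1) sub] that(3) by simp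
    then obtain n where "n \<in> N" "x = n \<otimes> y" by (auto simp: r_coset_def)
    then show ?thesis using that d1 sub by (simp add: subgroup.mem_carrier)
  qed
  obtain d' where d': "d' \<in> hom (T Mod N) G" "\<And>x. x \<in> carrier T \<Longrightarrow> d' (N #> x) = d x"
    by (rule FactGroup_universal[OF d_hom N]) (erule (2) dd, rule that)
  have cl: "N #> t \<in> carrier (T Mod N)" if "t \<in> carrier T" for t
    using that by (auto simp: carrier_FactGroup)
  interpret c: group_hom T "T Mod N" "\<lambda>t. N #> t"
    by unfold_locales (rule N.r_coset_hom_Mod)
  have "exterior_pairing (T Mod N) G (\<lambda>g h. N #> w g h) d'"
  proof unfold_locales
    show "d' \<in> hom (T Mod N) G" by (rule d')
    show "N #> w (g \<otimes>\<^bsub>G\<^esub> g') h = (N #> w (cj g g') (cj g h)) \<otimes>\<^bsub>T Mod N\<^esub> (N #> w g h)"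
      if "g \<in> carrier G" "g' \<in> carrier G" "h \<in> carrier G" for g g' h
      using that by (simp add: w_left)
    show "N #> w g (h \<otimes>\<^bsub>G\<^esub> h') = (N #> w g h) \<otimes>\<^bsub>T Mod N\<^esub> (N #> w (cj h g) (cj h h'))"
      if "g \<in> carrier G" "h \<in> carrier G" "h' \<in> carrier G" for g h h'
      using that by (simp add: w_right)
    show "N #> w g g = \<one>\<^bsub>T Mod N\<^esub>" if "g \<in> carrier G" for g
    proof -
      have "w g g \<in> N" unfolding N_def using that by (auto intro: generate.incl)
      then show ?thesis using that sub by (simp add: T.coset_join2)
    qed
    let ?S = "{N #> w g h |g h. g \<in> carrier G \<and> h \<in> carrier G}"
    have SQ: "?S \<subseteq> carrier (T Mod N)" using cl by auto
    have "N #> t \<in> generate (T Mod N) ?S" if "t \<in> carrier T" for t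
      using that
    proof (induction rule: T_induct)
      case one
      then show ?case using generate.one[of "T Mod N" ?S] by (metis c.hom_one)
    next
      case (w g h)
      then show ?case by (auto intro: generate.incl)
    next
      case (inv g h)
      then have "inv\<^bsub>T Mod N\<^esub> (N #> w g h) \<in> generate (T Mod N) ?S"
        by (auto intro: generate.inv)
      then show ?case using inv c.hom_inv[of "w g h"] by simp
    next
      case (mult t u)
      then show ?case using generate.eng[OF mult.IH] by simp
    qed
    then show "carrier (T Mod N) = generate (T Mod N) ?S"
      using Q.generate_incl[OF SQ] by (auto simp: carrier_FactGroup)
  qed (simp_all add: cl d' d_w)
  then show ?thesis by (intro exI[of _ d'])
qed

lemma exterior_square_pairing:
  assumes "group G"
  obtains w d where "exterior_pairing (exterior_square G) G w d"
proof -
  obtain d where d: "tensor_pairing (tensor_square G) G (tensor_symbol G) d"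
    using tensor_square_pairing[OF assms] .
  show ?thesis
    using tensor_pairing.exterior_pairing_Mod[OF d] that
    unfolding exterior_square_def nabla_def by blast
qed

section \<open>Central extensions and the Schur multiplier\<close>

text \<open>The kernel of \<open>p\<close> is central, so a commutator depends only on the images of
  its entries in \<open>G\<close>. Hence the section \<open>s\<close> need not be multiplicative: up
  to central factors it is, and the pairing relations become commutator identities. For the same
  reason these values are all commutators of \<open>E\<close>.\<close>

lemma central_extension_pairing:
  assumes E: "group E" and G: "group G" and p: "p \<in> hom E G"
    and s: "\<And>g. g \<in> carrier G \<Longrightarrow> s g \<in> carrier E" "\<And>g. g \<in> carrier G \<Longrightarrow> p (s g) = g"
    and central: "\<And>z e. z \<in> carrier E \<Longrightarrow> e \<in> carrier E \<Longrightarrow> p z = \<one>\<^bsub>G\<^esub> \<Longrightarrow> z \<otimes>\<^bsub>E\<^esub> e = e \<otimes>\<^bsub>E\<^esub> z"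
  shows "exterior_pairing (E\<lparr>carrier := derived E (carrier E)\<rparr>) G (\<lambda>g h. commutator E (s g) (s h)) p"
proof -
  interpret E: group E by fact
  interpret G: group G by fact
  interpret p: group_hom E G p using p by unfold_locales
  let ?K = "derived E (carrier E)"
  have K: "subgroup ?K E" by (rule E.derived_is_subgroup) simp
  have left: "commutator E a b = commutator E a' b"
    if [simp]: "a \<in> carrier E" "a' \<in> carrier E" "b \<in> carrier E" and eq: "p a = p a'" for a a' b
  proof -
    define z where "z = a \<otimes>\<^bsub>E\<^esub> inv\<^bsub>E\<^esub> a'"
    have z [simp]: "z \<in> carrier E" and pz: "p z = \<one>\<^bsub>G\<^esub>" using eq by (simp_all add: z_def)
    have a: "a = z \<otimes>\<^bsub>E\<^esub> a'" by (simp add: z_def E.m_assoc)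
    have "a' \<otimes>\<^bsub>E\<^esub> b \<otimes>\<^bsub>E\<^esub> inv\<^bsub>E\<^esub> a' \<otimes>\<^bsub>E\<^esub> inv\<^bsub>E\<^esub> z = inv\<^bsub>E\<^esub> z \<otimes>\<^bsub>E\<^esub> (a' \<otimes>\<^bsub>E\<^esub> b \<otimes>\<^bsub>E\<^esub> inv\<^bsub>E\<^esub> a')"
      using pz by (intro central[symmetric]) simp_all
    then show ?thesis
      unfolding a by (simp add: commutator_def E.inv_mult_group E.m_assoc)
  qed
  have comm_cong: "commutator E a b = commutator E a' b'"
    if "a \<in> carrier E" "a' \<in> carrier E" "b \<in> carrier E" "b' \<in> carrier E" "p a = p a'" "p b = p b'"
    for a a' b b'
  proof -
    have "commutator E b a' = commutator E b' a'" using that by (intro left)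
    then have "commutator E a' b = commutator E a' b'"
      using that by (metis E.inv_commutator)
    then show ?thesis using left[of a a' b] that by simp
  qed
  have sc: "commutator E (s (conjugate G g x)) (s (conjugate G g y)) =
      commutator E (conjugate E (s g) (s x)) (conjugate E (s g) (s y))"
    if "g \<in> carrier G" "x \<in> carrier G" "y \<in> carrier G" for g x y
    using that s by (intro comm_cong) (simp_all add: conjugate_def)
  have ws: "commutator E (s g) (s h) \<in> ?K" if "g \<in> carrier G" "h \<in> carrier G" for g h
    using that s unfolding derived_def commutator_def by (auto intro!: generate.incl)
  have K_eq: "derived_set E (carrier E) = {commutator E (s g) (s h) |g h. g \<in> carrier G \<and> h \<in> carrier G}"
  proof (intro Set.set_eqI iffI)
    fix c assume "c \<in> derived_set E (carrier E)"
    then obtain a b where ab: "a \<in> carrier E" "b \<in> carrier E" "c = commutator E a b"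
      by (auto simp: commutator_def)
    then have "c = commutator E (s (p a)) (s (p b))"
      using s by (simp only:) (intro comm_cong, simp_all)
    then show "c \<in> {commutator E (s g) (s h) |g h. g \<in> carrier G \<and> h \<in> carrier G}"
      using ab(1,2) by (intro CollectI exI[of _ "p a"] exI[of _ "p b"]) simp
  qed (use s in \<open>auto simp: commutator_def\<close>)
  interpret T: group "E\<lparr>carrier := ?K\<rparr>" by (rule subgroup.subgroup_is_group[OF K E])
  show ?thesis
  proof unfold_locales
    show "commutator E (s g) (s h) \<in> carrier (E\<lparr>carrier := ?K\<rparr>)"
      if "g \<in> carrier G" "h \<in> carrier G" for g h using ws[OF that] by simp
    show "commutator E (s (g \<otimes>\<^bsub>G\<^esub> g')) (s h) =
        commutator E (s (conjugate G g g')) (s (conjugate G g h)) \<otimes>\<^bsub>E\<lparr>carrier := ?K\<rparr>\<^esub> commutator E (s g) (s h)"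
      if [simp]: "g \<in> carrier G" "g' \<in> carrier G" "h \<in> carrier G" for g g' h
    proof -
      have "commutator E (s (g \<otimes>\<^bsub>G\<^esub> g')) (s h) = commutator E (s g \<otimes>\<^bsub>E\<^esub> s g') (s h)"
        using s by (intro comm_cong) simp_all
      also have "\<dots> = commutator E (conjugate E (s g) (s g')) (conjugate E (s g) (s h)) \<otimes>\<^bsub>E\<^esub> commutator E (s g) (s h)"
        using s by (simp add: commutator_def conjugate_def E.m_assoc E.inv_mult_group)
      finally show ?thesis by (simp add: sc)
    qed
    show "commutator E (s g) (s (h \<otimes>\<^bsub>G\<^esub> h')) =
        commutator E (s g) (s h) \<otimes>\<^bsub>E\<lparr>carrier := ?K\<rparr>\<^esub> commutator E (s (conjugate G h g)) (s (conjugate G h h'))"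
      if [simp]: "g \<in> carrier G" "h \<in> carrier G" "h' \<in> carrier G" for g h h'
    proof -
      have "commutator E (s g) (s (h \<otimes>\<^bsub>G\<^esub> h')) = commutator E (s g) (s h \<otimes>\<^bsub>E\<^esub> s h')"
        using s by (intro comm_cong) simp_all
      also have "\<dots> = commutator E (s g) (s h) \<otimes>\<^bsub>E\<^esub> commutator E (conjugate E (s h) (s g)) (conjugate E (s h) (s h'))"
        using s by (simp add: commutator_def conjugate_def E.m_assoc E.inv_mult_group)
      finally show ?thesis by (simp add: sc)
    qed
    show "p \<in> hom (E\<lparr>carrier := ?K\<rparr>) G"
      using subgroup.mem_carrier[OF K] by (intro homI) simp_all
    show "p (commutator E (s g) (s h)) = commutator G g h"
      if "g \<in> carrier G" "h \<in> carrier G" for g h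
      using that s by (simp add: commutator_def)
    show "carrier (E\<lparr>carrier := ?K\<rparr>) = generate (E\<lparr>carrier := ?K\<rparr>)
        {commutator E (s g) (s h) |g h. g \<in> carrier G \<and> h \<in> carrier G}"
    proof -
      let ?S = "{commutator E (s g) (s h) |g h. g \<in> carrier G \<and> h \<in> carrier G}"
      have "?S \<subseteq> ?K" using ws by blast
      then have "generate (E\<lparr>carrier := ?K\<rparr>) ?S = generate E ?S"
        by (rule E.generate_consistent[OF _ K])
      also have "\<dots> = ?K" by (simp add: derived_def K_eq)
      finally show ?thesis by simp
    qed
    show "commutator E (s g) (s g) = \<one>\<^bsub>E\<lparr>carrier := ?K\<rparr>\<^esub>" if "g \<in> carrier G" for g
      using that s by (simp add: commutator_def E.m_assoc)
  qed
qed

text \<open>The cocycle is not assumed normalized, whence the correction in the unit.\<close>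

definition cocycle_extension ::
    "('a, 'c) monoid_scheme \<Rightarrow> ('g, 'd) monoid_scheme \<Rightarrow> ('g \<Rightarrow> 'g \<Rightarrow> 'a) \<Rightarrow> ('a \<times> 'g) monoid" where
  "cocycle_extension A G f =
     \<lparr>carrier = carrier A \<times> carrier G,
      monoid.mult = (\<lambda>(a, x) (b, y). (a \<otimes>\<^bsub>A\<^esub> b \<otimes>\<^bsub>A\<^esub> f x y, x \<otimes>\<^bsub>G\<^esub> y)),
      monoid.one = (inv\<^bsub>A\<^esub> (f \<one>\<^bsub>G\<^esub> \<one>\<^bsub>G\<^esub>), \<one>\<^bsub>G\<^esub>)\<rparr>"

locale cocycle = A: comm_group A + G: group G
  for A (structure) and G :: "('g, 'd) monoid_scheme" +
  fixes f :: "'g \<Rightarrow> 'g \<Rightarrow> 'a"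
  assumes f_closed [simp]: "x \<in> carrier G \<Longrightarrow> y \<in> carrier G \<Longrightarrow> f x y \<in> carrier A"
    and f_cocycle: "x \<in> carrier G \<Longrightarrow> y \<in> carrier G \<Longrightarrow> z \<in> carrier G \<Longrightarrow>
      f y z \<otimes> f x (y \<otimes>\<^bsub>G\<^esub> z) = f (x \<otimes>\<^bsub>G\<^esub> y) z \<otimes> f x y"
begin

abbreviation E where "E \<equiv> cocycle_extension A G f"

abbreviation c0 where "c0 \<equiv> f \<one>\<^bsub>G\<^esub> \<one>\<^bsub>G\<^esub>"

lemma E_simps [simp]:
  "carrier E = carrier A \<times> carrier G"
  "(a, x) \<otimes>\<^bsub>E\<^esub> (b, y) = (a \<otimes> b \<otimes> f x y, x \<otimes>\<^bsub>G\<^esub> y)"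
  "\<one>\<^bsub>E\<^esub> = (inv c0, \<one>\<^bsub>G\<^esub>)"
  by (simp_all add: cocycle_extension_def)

lemma f_one:
  assumes "x \<in> carrier G"
  shows "f \<one>\<^bsub>G\<^esub> x = c0" "f x \<one>\<^bsub>G\<^esub> = c0"
  using f_cocycle[of "\<one>\<^bsub>G\<^esub>" "\<one>\<^bsub>G\<^esub>" x] f_cocycle[of x "\<one>\<^bsub>G\<^esub>" "\<one>\<^bsub>G\<^esub>"] assms by simp_all

lemma group_E: "group E"
proof (rule groupI)
  fix u v t assume uvt: "u \<in> carrier E" "v \<in> carrier E" "t \<in> carrier E"
  then obtain a x b y c z where [simp]: "u = (a, x)" "v = (b, y)" "t = (c, z)"
    and [simp]: "a \<in> carrier A" "b \<in> carrier A" "c \<in> carrier A"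
      "x \<in> carrier G" "y \<in> carrier G" "z \<in> carrier G" by auto
  have "a \<otimes> b \<otimes> f x y \<otimes> c \<otimes> f (x \<otimes>\<^bsub>G\<^esub> y) z = a \<otimes> b \<otimes> c \<otimes> (f (x \<otimes>\<^bsub>G\<^esub> y) z \<otimes> f x y)"
    by (simp add: A.m_ac)
  also have "\<dots> = a \<otimes> b \<otimes> c \<otimes> (f y z \<otimes> f x (y \<otimes>\<^bsub>G\<^esub> z))"
    by (simp add: f_cocycle)
  also have "\<dots> = a \<otimes> (b \<otimes> c \<otimes> f y z) \<otimes> f x (y \<otimes>\<^bsub>G\<^esub> z)"
    by (simp add: A.m_assoc)
  finally show "u \<otimes>\<^bsub>E\<^esub> v \<otimes>\<^bsub>E\<^esub> t = u \<otimes>\<^bsub>E\<^esub> (v \<otimes>\<^bsub>E\<^esub> t)"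
    by (simp add: G.m_assoc)
next
  fix u assume "u \<in> carrier E"
  then obtain a x where [simp]: "u = (a, x)" "a \<in> carrier A" "x \<in> carrier G" by auto
  have "inv c0 \<otimes> a \<otimes> c0 = a" using A.m_comm[of "inv c0" a] by (simp add: A.m_assoc)
  then show "\<one>\<^bsub>E\<^esub> \<otimes>\<^bsub>E\<^esub> u = u" by (simp add: f_one[of x])
  let ?k = "f (inv\<^bsub>G\<^esub> x) x"
  have "inv c0 \<otimes> inv ?k \<otimes> inv a \<otimes> a \<otimes> ?k = inv c0" by (simp add: A.m_assoc)
  then have "(inv c0 \<otimes> inv ?k \<otimes> inv a, inv\<^bsub>G\<^esub> x) \<otimes>\<^bsub>E\<^esub> u = \<one>\<^bsub>E\<^esub>" by simp
  then show "\<exists>v\<in>carrier E. v \<otimes>\<^bsub>E\<^esub> u = \<one>\<^bsub>E\<^esub>"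
    by (rule bexI) simp
qed auto

lemma snd_hom: "snd \<in> hom E G"
  by (rule homI) auto

lemma E_central:
  assumes "u \<in> carrier E" "v \<in> carrier E" "snd u = \<one>\<^bsub>G\<^esub>"
  shows "u \<otimes>\<^bsub>E\<^esub> v = v \<otimes>\<^bsub>E\<^esub> u"
proof -
  obtain a b y where "u = (a, \<one>\<^bsub>G\<^esub>)" "v = (b, y)" "a \<in> carrier A" "b \<in> carrier A" "y \<in> carrier G"
    using assms by (cases u; cases v) auto
  then show ?thesis using A.m_comm[of a b] by (simp add: f_one[of y])
qed

text \<open>The kernel of \<open>snd\<close> multiplies by
  \<open>(a, 1)(b, 1) = (a b c0, 1)\<close>; the factor \<open>inv c0\<close> turns the inclusion
  into a homomorphism.\<close>

definition emb where "emb a = (a \<otimes> inv c0, \<one>\<^bsub>G\<^esub>)"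

lemma emb_hom: "emb \<in> hom A E"
  by (rule homI) (auto simp: emb_def A.m_ac)

text \<open>So \<open>f\<close> is the factor set of the section sending \<open>x\<close> to
  \<open>(\<one>, x)\<close>.\<close>

lemma emb_f:
  "x \<in> carrier G \<Longrightarrow> y \<in> carrier G \<Longrightarrow> emb (f x y) \<otimes>\<^bsub>E\<^esub> (\<one>, x \<otimes>\<^bsub>G\<^esub> y) = (\<one>, x) \<otimes>\<^bsub>E\<^esub> (\<one>, y)"
  by (simp add: emb_def A.m_assoc f_one[of "x \<otimes>\<^bsub>G\<^esub> y"])

lemma emb_eq_one: "a \<in> carrier A \<Longrightarrow> emb a = \<one>\<^bsub>E\<^esub> \<Longrightarrow> a = \<one>"
  by (simp add: emb_def)

lemma E_pairing:
  "exterior_pairing (E\<lparr>carrier := derived E (carrier E)\<rparr>) G (\<lambda>g h. commutator E (\<one>, g) (\<one>, h)) snd"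
  by (rule central_extension_pairing[OF group_E G.is_group snd_hom _ _ E_central]) simp_all

end

section \<open>The bar complex and its tautological cocycle\<close>

context group
begin

abbreviation C1 where "C1 \<equiv> free_Abelian_group (carrier G)"
abbreviation C2 where "C2 \<equiv> free_Abelian_group (carrier G \<times> carrier G)"
abbreviation B2 where "B2 \<equiv> bar_boundaries2 G"

lemma keys_bar_boundary3:
  assumes "Poly_Mapping.keys c \<subseteq> carrier G \<times> carrier G \<times> carrier G"
  shows "Poly_Mapping.keys (bar_boundary3 G c) \<subseteq> carrier G \<times> carrier G"
  using assms
proof (induction c rule: frag_induction)
  case (one t)
  then show ?case
    by (auto simp: bar_boundary3_def dest!: subsetD[OF keys_diff] subsetD[OF keys_add])
next
  case (diff x y)
  then show ?case
    using keys_diff[of "bar_boundary3 G x" "bar_boundary3 G y"]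
    by (auto simp: bar_boundary3_def frag_extend_diff)
qed (simp add: bar_boundary3_def)

lemma keys_bar_boundary2:
  assumes "Poly_Mapping.keys c \<subseteq> carrier G \<times> carrier G"
  shows "Poly_Mapping.keys (bar_boundary2 G c) \<subseteq> carrier G"
  using assms
proof (induction c rule: frag_induction)
  case (one t)
  then show ?case
    by (auto simp: bar_boundary2_def dest!: subsetD[OF keys_diff] subsetD[OF keys_add])
next
  case (diff x y)
  then show ?case
    using keys_diff[of "bar_boundary2 G x" "bar_boundary2 G y"]
    by (auto simp: bar_boundary2_def frag_extend_diff)
qed (simp add: bar_boundary2_def)

lemma subgroup_B2: "subgroup B2 C2"
proof -
  have "group_hom (free_Abelian_group (carrier G \<times> carrier G \<times> carrier G)) C2 (bar_boundary3 G)"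
    using keys_bar_boundary3 unfolding group_hom_def group_hom_axioms_def
    by (auto simp: hom_def bar_boundary3_def frag_extend_add)
  then show ?thesis unfolding bar_boundaries2_def by (rule group_hom.img_is_subgroup)
qed

lemma coset_B2_eqI:
  assumes "Poly_Mapping.keys u \<subseteq> carrier G \<times> carrier G" "Poly_Mapping.keys v \<subseteq> carrier G \<times> carrier G"
    and "u - v \<in> B2"
  shows "B2 #>\<^bsub>C2\<^esub> u = B2 #>\<^bsub>C2\<^esub> v"
proof -
  interpret C2: comm_group C2 by (rule abelian_free_Abelian_group)
  have "u \<in> B2 #>\<^bsub>C2\<^esub> v"
    using assms(3) by (force simp: r_coset_def)
  then show ?thesis
    using assms(1,2) by (intro C2.repr_independence[symmetric] subgroup_B2) simp_all
qed

text \<open>The cocycle identity says precisely that the boundary of \<open>[x | y | z]\<close>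
  vanishes modulo \<open>B2\<close>.\<close>

lemma cocycle_bar: "cocycle (C2 Mod B2) G (\<lambda>x y. B2 #>\<^bsub>C2\<^esub> frag_of (x, y))"
proof -
  interpret C2: comm_group C2 by (rule abelian_free_Abelian_group)
  interpret B: normal B2 C2 using subgroup_B2 by (simp add: C2.normal_iff_subgroup)
  interpret A: comm_group "C2 Mod B2" by (rule C2.abelian_FactGroup[OF subgroup_B2])
  show ?thesis
  proof unfold_locales
    show "B2 #>\<^bsub>C2\<^esub> frag_of (x, y) \<in> carrier (C2 Mod B2)" if "x \<in> carrier G" "y \<in> carrier G" for x y
      using that by (auto simp: carrier_FactGroup)
    fix x y z assume [simp]: "x \<in> carrier G" "y \<in> carrier G" "z \<in> carrier G"
    let ?l = "frag_of (y, z) + frag_of (x, y \<otimes> z)" and ?r = "frag_of (x \<otimes> y, z) + frag_of (x, y)"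
    have "?l - ?r = bar_boundary3 G (frag_of (x, y, z))"
      by (simp add: bar_boundary3_def)
    then have "?l - ?r \<in> B2"
      unfolding bar_boundaries2_def by (intro image_eqI[where x = "frag_of (x, y, z)"]) simp_all
    then have "B2 #>\<^bsub>C2\<^esub> ?l = B2 #>\<^bsub>C2\<^esub> ?r"
      by (intro coset_B2_eqI) (auto dest!: subsetD[OF keys_add])
    then show "(B2 #>\<^bsub>C2\<^esub> frag_of (y, z)) \<otimes>\<^bsub>C2 Mod B2\<^esub> (B2 #>\<^bsub>C2\<^esub> frag_of (x, y \<otimes> z)) =
        (B2 #>\<^bsub>C2\<^esub> frag_of (x \<otimes> y, z)) \<otimes>\<^bsub>C2 Mod B2\<^esub> (B2 #>\<^bsub>C2\<^esub> frag_of (x, y))"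
      by (simp add: B.rcos_sum)
  qed
qed

text \<open>Modulo commutators, \<open>[x | y]\<close> becomes \<open>s x + s y - s (x y)\<close>, the image of its boundary under
  \<open>[x] \<mapsto> s x\<close>.\<close>

lemma emb_cycle_derived:
  defines "f \<equiv> \<lambda>x y. B2 #>\<^bsub>C2\<^esub> frag_of (x, y)"
  defines "E \<equiv> cocycle_extension (C2 Mod B2) G f"
  assumes c: "c \<in> bar_cycles2 G"
  shows "cocycle.emb (C2 Mod B2) G f (B2 #>\<^bsub>C2\<^esub> c) \<in> derived E (carrier E)"
proof -
  interpret C2: comm_group C2 by (rule abelian_free_Abelian_group)
  interpret B: normal B2 C2 using subgroup_B2 by (simp add: C2.normal_iff_subgroup)
  interpret e: cocycle "C2 Mod B2" G f unfolding f_def by (rule cocycle_bar)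
  have E: "E = e.E" by (simp add: E_def)
  interpret E: group E unfolding E by (rule e.group_E)
  let ?K = "derived E (carrier E)"
  have K: "?K \<lhd> E" by (rule E.derived_self_is_normal)
  interpret K: normal ?K E by (rule K)
  interpret Q: comm_group "E Mod ?K" by (rule E.derived_quot_is_comm_group)
  interpret k: group_hom E "E Mod ?K" "\<lambda>t. ?K #>\<^bsub>E\<^esub> t"
    by unfold_locales (rule K.r_coset_hom_Mod)
  define s where "s x = (\<one>\<^bsub>C2 Mod B2\<^esub>, x)" for x :: 'a
  have s: "s x \<in> carrier E" if "x \<in> carrier G" for x
    using that by (simp add: s_def E del: one_FactGroup)
  have "(\<lambda>x. ?K #>\<^bsub>E\<^esub> s x) ` carrier G \<subseteq> carrier (E Mod ?K)"
    using s by auto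
  then obtain \<sigma> where \<sigma>: "\<sigma> \<in> hom C1 (E Mod ?K)" "\<And>x. x \<in> carrier G \<Longrightarrow> \<sigma> (frag_of x) = ?K #>\<^bsub>E\<^esub> s x"
    using Q.free_Abelian_group_universal by blast
  interpret C1: group C1 by simp
  interpret \<sigma>: group_hom C1 "E Mod ?K" \<sigma>
    by unfold_locales (rule \<sigma>(1))
  have hA: "(\<lambda>c. B2 #>\<^bsub>C2\<^esub> c) \<in> hom C2 (C2 Mod B2)" by (rule B.r_coset_hom_Mod)
  have "e.emb \<in> hom (C2 Mod B2) E" unfolding E by (rule e.emb_hom)
  then have "(\<lambda>t. ?K #>\<^bsub>E\<^esub> t) \<circ> (e.emb \<circ> (\<lambda>c. B2 #>\<^bsub>C2\<^esub> c)) \<in> hom C2 (E Mod ?K)"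
    using Group.hom_compose[OF Group.hom_compose[OF hA] K.r_coset_hom_Mod] by simp
  then have "(\<lambda>c. ?K #>\<^bsub>E\<^esub> e.emb (B2 #>\<^bsub>C2\<^esub> c)) \<in> hom C2 (E Mod ?K)"
    by (simp add: o_def)
  then interpret \<rho>: group_hom C2 "E Mod ?K" "\<lambda>c. ?K #>\<^bsub>E\<^esub> e.emb (B2 #>\<^bsub>C2\<^esub> c)"
    by unfold_locales
  have emb: "e.emb (B2 #>\<^bsub>C2\<^esub> u) \<in> carrier E" if "Poly_Mapping.keys u \<subseteq> carrier G \<times> carrier G" for u
    using that hom_in_carrier[OF \<open>e.emb \<in> hom (C2 Mod B2) E\<close>] hom_in_carrier[OF hA] by simp
  \<comment> \<open>The support condition is carried along because the induction over differences
    does not supply it for the two terms.\<close>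
  have rs: "Poly_Mapping.keys u \<subseteq> carrier G \<times> carrier G \<and>
      ?K #>\<^bsub>E\<^esub> e.emb (B2 #>\<^bsub>C2\<^esub> u) = \<sigma> (bar_boundary2 G u)"
    if "Poly_Mapping.keys u \<subseteq> carrier G \<times> carrier G" for u
    using that
  proof (induction u rule: frag_induction)
    case zero
    have "bar_boundary2 G 0 = \<one>\<^bsub>C1\<^esub>" by (simp add: bar_boundary2_def)
    then show ?case using \<rho>.hom_one \<sigma>.hom_one by simp
  next
    case (diff u v)
    then have uv: "Poly_Mapping.keys u \<subseteq> carrier G \<times> carrier G" "Poly_Mapping.keys v \<subseteq> carrier G \<times> carrier G"
      by simp_all
    have "bar_boundary2 G (u - v) = bar_boundary2 G u \<otimes>\<^bsub>C1\<^esub> inv\<^bsub>C1\<^esub> (bar_boundary2 G v)"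
      using keys_bar_boundary2[OF uv(2)] by (simp add: bar_boundary2_def frag_extend_diff)
    moreover have "u - v = u \<otimes>\<^bsub>C2\<^esub> inv\<^bsub>C2\<^esub> v" using uv by simp
    moreover have "Poly_Mapping.keys (u - v) \<subseteq> carrier G \<times> carrier G"
      using uv keys_diff[of u v] by blast
    ultimately show ?case
      using diff uv keys_bar_boundary2 \<rho>.hom_mult[of u "inv\<^bsub>C2\<^esub> v"] \<rho>.hom_inv[of v]
        \<sigma>.hom_mult[of "bar_boundary2 G u" "inv\<^bsub>C1\<^esub> (bar_boundary2 G v)"] \<sigma>.hom_inv[of "bar_boundary2 G v"]
        C2.inv_closed[of v] C1.inv_closed[of "bar_boundary2 G v"]
      by (simp del: mult_free_Abelian_group inv_free_Abelian_group mult_FactGroup)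
  next
    case (one t)
    then obtain x y where t: "t = (x, y)" and [simp]: "x \<in> carrier G" "y \<in> carrier G" by auto
    let ?\<kappa> = "\<lambda>t. ?K #>\<^bsub>E\<^esub> t"
    have e: "e.emb (f x y) \<in> carrier E"
      using emb[of "frag_of (x, y)"] by (simp add: f_def)
    have "e.emb (f x y) \<otimes>\<^bsub>E\<^esub> s (x \<otimes> y) = s x \<otimes>\<^bsub>E\<^esub> s y"
      unfolding E s_def by (rule e.emb_f) simp_all
    then have "?\<kappa> (e.emb (f x y)) \<otimes>\<^bsub>E Mod ?K\<^esub> ?\<kappa> (s (x \<otimes> y)) = ?\<kappa> (s x) \<otimes>\<^bsub>E Mod ?K\<^esub> ?\<kappa> (s y)"
      using s e by (simp del: mult_FactGroup flip: k.hom_mult)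
    then have 1: "?\<kappa> (e.emb (f x y)) = ?\<kappa> (s x) \<otimes>\<^bsub>E Mod ?K\<^esub> ?\<kappa> (s y) \<otimes>\<^bsub>E Mod ?K\<^esub> inv\<^bsub>E Mod ?K\<^esub> ?\<kappa> (s (x \<otimes> y))"
      using s e by (subst Q.inv_solve_right) (simp_all del: mult_FactGroup)
    have "bar_boundary2 G (frag_of t) = frag_of x \<otimes>\<^bsub>C1\<^esub> frag_of y \<otimes>\<^bsub>C1\<^esub> inv\<^bsub>C1\<^esub> (frag_of (x \<otimes> y))"
      by (simp add: bar_boundary2_def t)
    then have "\<sigma> (bar_boundary2 G (frag_of t)) = ?\<kappa> (s x) \<otimes>\<^bsub>E Mod ?K\<^esub> ?\<kappa> (s y) \<otimes>\<^bsub>E Mod ?K\<^esub> inv\<^bsub>E Mod ?K\<^esub> ?\<kappa> (s (x \<otimes> y))"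
      using \<sigma>(2) \<sigma>.hom_mult[of "frag_of x" "frag_of y"] \<sigma>.hom_inv[of "frag_of (x \<otimes> y)"]
        \<sigma>.hom_mult[of "frag_of x \<otimes>\<^bsub>C1\<^esub> frag_of y" "inv\<^bsub>C1\<^esub> (frag_of (x \<otimes> y))"]
        C1.m_closed[of "frag_of x" "frag_of y"] C1.inv_closed[of "frag_of (x \<otimes> y)"]
      by (simp del: mult_free_Abelian_group inv_free_Abelian_group mult_FactGroup)
    then show ?case using 1 by (simp add: t f_def)
  qed
  have "?K #>\<^bsub>E\<^esub> e.emb (B2 #>\<^bsub>C2\<^esub> c) = \<sigma> (bar_boundary2 G c)"
    using rs[of c] c by (simp add: bar_cycles2_def kernel_def)
  also have "bar_boundary2 G c = \<one>\<^bsub>C1\<^esub>" using c by (simp add: bar_cycles2_def kernel_def)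
  also have "\<sigma> \<one>\<^bsub>C1\<^esub> = ?K" using \<sigma>.hom_one by simp
  finally have "?K #>\<^bsub>E\<^esub> e.emb (B2 #>\<^bsub>C2\<^esub> c) = ?K" .
  moreover have "Poly_Mapping.keys c \<subseteq> carrier G \<times> carrier G"
    using c by (simp add: bar_cycles2_def kernel_def)
  ultimately show ?thesis by (rule E.coset_join1[OF _ emb K.subgroup_axioms])
qed

end

lemma group_schur_multiplier:
  assumes "group G"
  shows "group (schur_multiplier G)"
proof -
  interpret group G by fact
  interpret C2: comm_group C2 by (rule abelian_free_Abelian_group)
  let ?S = "subgroup_generated C2 (bar_cycles2 G)"
  interpret S: comm_group ?S
    by (rule C2.abelian_subgroup_generated) unfold_locales
  have "subgroup B2 ?S"
    by (rule C2.subgroup_of_subgroup_generated[OF bar_boundaries2_subset_cycles2[OF assms] subgroup_B2])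
  then show ?thesis
    unfolding schur_multiplier_def by (intro comm_group.axioms(2) S.abelian_FactGroup)
qed

text \<open>By \<open>emb_cycle_derived\<close>, the class of a cycle lies in the derived subgroup
  of the tautological extension, where \<open>T_pow_q\<close> applies. As \<open>emb\<close> is
  injective, \<open>q\<close> times the cycle is a boundary.\<close>

lemma schur_multiplier_pow:
  assumes G: "group G" and L5: "lower_central_series G 5 = {\<one>\<^bsub>G\<^esub>}" and q: "odd q" "\<not> 15 dvd q"
    and exp: "\<And>x. x \<in> carrier G \<Longrightarrow> x [^]\<^bsub>G\<^esub> (q::nat) = \<one>\<^bsub>G\<^esub>"
    and X: "X \<in> carrier (schur_multiplier G)"
  shows "X [^]\<^bsub>schur_multiplier G\<^esub> q = \<one>\<^bsub>schur_multiplier G\<^esub>"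
proof -
  interpret group G by fact
  interpret C2: comm_group C2 by (rule abelian_free_Abelian_group)
  interpret B: normal B2 C2 using subgroup_B2 by (simp add: C2.normal_iff_subgroup)
  let ?f = "\<lambda>x y. B2 #>\<^bsub>C2\<^esub> frag_of (x, y)"
  interpret e: cocycle "C2 Mod B2" G ?f by (rule cocycle_bar)
  interpret E: group e.E by (rule e.group_E)
  interpret h: group_hom "C2 Mod B2" e.E e.emb
    by unfold_locales (rule e.emb_hom)
  let ?K = "derived e.E (carrier e.E)"
  interpret p: exterior_pairing5_exp "e.E\<lparr>carrier := ?K\<rparr>" G
    "\<lambda>g h. commutator e.E (\<one>\<^bsub>C2 Mod B2\<^esub>, g) (\<one>\<^bsub>C2 Mod B2\<^esub>, h)" snd q
    by (intro exterior_pairing5_exp.intro exterior_pairing5.intro e.E_pairing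
        exterior_pairing5_axioms.intro exterior_pairing5_exp_axioms.intro L5 q exp)
  let ?Z = "bar_cycles2 G" and ?S = "subgroup_generated C2 (bar_cycles2 G)"
  have cyc: "frag_cmul (int q) c \<in> B2" if c: "c \<in> ?Z" for c
  proof -
    have cC: "c \<in> carrier C2" using c by (simp add: bar_cycles2_def kernel_def)
    let ?a = "B2 #>\<^bsub>C2\<^esub> c"
    have a: "?a \<in> carrier (C2 Mod B2)" using cC by (auto simp: carrier_FactGroup)
    have "e.emb ?a [^]\<^bsub>e.E\<lparr>carrier := ?K\<rparr>\<^esub> q = \<one>\<^bsub>e.E\<lparr>carrier := ?K\<rparr>\<^esub>"
      using emb_cycle_derived[OF c] by (intro p.T_pow_q q) simp
    then have "e.emb ?a [^]\<^bsub>e.E\<^esub> q = \<one>\<^bsub>e.E\<^esub>"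
      using E.nat_pow_consistent[of "e.emb ?a" q ?K] by simp
    then have "e.emb (?a [^]\<^bsub>C2 Mod B2\<^esub> q) = \<one>\<^bsub>e.E\<^esub>"
      using h.hom_nat_pow[OF a, of q] by simp
    then have "?a [^]\<^bsub>C2 Mod B2\<^esub> q = \<one>\<^bsub>C2 Mod B2\<^esub>"
      by (intro e.emb_eq_one e.A.nat_pow_closed a)
    then have "B2 #>\<^bsub>C2\<^esub> (c [^]\<^bsub>C2\<^esub> q) = B2"
      using B.FactGroup_pow[OF cC, of q] by simp
    then have "c [^]\<^bsub>C2\<^esub> q \<in> B2"
      by (rule C2.coset_join1) (simp_all only: C2.nat_pow_closed cC subgroup_B2)
    then show ?thesis using cC by simp
  qed
  \<comment> \<open>The multiplier is a quotient of the group of cycles, not of all 2-chains, so the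
    result is transferred to cosets there.\<close>
  have Z: "subgroup ?Z C2" by (rule subgroup_bar_cycles2[OF G])
  interpret S: comm_group ?S
    by (rule C2.abelian_subgroup_generated) unfold_locales
  have BS: "subgroup B2 ?S"
    by (rule C2.subgroup_of_subgroup_generated[OF bar_boundaries2_subset_cycles2[OF G] subgroup_B2])
  interpret SB: normal B2 ?S using BS by (simp add: S.normal_iff_subgroup)
  obtain c where c: "c \<in> carrier ?S" "X = B2 #>\<^bsub>?S\<^esub> c"
    using X by (auto simp: schur_multiplier_def carrier_FactGroup)
  have cZ: "c \<in> ?Z" using c(1) unfolding subgroup.carrier_subgroup_generated_subgroup[OF Z] .
  then have cC: "c \<in> carrier C2" by (rule subgroup.mem_carrier[OF Z])
  have "c [^]\<^bsub>?S\<^esub> q \<in> B2"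
    using cyc[OF cZ] cC by (simp add: pow_subgroup_generated)
  then have "B2 #>\<^bsub>?S\<^esub> (c [^]\<^bsub>?S\<^esub> q) = B2"
    by (rule S.coset_join2[OF S.nat_pow_closed[OF c(1)] BS])
  then show ?thesis
    unfolding schur_multiplier_def c(2) SB.FactGroup_pow[OF c(1)] by simp
qed

lemma exterior_square_pow:
  assumes G: "group G" and L5: "lower_central_series G 5 = {\<one>\<^bsub>G\<^esub>}" and q: "odd q" "\<not> 15 dvd q"
    and exp: "\<And>x. x \<in> carrier G \<Longrightarrow> x [^]\<^bsub>G\<^esub> (q::nat) = \<one>\<^bsub>G\<^esub>"
    and t: "t \<in> carrier (exterior_square G)"
  shows "t [^]\<^bsub>exterior_square G\<^esub> q = \<one>\<^bsub>exterior_square G\<^esub>"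
proof -
  obtain w d where "exterior_pairing (exterior_square G) G w d"
    using exterior_square_pairing[OF G] .
  then interpret exterior_pairing5_exp "exterior_square G" G w d q
    by (intro exterior_pairing5_exp.intro exterior_pairing5.intro
        exterior_pairing5_axioms.intro exterior_pairing5_exp_axioms.intro L5 q exp)
  show ?thesis using q(2) t by (rule T_pow_q)
qed

theorem theorem4p6:
  fixes G :: "('a, 'b) monoid_scheme" and p :: nat
  assumes "prime p"
    and "finite_p_group p G"
    and "has_nilpotency_class G 5"
    and "odd p"
  shows "group_exponent (exterior_square G) dvd group_exponent G \<and>
         group_exponent (schur_multiplier G) dvd group_exponent G"
proof -
  have G: "group G" and "finite (carrier G)" using assms(2) by (auto simp: finite_p_group_def)
  interpret group G by fact
  obtain n where n: "order G = p ^ n" using assms(2) by (auto simp: finite_p_group_def)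
  have L5: "lower_central_series G 5 = {\<one>\<^bsub>G\<^esub>}"
    using assms(3) by (simp add: has_nilpotency_class_def)
  let ?q = "group_exponent G"
  have "?q dvd p ^ n"
    using n by (intro group_exponent_dvd) (simp flip: n add: pow_order_eq_1)
  have odd: "odd ?q"
    using \<open>?q dvd p ^ n\<close> \<open>odd p\<close> by (meson dvd_trans even_power)
  \<comment> \<open>The exponent divides a power of the prime \<open>p\<close>, which cannot be both
    3 and 5.\<close>
  have not15: "\<not> 15 dvd ?q"
  proof
    assume "15 dvd ?q"
    then have 15: "15 dvd p ^ n" using \<open>?q dvd p ^ n\<close> dvd_trans by blast
    have "r dvd p" if "prime r" "r dvd 15" for r :: nat
      using that 15 by (meson dvd_trans prime_dvd_power)
    then have "3 dvd p" "5 dvd p" by simp_all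
    then have "3 = p" "5 = p"
      using assms(1) by (simp_all add: primes_dvd_imp_eq)
    then show False by simp
  qed
  have "group (exterior_square G)"
    using exterior_square_pairing[OF G]
    by (metis exterior_pairing.axioms(1) tensor_pairing.axioms(1))
  then have "group_exponent (exterior_square G) dvd ?q"
    by (rule group.group_exponent_dvd)
      (rule exterior_square_pow[OF G L5 odd not15 pow_group_exponent])
  moreover have "group (schur_multiplier G)"
    by (rule group_schur_multiplier[OF G])
  then have "group_exponent (schur_multiplier G) dvd ?q"
    by (rule group.group_exponent_dvd)
      (rule schur_multiplier_pow[OF G L5 odd not15 pow_group_exponent])
  ultimately show ?thesis ..
qed

end
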